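(* Let $n\ge 2$ and let $V\in L^\infty_{loc}(\mathbb R^n)$ be real-valued. Assume that there exist constants $R>1$, $C>0$ and $M\in\mathbb R$ such that on $\{x\in\mathbb R^n: |x|>R\}$ the function $V$ is locally Lipschitz, $|V(x)|\le C|x|^M$, and, in polar coordinates $(r,\theta)$, $r>0$, $\theta\in S^{n-1}$, $$\frac{\partial}{\partial r}\left(r^2V\right)\ge 0 .$$ Let $u\in L^2_{loc}(\mathbb R^n)$ be a real-valued weak solution to $-\Delta u=Vu$ on $\mathbb R^n$. If $\lim_{r\to\infty} r^m\int_{|x|>r}|u|^2=0$ for every $m\ge 0$, then $u\equiv 0$.
   Context: A weak solution is a solution in the sense of distributions. The derivative $\frac{\partial}{\partial r}(r^2V)$ is understood almost everywhere (where it exists, $V$ being locally Lipschitz for $|x|>R$). Equality $u\equiv 0$ is understood almost everywhere. *)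

theory Defs
  imports "HOL-Analysis.Analysis"
begin

definition Linf_loc :: "(real ^ 'n \<Rightarrow> real) \<Rightarrow> bool" where
  "Linf_loc V \<longleftrightarrow> V \<in> borel_measurable lebesgue \<and>
     (\<forall>K. compact K \<longrightarrow> (\<exists>B. AE x in lebesgue. x \<in> K \<longrightarrow> \<bar>V x\<bar> \<le> B))"

definition L2_loc :: "(real ^ 'n \<Rightarrow> real) \<Rightarrow> bool" where
  "L2_loc u \<longleftrightarrow> u \<in> borel_measurable lebesgue \<and>
     (\<forall>K. compact K \<longrightarrow> set_integrable lebesgue K (\<lambda>x. (u x)\<^sup>2))"

definition locally_lipschitz_on :: "'a::metric_space set \<Rightarrow> ('a \<Rightarrow> 'b::metric_space) \<Rightarrow> bool" where
  "locally_lipschitz_on S f \<longleftrightarrow> (\<forall>x\<in>S. \<exists>d>0. \<exists>L. L-lipschitz_on (cball x d \<inter> S) f)"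

lemma locally_lipschitz_on_iff_local_lipschitz:
  "locally_lipschitz_on S f \<longleftrightarrow> local_lipschitz {0::real} S (\<lambda>_. f)"
  by (force simp: locally_lipschitz_on_def local_lipschitz_def)

definition partial_deriv :: "'n \<Rightarrow> (real ^ 'n \<Rightarrow> real) \<Rightarrow> real ^ 'n \<Rightarrow> real" where
  "partial_deriv i f x = frechet_derivative f (at x) (axis i 1)"

definition laplacian :: "(real ^ 'n \<Rightarrow> real) \<Rightarrow> real ^ 'n \<Rightarrow> real" where
  "laplacian f x = (\<Sum>i\<in>UNIV. partial_deriv i (partial_deriv i f) x)"

text \<open>Every iterated partial derivative, of any order, is differentiable everywhere (hence
  continuous); this is \<open>f \<in> C\<^sup>\<infinity>\<close>.\<close>

definition smooth :: "(real ^ 'n \<Rightarrow> real) \<Rightarrow> bool" where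
  "smooth f \<longleftrightarrow> (\<forall>is x. foldr partial_deriv is f differentiable (at x))"

definition test_function :: "(real ^ 'n \<Rightarrow> real) \<Rightarrow> bool" where
  "test_function \<phi> \<longleftrightarrow> smooth \<phi> \<and> compact (closure (support_on UNIV \<phi>))"

text \<open>Equality \<open>-\<Delta>u = Vu\<close> as distributions. Both integrands are integrable when
  \<open>u \<in> L\<^sup>2\<^sub>l\<^sub>o\<^sub>c\<close> and \<open>V \<in> L\<^sup>\<infinity>\<^sub>l\<^sub>o\<^sub>c\<close>; otherwise the definition is not meaningful. Since \<open>u\<close> and
  \<open>V\<close> are real-valued, real test functions suffice.\<close>

definition weak_solution :: "(real ^ 'n \<Rightarrow> real) \<Rightarrow> (real ^ 'n \<Rightarrow> real) \<Rightarrow> bool" where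
  "weak_solution V u \<longleftrightarrow> (\<forall>\<phi>. test_function \<phi> \<longrightarrow>
     (\<integral>x. u x * (- laplacian \<phi> x) \<partial>lebesgue) = (\<integral>x. (V x * u x) * \<phi> x \<partial>lebesgue))"

text \<open>At the point with polar coordinates \<open>(r, \<theta>)\<close>, the derivative of \<open>s \<mapsto> s\<^sup>2 V(s \<theta>)\<close> at
  \<open>s = r\<close> is \<open>D\<close>.\<close>

definition has_radial_deriv_r2V ::
    "(real ^ 'n \<Rightarrow> real) \<Rightarrow> real \<Rightarrow> real ^ 'n \<Rightarrow> real \<Rightarrow> bool" where
  "has_radial_deriv_r2V V r \<theta> D \<longleftrightarrow>
     ((\<lambda>s. s\<^sup>2 * V (s *\<^sub>R \<theta>)) has_real_derivative D) (at r)"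

end

theory Submission
  imports Defs
begin

text \<open>Let $E = x\cdot\nabla$ and let \<open>n\<close> be the dimension. The proof rests on one weighted inequality of
Carleman type with the weights \<open>(x \<bullet> x) ^ k\<close>, used twice: first near infinity, then globally.

For a compactly supported \<open>v\<close> of class $C^2$ and a natural number \<open>k\<close>, put
$\tau = n/2 + k$ and $Z = Ev + \tau v$; then $|x|^\tau Z$ is the Euler derivative of $|x|^\tau v$.
The divergence of the vector field
$$ |x|^{2k+2} Z\,\nabla v - {\textstyle\frac12} |x|^{2k+2} |\nabla v|^2 x + (k+1)\tau\, |x|^{2k} v^2 x $$
is $|x|^{2k+2} Z\,\Delta v + (2k+2) |x|^{2k} Z^2$. Integrating, and completing a square, gives
$$ (2k+2)^2 \int |x|^{2k} Z^2 \le \int |x|^{2k+4} (\Delta v)^2, $$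
and \<open>v\<close> is controlled by \<open>Z\<close> through a weighted Poincare inequality (\<open>weighted_poincare\<close>). The large
factor $(2k+2)^2$ beats every fixed bounded potential.

If \<open>v\<close> is supported in \<open>norm x > R\<close>, then $\Delta v$ may be replaced by $\Delta v + Vv$ (\<open>carleman\<close>): the
extra term $\int V |x|^{2k+2} v Z$ is half the derivative at $\lambda = 1$ of
$\lambda^{n+2k} \int V(x) |x|^{2k+2} v(\lambda x)^2\,dx$, and after the substitution $y = \lambda x$ this
is a nonincreasing function of $\lambda$ because $r^2 V$ is nondecreasing along rays (\<open>potential_term_nonpos\<close>).
So a potential of arbitrary polynomial size costs nothing.

Near infinity the inequality is applied to \<open>u\<close> times a cut-off that lives on \<open>a \<le> x \<bullet> x \<le> 2 * S\<close>. The
error at the outer edge tends to \<open>0\<close> as \<open>S\<close> grows because \<open>u\<close> decays faster than every power. The error at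
the inner edge is at most a constant times \<open>(a + 1) ^ k\<close>, while the left side carries the same power, up to a
constant, and the additional factor $(2k+2)^2$; letting \<open>k\<close> grow shows that \<open>u\<close> vanishes outside a ball
(\<open>vanishes_near_infinity\<close>). Then \<open>u\<close> has compact support and \<open>V\<close> is bounded there, so that the
inequality for the plain Laplacian, with one large \<open>k\<close>, forces \<open>u = 0\<close> (\<open>vanishes_of_compact_support\<close>).

Two points need care. First, \<open>u\<close> is merely in $L^2_{loc}$, so the inequality is proved for mollifications
of \<open>u\<close>. Cutting off produces gradient terms, but $\int \eta |\nabla v|^2 = \int \frac12 \Delta\eta\, v^2 -
\eta v \Delta v$ turns them into terms in \<open>v\<close> and $\Delta v$, which converge in $L^2_{loc}$
(\<open>weak_cutoff_inequality\<close>). Second, the sign of the radial derivative of $r^2 V$ is given only where that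
derivative exists. A Lipschitz function on an interval is differentiable almost everywhere, and almost
every ray meets the exceptional null set in a null set, so $r^2 V$ is monotone on almost every ray
(\<open>radially_nondecreasing\<close>).\<close>

section \<open>Monotonicity of Lipschitz functions\<close>

text \<open>The set \<open>G -` E\<close> is the image \<open>H ` E\<close>. Vitali's theorem covers \<open>E\<close>, up to a null set, by disjoint
short intervals on which \<open>H\<close> has slope at most \<open>p\<close>; these may be chosen inside an open set that is hardly
larger than \<open>E\<close>. The image of the remaining null set is null because \<open>H\<close> is Lipschitz.\<close>

lemma emeasure_image_le_of_small_slopes:
  fixes H G :: "real \<Rightarrow> real" and p B :: real
  assumes mono: "strict_mono H"
    and inv: "\<And>x. G (H x) = x" "\<And>y. H (G y) = y"
    and G: "continuous_on UNIV G"
    and lip: "\<And>x y. \<bar>H x - H y\<bar> \<le> B * \<bar>x - y\<bar>"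
    and E: "E \<in> sets borel" and p: "p > 0"
    and cov: "\<And>t \<delta>. t \<in> E \<Longrightarrow> \<delta> > 0 \<Longrightarrow>
               \<exists>c d. c \<le> t \<and> t \<le> d \<and> c < d \<and> d - c < \<delta> \<and> H d - H c \<le> p * (d - c)"
  shows "emeasure lborel (G -` E) \<le> ennreal p * emeasure lborel E"
proof -
  have GE: "G -` E = H ` E"
    using inv by (auto simp: image_iff) metis
  have GEm: "G -` E \<in> sets borel"
    using measurable_sets[OF borel_measurable_continuous_onI[OF G] E] by simp
  have ivl: "H ` {c..d} = {H c..H d}" for c d
  proof
    show "H ` {c..d} \<subseteq> {H c..H d}"
      using mono by (auto simp: strict_mono_less_eq)
    show "{H c..H d} \<subseteq> H ` {c..d}"
    proof
      fix y assume y: "y \<in> {H c..H d}"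
      then have "H c \<le> H (G y)" "H (G y) \<le> H d" by (auto simp: inv)
      then have "G y \<in> {c..d}" using mono by (simp add: strict_mono_less_eq)
      then show "y \<in> H ` {c..d}" using inv(2)[of y] by force
    qed
  qed
  have main: "emeasure lborel (G -` E) \<le> ennreal p * (emeasure lborel E + ennreal e)" if e: "e > 0" for e :: real
  proof -
    obtain U where U: "open U" "E \<subseteq> U" "emeasure lborel (U - E) < ennreal e"
      using outer_regular_lborel[OF E e] by blast
    have Um: "U \<in> sets borel" using U(1) by simp
    have "emeasure lborel U = emeasure lborel (E \<union> (U - E))"
      using U(2) by (metis Diff_partition)
    also have "\<dots> \<le> emeasure lborel E + emeasure lborel (U - E)"
      using E Um by (intro emeasure_subadditive) auto
    also have "\<dots> \<le> emeasure lborel E + ennreal e"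
      using U(3) by (intro add_left_mono) auto
    finally have UE: "emeasure lborel U \<le> emeasure lborel E + ennreal e" .
    define K where "K = {(c,d). c < d \<and> {c..d} \<subseteq> U \<and> H d - H c \<le> p * (d - c)}"
    define a r where "a = (\<lambda>(c,d). (c + d) / 2 :: real)" and "r = (\<lambda>(c,d). (d - c) / 2 :: real)"
    have ball: "cball (a i) (r i) = {fst i..snd i}" for i
      by (cases i) (auto simp: a_def r_def cball_def dist_real_def abs_le_iff field_simps)
    obtain C where C: "countable C" "C \<subseteq> K"
      "pairwise (\<lambda>i j. disjnt (cball (a i) (r i)) (cball (a j) (r j))) C"
      "negligible (E - (\<Union>i \<in> C. cball (a i) (r i)))"
    proof (rule Vitali_covering_theorem_cballs[of K r E a])
      show "0 < r i" if "i \<in> K" for i using that by (auto simp: K_def r_def)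
      fix x \<delta> :: real assume x: "x \<in> E" "0 < \<delta>"
      then obtain \<rho> where \<rho>: "\<rho> > 0" "ball x \<rho> \<subseteq> U"
        using U openE by blast
      obtain c d where cd: "c \<le> x" "x \<le> d" "c < d" "d - c < min \<rho> \<delta>" "H d - H c \<le> p * (d - c)"
        using cov[OF x(1), of "min \<rho> \<delta>"] x \<rho> by auto
      have "{c..d} \<subseteq> ball x \<rho>"
        using cd by (auto simp: dist_real_def)
      then have "(c,d) \<in> K" using cd \<rho> by (auto simp: K_def)
      moreover have "x \<in> cball (a (c,d)) (r (c,d))" using cd by (simp only: ball) auto
      moreover have "r (c,d) < \<delta>" using cd by (auto simp: r_def)
      ultimately show "\<exists>i. i \<in> K \<and> x \<in> cball (a i) (r i) \<and> r i < \<delta>" by blast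
    qed
    have disj: "disjoint_family_on (\<lambda>i. {fst i..snd i}) C"
      using C(3) unfolding pairwise_def disjoint_family_on_def disjnt_def ball by auto
    have "inj H" using mono by (rule strict_mono_imp_inj_on)
    have disjH: "disjoint_family_on (\<lambda>i. {H (fst i)..H (snd i)}) C"
      unfolding disjoint_family_on_def ivl[symmetric]
      using disj \<open>inj H\<close> unfolding disjoint_family_on_def
      by (metis image_Int image_empty)
    define Nn where "Nn = E - (\<Union>i \<in> C. {fst i..snd i})"
    have Nn: "negligible Nn" using C(4) by (simp add: Nn_def ball)
    have HN: "negligible (H ` Nn)"
    proof (rule negligible_locally_Lipschitz_image[OF _ Nn])
      show "\<exists>T B. open T \<and> x \<in> T \<and> (\<forall>y\<in>Nn \<inter> T. norm (H y - H x) \<le> B * norm (y - x))" for x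
        using lip by (intro exI[of _ UNIV] exI[of _ B]) auto
    qed simp
    have "G -` E \<subseteq> H ` Nn \<union> (\<Union>i\<in>C. {H (fst i)..H (snd i)})"
      unfolding GE ivl[symmetric] Nn_def by auto
    then have "emeasure lebesgue (G -` E) \<le> emeasure lebesgue (H ` Nn \<union> (\<Union>i\<in>C. {H (fst i)..H (snd i)}))"
      using HN C(1) by (intro emeasure_mono) (auto simp: negligible_iff_null_sets intro!: sets.countable_UN')
    also have "\<dots> \<le> emeasure lebesgue (H ` Nn) + emeasure lebesgue (\<Union>i\<in>C. {H (fst i)..H (snd i)})"
      using HN C(1) by (intro emeasure_subadditive) (auto simp: negligible_iff_null_sets intro!: sets.countable_UN')
    also have "emeasure lebesgue (H ` Nn) = 0"
      using HN by (auto simp: negligible_iff_null_sets)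
    also have "emeasure lebesgue (\<Union>i\<in>C. {H (fst i)..H (snd i)}) = (\<integral>\<^sup>+i. emeasure lebesgue {H (fst i)..H (snd i)} \<partial>count_space C)"
      using C(1) disjH by (intro emeasure_UN_countable) auto
    also have "\<dots> \<le> (\<integral>\<^sup>+i. ennreal p * emeasure lborel {fst i..snd i} \<partial>count_space C)"
    proof (rule nn_integral_mono)
      fix i assume "i \<in> space (count_space C)"
      then have i: "fst i < snd i" "H (snd i) - H (fst i) \<le> p * (snd i - fst i)"
        using C(2) by (auto simp: K_def)
      then show "emeasure lebesgue {H (fst i)..H (snd i)} \<le> ennreal p * emeasure lborel {fst i..snd i}"
        using mono p by (simp add: strict_mono_less_eq ennreal_mult[symmetric])
    qed
    also have "\<dots> = ennreal p * (\<integral>\<^sup>+i. emeasure lborel {fst i..snd i} \<partial>count_space C)"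
      by (rule nn_integral_cmult) simp
    also have "(\<integral>\<^sup>+i. emeasure lborel {fst i..snd i} \<partial>count_space C) = emeasure lborel (\<Union>i\<in>C. {fst i..snd i})"
      using C(1) disj by (intro emeasure_UN_countable[symmetric]) auto
    also have "\<dots> \<le> emeasure lborel U"
      using C(2) Um by (intro emeasure_mono) (fastforce simp: K_def)+
    also have "\<dots> \<le> emeasure lborel E + ennreal e" by (rule UE)
    finally show ?thesis using GEm by (simp add: mult_left_mono)
  qed
  show ?thesis
  proof (rule ennreal_le_epsilon)
    fix e :: real assume "0 < e"
    then have "emeasure lborel (G -` E) \<le> ennreal p * (emeasure lborel E + ennreal (e/p))"
      using p by (intro main) auto
    also have "\<dots> = ennreal p * emeasure lborel E + ennreal e"
      using p \<open>0 < e\<close> by (simp add: distrib_left ennreal_mult[symmetric])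
    finally show "emeasure lborel (G -` E) \<le> ennreal p * emeasure lborel E + ennreal e" .
  qed
qed

text \<open>Adding a large multiple of the identity turns \<open>f\<close> into a bi-Lipschitz homeomorphism \<open>H\<close> of the line. On the
set of points with difference quotients of \<open>H\<close> below \<open>p\<close> and above \<open>q > p\<close> at arbitrarily small scales, the preceding
lemma, applied to \<open>H\<close> and to its inverse, shows that \<open>H\<close> stretches measure by a factor at most \<open>p\<close> and at
least \<open>q\<close>, so this set is null. Hence \<open>H\<close> is differentiable almost everywhere, the hypothesis gives its slope a
lower bound almost everywhere, and a third use of the lemma integrates that bound.\<close>

lemma lipschitz_le_of_AE_deriv_nonneg:
  fixes f :: "real \<Rightarrow> real" and a b L :: real
  assumes ab: "a < b" and lip: "L-lipschitz_on {a..b} f"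
    and der: "AE t in lborel. t \<in> {a<..<b} \<longrightarrow> (\<forall>D. (f has_real_derivative D) (at t) \<longrightarrow> D \<ge> 0)"
  shows "f a \<le> f b"
proof -
  \<comment> \<open>adding \<open>1\<close> keeps the constant positive when \<open>f\<close> is constant\<close>
  define K where "K = L + 1"
  have "L \<ge> 0" using lip lipschitz_on_nonneg by blast
  then have K: "K > 0" by (simp add: K_def)
  define H where "H t = f (max a (min b t)) + 2 * K * t" for t
  have bnd: "\<bar>f (max a (min b x)) - f (max a (min b y))\<bar> \<le> K * \<bar>x - y\<bar>" for x y
  proof -
    have "\<bar>f (max a (min b x)) - f (max a (min b y))\<bar> \<le> L * \<bar>max a (min b x) - max a (min b y)\<bar>"
      using lipschitz_onD[OF lip, of "max a (min b x)" "max a (min b y)"] ab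
      by (auto simp: dist_real_def)
    also have "\<dots> \<le> K * \<bar>x - y\<bar>"
      using \<open>L \<ge> 0\<close> by (intro mult_mono) (auto simp: K_def)
    finally show ?thesis .
  qed
  have lo: "K * (y - x) \<le> H y - H x" and up: "H y - H x \<le> 3 * K * (y - x)" if "x \<le> y" for x y
    using bnd[of y x] that by (auto simp: H_def algebra_simps)
  have mono: "strict_mono H"
  proof
    fix x y :: real assume "x < y"
    then show "H x < H y" using lo[of x y] K mult_pos_pos[of K "y - x"] by linarith
  qed
  have lipH: "\<bar>H x - H y\<bar> \<le> 3 * K * \<bar>x - y\<bar>" for x y
    using up[of x y] up[of y x] lo[of x y] lo[of y x] K mult_nonneg_nonneg[of K "\<bar>x - y\<bar>"]
    by (cases "x \<le> y") (auto simp: abs_if algebra_simps split: if_splits)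
  have contH: "continuous_on UNIV H"
  proof (rule lipschitz_on_continuous_on)
    show "(3 * K)-lipschitz_on UNIV H"
      using lipH K by (auto intro!: lipschitz_onI simp: dist_real_def)
  qed
  have "\<exists>x. H x = y" for y
  proof -
    define t where "t = \<bar>y - H 0\<bar> / K"
    have t: "t \<ge> 0" "K * t = \<bar>y - H 0\<bar>" using K by (auto simp: t_def)
    have "H (-t) \<le> y" "y \<le> H t" using lo[of "-t" 0] lo[of 0 t] t by auto
    then show ?thesis
      using IVT'[of H "-t" y t] continuous_on_subset[OF contH] t by auto
  qed
  then obtain G where HG: "\<And>y. H (G y) = y" by metis
  have GH: "G (H x) = x" for x
    using HG strict_mono_imp_inj_on[OF mono] by (metis injD)
  have monoG: "strict_mono G"
    by (rule strict_monoI) (metis HG mono strict_mono_less)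
  have lipG: "\<bar>G x - G y\<bar> \<le> (1 / K) * \<bar>x - y\<bar>" for x y
  proof -
    have "K * \<bar>G x - G y\<bar> \<le> \<bar>x - y\<bar>"
      using lo[of "G x" "G y"] lo[of "G y" "G x"] by (auto simp: HG abs_if)
    then show ?thesis using K by (simp add: field_simps)
  qed
  have contG: "continuous_on UNIV G"
  proof (rule lipschitz_on_continuous_on)
    show "(1/K)-lipschitz_on UNIV G"
      using lipG K by (auto intro!: lipschitz_onI simp: dist_real_def)
  qed
  define Q where "Q t s = (H s - H t) / (s - t)" for t s
  \<comment> \<open>points with difference quotients below \<open>p\<close>, respectively above \<open>q\<close>, at arbitrarily small scales\<close>
  define A where "A p = {t \<in> {a<..<b}. \<forall>n. \<exists>s. s \<noteq> t \<and> \<bar>s - t\<bar> < 1 / Suc n \<and> Q t s < p}" for p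
  define B where "B q = {t \<in> {a<..<b}. \<forall>n. \<exists>s. s \<noteq> t \<and> \<bar>s - t\<bar> < 1 / Suc n \<and> Q t s > q}" for q
  have opn: "open {t. s \<noteq> t \<and> \<bar>s - t\<bar> < e \<and> Q t s \<in> S}" if "open S" for s e S
  proof -
    have "open {t. s \<noteq> t \<and> \<bar>s - t\<bar> < e}"
      by (intro open_Collect_conj open_Collect_neq open_Collect_less continuous_intros)
    moreover have "continuous_on {t. s \<noteq> t \<and> \<bar>s - t\<bar> < e} (\<lambda>t. Q t s)"
      unfolding Q_def by (intro continuous_intros continuous_on_subset[OF contH]) auto
    ultimately have "open ({t. s \<noteq> t \<and> \<bar>s - t\<bar> < e} \<inter> (\<lambda>t. Q t s) -` S)"
      using that continuous_on_open_vimage by (metis Int_commute)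
    also have "{t. s \<noteq> t \<and> \<bar>s - t\<bar> < e} \<inter> (\<lambda>t. Q t s) -` S = {t. s \<noteq> t \<and> \<bar>s - t\<bar> < e \<and> Q t s \<in> S}"
      by auto
    finally show ?thesis .
  qed
  have Am: "A p \<in> sets borel" for p
  proof -
    have "A p = {a<..<b} \<inter> (\<Inter>n. \<Union>s. {t. s \<noteq> t \<and> \<bar>s - t\<bar> < 1 / Suc n \<and> Q t s \<in> {..<p}})"
      by (auto simp: A_def)
    moreover have "open (\<Union>s. {t. s \<noteq> t \<and> \<bar>s - t\<bar> < 1 / Suc n \<and> Q t s \<in> {..<p}})" for n
      by (intro open_UN ballI opn) auto
    ultimately show ?thesis by auto
  qed
  have Bm: "B p \<in> sets borel" for p
  proof -
    have "B p = {a<..<b} \<inter> (\<Inter>n. \<Union>s. {t. s \<noteq> t \<and> \<bar>s - t\<bar> < 1 / Suc n \<and> Q t s \<in> {p<..}})"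
      by (auto simp: B_def)
    moreover have "open (\<Union>s. {t. s \<noteq> t \<and> \<bar>s - t\<bar> < 1 / Suc n \<and> Q t s \<in> {p<..}})" for n
      by (intro open_UN ballI opn) auto
    ultimately show ?thesis by auto
  qed
  have ordQ: "\<exists>c d. c \<le> t \<and> t \<le> d \<and> c < d \<and> d - c = \<bar>s - t\<bar> \<and> H d - H c = Q t s * (d - c)"
    if "s \<noteq> t" for s t
  proof (cases "s < t")
    case True
    then show ?thesis by (intro exI[of _ s] exI[of _ t]) (auto simp: Q_def field_simps)
  next
    case False
    then show ?thesis using that by (intro exI[of _ t] exI[of _ s]) (auto simp: Q_def field_simps)
  qed
  have small: "\<exists>n. 1 / real (Suc n) < \<delta>" if "\<delta> > 0" for \<delta>
    using that by (metis nat_approx_posE)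
  \<comment> \<open>on \<open>A p\<close> the map \<open>H\<close> stretches measure by at most \<open>p\<close>, on \<open>B q\<close> by at least \<open>q\<close>\<close>
  have leA: "emeasure lborel (G -` E) \<le> ennreal p * emeasure lborel E"
    if E: "E \<in> sets borel" "E \<subseteq> A p" "p > 0" for E p
  proof (rule emeasure_image_le_of_small_slopes[OF mono GH HG contG lipH E(1,3)])
    fix t \<delta> :: real assume t: "t \<in> E" "\<delta> > 0"
    obtain n where n: "1 / real (Suc n) < \<delta>" using small t by blast
    obtain s where s: "s \<noteq> t" "\<bar>s - t\<bar> < 1 / Suc n" "Q t s < p"
      using t E(2) by (auto simp: A_def)
    obtain c d where cd: "c \<le> t" "t \<le> d" "c < d" "d - c = \<bar>s - t\<bar>" "H d - H c = Q t s * (d - c)"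
      using ordQ[OF s(1)] by blast
    have "Q t s * (d - c) \<le> p * (d - c)" using s cd by (intro mult_right_mono) auto
    then show "\<exists>c d. c \<le> t \<and> t \<le> d \<and> c < d \<and> d - c < \<delta> \<and> H d - H c \<le> p * (d - c)"
      using cd s n by (intro exI[of _ c] exI[of _ d]) auto
  qed
  have leB: "emeasure lborel E \<le> ennreal (1 / q) * emeasure lborel (G -` E)"
    if E: "E \<in> sets borel" "E \<subseteq> B q" "q > 0" for E q
  proof -
    have GE: "G -` E \<in> sets borel"
      using measurable_sets[OF borel_measurable_continuous_onI[OF contG] E(1)] by simp
    have "emeasure lborel (H -` (G -` E)) \<le> ennreal (1 / q) * emeasure lborel (G -` E)"
    proof (rule emeasure_image_le_of_small_slopes[OF monoG HG GH contH lipG GE])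
      show "1 / q > 0" using E by simp
      fix y \<delta> :: real assume y: "y \<in> G -` E" "\<delta> > 0"
      obtain n where n: "1 / real (Suc n) < \<delta> / (3 * K)" using small[of "\<delta> / (3 * K)"] y K by auto
      define t where "t = G y"
      have "t \<in> B q" using y E(2) by (auto simp: t_def)
      then obtain s where s: "s \<noteq> t" "\<bar>s - t\<bar> < 1 / Suc n" "Q t s > q"
        by (auto simp: B_def)
      obtain c d where cd: "c \<le> t" "t \<le> d" "c < d" "d - c = \<bar>s - t\<bar>" "H d - H c = Q t s * (d - c)"
        using ordQ[OF s(1)] by blast
      have "q * (d - c) \<le> Q t s * (d - c)" using s cd by (intro mult_right_mono) auto
      then have q: "d - c \<le> (1/q) * (H d - H c)" using cd E(3) by (simp add: field_simps)
      have "d - c < \<delta> / (3 * K)" using cd s n by linarith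
      then have "3 * K * (d - c) < \<delta>" using K by (simp add: field_simps)
      then have "H d - H c < \<delta>" using up[of c d] cd by linarith
      moreover have "H c \<le> y" "y \<le> H d" "H c < H d"
        using cd mono HG[of y] strict_mono_less_eq[OF mono] strict_mono_less[OF mono] by (metis t_def)+
      ultimately show "\<exists>c d. c \<le> y \<and> y \<le> d \<and> c < d \<and> d - c < \<delta> \<and> G d - G c \<le> (1/q) * (d - c)"
        using q by (intro exI[of _ "H c"] exI[of _ "H d"]) (auto simp: GH)
    qed
    moreover have "H -` (G -` E) = E" by (auto simp: GH)
    ultimately show ?thesis by simp
  qed
  have null: "emeasure lborel (A p \<inter> B q) = 0" if "0 < p" "p < q" for p q
  proof -
    let ?E = "A p \<inter> B q"
    have E: "?E \<in> sets borel" using Am Bm by auto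
    have "emeasure lborel ?E \<le> emeasure lborel {a..b}"
      by (intro emeasure_mono) (auto simp: A_def)
    then have "emeasure lborel ?E \<noteq> \<infinity>" using ab by (auto simp: top_unique)
    then obtain m where m: "emeasure lborel ?E = ennreal m" "m \<ge> 0"
      by (metis ennreal_cases infinity_ennreal_def)
    have "emeasure lborel ?E \<le> ennreal (1/q) * (ennreal p * emeasure lborel ?E)"
      using leB[of ?E q] leA[of ?E p] E that by (meson inf_le1 inf_le2 mult_left_mono order.trans order.strict_trans zero_le)
    then have "ennreal m \<le> ennreal (p / q * m)"
      using m that by (simp add: ennreal_mult[symmetric] mult.assoc)
    then have "m \<le> p / q * m" using m that by (subst (asm) ennreal_le_iff) auto
    then have "m * (q - p) \<le> 0" using that by (simp add: field_simps)
    then have "m = 0" using m that by (simp add: mult_le_0_iff)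
    then show ?thesis using m by simp
  qed
  have AEnull: "AE t in lborel. \<forall>p\<in>\<rat>. \<forall>q\<in>\<rat>. 0 < p \<and> p < q \<longrightarrow> t \<notin> A p \<inter> B q"
  proof -
    have "AE t in lborel. 0 < p \<and> p < q \<longrightarrow> t \<notin> A p \<inter> B q" for p q
    proof (cases "0 < p \<and> p < q")
      case True
      then show ?thesis using null[of p q] Am Bm
        by (intro AE_I[of _ _ "A p \<inter> B q"]) auto
    next
      case False
      then show ?thesis by (intro AE_I2) blast
    qed
    then show ?thesis unfolding AE_ball_countable[OF countable_rat] by blast
  qed
  have AEA: "AE t in lborel. \<forall>p. 0 < p \<and> p < 2 * K \<longrightarrow> t \<notin> A p"
    using AEnull der
  proof eventually_elim
    case (elim t)
    show ?case
    proof (intro allI impI notI)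
      fix p assume p: "0 < p \<and> p < 2 * K" and tA: "t \<in> A p"
      then have tab: "t \<in> {a<..<b}" by (auto simp: A_def)
      have ev: "eventually (\<lambda>s. p' \<le> Q t s) (at t)" if nA: "t \<notin> A p'" for p'
      proof -
        obtain n where n: "\<And>s. s \<noteq> t \<Longrightarrow> \<bar>s - t\<bar> < 1 / Suc n \<Longrightarrow> p' \<le> Q t s"
          using nA tab unfolding A_def not_less[symmetric] by blast
        then show ?thesis unfolding eventually_at
          by (intro exI[of _ "1 / Suc n"]) (auto simp: dist_real_def)
      qed
      have ev2: "eventually (\<lambda>s. Q t s \<le> p') (at t)" if nA: "t \<notin> B p'" for p'
      proof -
        obtain n where n: "\<And>s. s \<noteq> t \<Longrightarrow> \<bar>s - t\<bar> < 1 / Suc n \<Longrightarrow> Q t s \<le> p'"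
          using nA tab unfolding B_def not_less[symmetric] by blast
        then show ?thesis unfolding eventually_at
          by (intro exI[of _ "1 / Suc n"]) (auto simp: dist_real_def)
      qed
      have Amono: "t \<in> A p2" if "t \<in> A p1" "p1 \<le> p2" for p1 p2
        using that by (force simp: A_def)
      have QK: "K \<le> Q t s" if "s \<noteq> t" for s
        using ordQ[OF that] lo K by (metis diff_gt_0_iff_gt less_le mult_le_cancel_right_pos)
      \<comment> \<open>if \<open>H\<close> had quotients below \<open>2 * K\<close> frequently, the quotients would converge to this infimum, and \<open>f\<close> would have a negative derivative\<close>
      define l where "l = Inf {p. t \<in> A p}"
      have Kb: "K \<le> p'" if tA': "t \<in> A p'" for p'
      proof -
        obtain s where "s \<noteq> t" "Q t s < p'" using tA' unfolding A_def by blast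
        then show ?thesis using QK by force
      qed
      then have bdd: "bdd_below {p. t \<in> A p}" by (auto intro!: bdd_belowI)
      have lK: "K \<le> l" unfolding l_def using Kb tA by (intro cInf_greatest) auto
      have lp: "l \<le> p" unfolding l_def using tA bdd by (intro cInf_lower) auto
      have "(Q t \<longlongrightarrow> l) (at t)"
      proof (rule order_tendstoI)
        fix e assume "e < l"
        then obtain e' where e': "e < e'" "e' < l" using dense by blast
        then have "t \<notin> A e'" unfolding l_def using bdd cInf_lower[of e' "{p. t \<in> A p}"] by auto
        then show "eventually (\<lambda>s. e < Q t s) (at t)" using ev[of e'] e' by (auto elim: eventually_mono)
      next
        fix e assume "l < e"
        then obtain p' where p': "t \<in> A p'" "p' < e"
          unfolding l_def using cInf_less_iff[OF _ bdd] tA by auto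
        obtain p1 where p1: "p1 \<in> \<rat>" "p' < p1" "p1 < e" using Rats_dense_in_real[OF p'(2)] by blast
        obtain q1 where q1: "q1 \<in> \<rat>" "p1 < q1" "q1 < e" using Rats_dense_in_real[OF p1(3)] by blast
        have "t \<in> A p1" using Amono[OF p'(1)] p1 by simp
        moreover have "0 < p1" using Kb[OF p'(1)] K p1 by linarith
        ultimately have "t \<notin> B q1" using elim(1) p1 q1 by blast
        then show "eventually (\<lambda>s. Q t s < e) (at t)" using ev2[of q1] q1 by (auto elim: eventually_mono)
      qed
      then have "(H has_real_derivative l) (at t)"
        unfolding has_field_derivative_iff Q_def .
      then have "((\<lambda>s. H s - 2 * K * s) has_real_derivative (l - 2 * K)) (at t)"
        by (auto intro!: derivative_eq_intros)
      then have "(f has_real_derivative (l - 2 * K)) (at t)"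
      proof (rule has_field_derivative_transform_within_open)
        show "open {a<..<b}" "t \<in> {a<..<b}" using tab by auto
      qed (auto simp: H_def)
      then have "0 \<le> l - 2 * K" using elim(2) tab by blast
      then show False using lp p by linarith
    qed
  qed
  have key: "q * (b - a) \<le> H b - H a" if q: "0 < q" "q < 2 * K" for q
  proof -
    obtain p where p: "q < p" "p < 2 * K" using dense q(2) by blast
    let ?E = "{a<..<b} - A p"
    have Em: "?E \<in> sets borel" using Am by auto
    have sub: "?E \<subseteq> B q"
    proof
      fix t assume t: "t \<in> ?E"
      then obtain n where n: "\<And>s. s \<noteq> t \<Longrightarrow> \<bar>s - t\<bar> < 1 / Suc n \<Longrightarrow> p \<le> Q t s"
        unfolding A_def not_less[symmetric] by blast
      have "\<exists>s. s \<noteq> t \<and> \<bar>s - t\<bar> < 1 / Suc m \<and> Q t s > q" for m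
      proof -
        define s where "s = t + (1 / Suc (max n m)) / 2"
        have "s \<noteq> t" "\<bar>s - t\<bar> < 1 / Suc (max n m)" by (auto simp: s_def field_simps)
        moreover have "1 / real (Suc (max n m)) \<le> 1 / Suc n" "1 / real (Suc (max n m)) \<le> 1 / Suc m"
          by (auto intro!: divide_left_mono)
        ultimately show ?thesis using n[of s] p by (intro exI[of _ s]) auto
      qed
      then show "t \<in> B q" using t by (auto simp: B_def)
    qed
    have "AE t in lborel. t \<notin> A p" using AEA p q by (auto elim!: eventually_mono)
    then have "emeasure lborel ?E = emeasure lborel {a<..<b}"
      using Em by (intro emeasure_eq_AE) auto
    then have "ennreal (b - a) = emeasure lborel ?E" using ab by simp
    also have "\<dots> \<le> ennreal (1/q) * emeasure lborel (G -` ?E)"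
      using leB[OF Em sub q(1)] .
    also have "\<dots> \<le> ennreal (1/q) * emeasure lborel {H a..H b}"
    proof (intro mult_left_mono emeasure_mono)
      show "G -` ?E \<subseteq> {H a..H b}"
      proof
        fix y assume "y \<in> G -` ?E"
        then have "a \<le> G y" "G y \<le> b" by auto
        then have "H a \<le> H (G y)" "H (G y) \<le> H b" using strict_mono_less_eq[OF mono] by auto
        then show "y \<in> {H a..H b}" by (simp add: HG)
      qed
    qed auto
    also have "\<dots> = ennreal ((1/q) * (H b - H a))"
      using ab q strict_mono_less_eq[OF mono, of a b] by (simp add: ennreal_mult[symmetric])
    finally have "b - a \<le> (1/q) * (H b - H a)"
      using ab q strict_mono_less_eq[OF mono, of a b] by (subst (asm) ennreal_le_iff) auto
    then show ?thesis using q by (simp add: field_simps)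
  qed
  have "2 * K * (b - a) \<le> H b - H a"
  proof (rule ccontr)
    assume "\<not> ?thesis"
    then have "(H b - H a) / (b - a) < 2 * K" using ab by (simp add: field_simps)
    moreover have "0 \<le> (H b - H a) / (b - a)" using ab strict_mono_less_eq[OF mono, of a b] by simp
    ultimately obtain q where q: "(H b - H a) / (b - a) < q" "q < 2 * K" "0 < q"
      using dense by (metis le_less_trans)
    then show False using key[of q] ab by (simp add: field_simps)
  qed
  moreover have "H b - H a = f b - f a + 2 * K * (b - a)" using ab by (simp add: H_def algebra_simps)
  ultimately show ?thesis by simp
qed

section \<open>Monotonicity along rays\<close>

lemma lborel_scaleR:
  fixes f :: "'a::euclidean_space \<Rightarrow> ennreal"
  assumes "c > 0" and [measurable]: "f \<in> borel_measurable borel"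
  shows "(\<integral>\<^sup>+x. f x \<partial>lborel) = ennreal (c ^ DIM('a)) * (\<integral>\<^sup>+x. f (c *\<^sub>R x) \<partial>lborel)"
  using assms(1)
  by (subst lborel_affine[of c 0])
     (auto simp: nn_integral_density nn_integral_distr nn_integral_cmult)

lemma AE_lborel_scaleR:
  fixes P :: "'a::euclidean_space \<Rightarrow> bool"
  assumes "AE x in lborel. P x" "c > 0"
  shows "AE x in lborel. P (c *\<^sub>R x)"
proof -
  obtain N where N: "{x \<in> space lborel. \<not> P x} \<subseteq> N" "emeasure lborel N = 0" "N \<in> sets lborel"
    using AE_E[OF assms(1)] by blast
  have [measurable]: "N \<in> sets borel" using N by simp
  have Nm: "(\<lambda>x. c *\<^sub>R x) -` N \<in> sets borel"
    using measurable_sets[of "\<lambda>x::'a. c *\<^sub>R x" borel borel N] by simp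
  have "0 = (\<integral>\<^sup>+x. indicator N x \<partial>(lborel :: 'a measure))" using N by simp
  also have "\<dots> = ennreal (c ^ DIM('a)) * (\<integral>\<^sup>+x. indicator N (c *\<^sub>R x) \<partial>(lborel :: 'a measure))"
    by (rule lborel_scaleR) (use assms in auto)
  also have "(\<integral>\<^sup>+x. indicator N (c *\<^sub>R x) \<partial>(lborel :: 'a measure)) = (\<integral>\<^sup>+x. indicator ((\<lambda>x. c *\<^sub>R x) -` N) x \<partial>lborel)"
    by (intro nn_integral_cong) (auto simp: indicator_def)
  also have "\<dots> = emeasure lborel ((\<lambda>x. c *\<^sub>R x) -` N)" using Nm by simp
  finally have "emeasure lborel ((\<lambda>x::'a. c *\<^sub>R x) -` N) = 0"
    using assms(2) by (auto simp: mult_eq_0_iff)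
  then show ?thesis using N(1) Nm by (intro AE_I[of _ _ "(\<lambda>x. c *\<^sub>R x) -` N"]) auto
qed

text \<open>Fubini's theorem for the pairs of a factor and a point replaces polar coordinates: almost every
ray meets a null set in a null set.\<close>

lemma AE_lborel_AE_scaleR:
  fixes P :: "'a::euclidean_space \<Rightarrow> bool"
  assumes "AE x in lborel. P x"
  shows "AE y in lborel. AE t in lborel. 0 < t \<longrightarrow> P (t *\<^sub>R y)"
proof -
  obtain N where N: "{x \<in> space lborel. \<not> P x} \<subseteq> N" "emeasure lborel N = 0" "N \<in> sets lborel"
    using AE_E[OF assms(1)] by blast
  have [measurable]: "N \<in> sets borel" using N by simp
  have "AE x in lborel. x \<notin> N" using N by (intro AE_I[of _ _ N]) auto
  then have "AE y in lborel. 0 < t \<longrightarrow> t *\<^sub>R y \<notin> N" for t :: real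
    using AE_lborel_scaleR[of "\<lambda>x. x \<notin> N" t] by (cases "0 < t") auto
  then have *: "AE t in lborel. AE y in lborel. 0 < t \<longrightarrow> t *\<^sub>R y \<notin> N" by simp
  have "AE y in lborel. AE t in lborel. 0 < t \<longrightarrow> t *\<^sub>R y \<notin> N"
  proof (subst lborel_pair.AE_commute[symmetric])
    show "{x \<in> space (lborel \<Otimes>\<^sub>M lborel). 0 < fst x \<longrightarrow> fst x *\<^sub>R (snd x :: 'a) \<notin> N} \<in> sets ((lborel :: real measure) \<Otimes>\<^sub>M lborel)"
      by measurable
  qed (rule *)
  then show ?thesis
    by (rule eventually_mono) (use N(1) in \<open>auto elim!: eventually_mono\<close>)
qed

text \<open>The conclusion compares $r^2 V$ at the points \<open>y\<close> and \<open>l *\<^sub>R y\<close> of one ray, after division by the square of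
\<open>norm y\<close>.\<close>

lemma radially_nondecreasing:
  fixes V :: "real ^ 'n \<Rightarrow> real"
  assumes R: "R \<ge> 0" and lip: "locally_lipschitz_on {x. norm x > R} V"
    and der: "AE x in lborel. norm x > R \<longrightarrow>
           (\<forall>D. has_radial_deriv_r2V V (norm x) (x /\<^sub>R norm x) D \<longrightarrow> D \<ge> 0)"
    and l: "l > 1"
  shows "AE y in lborel. norm y > R \<longrightarrow> V y \<le> l\<^sup>2 * V (l *\<^sub>R y)"
  using AE_lborel_AE_scaleR[OF der]
proof eventually_elim
  case (elim y)
  show ?case
  proof
    assume y: "R < norm y"
    then have y0: "norm y > 0" using R by linarith
    define f where "f t = t\<^sup>2 * V (t *\<^sub>R y)" for t
    define S where "S = (\<lambda>t. t *\<^sub>R y) ` {1..l}"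
    have S: "compact S" unfolding S_def by (intro compact_continuous_image continuous_intros) auto
    have Ssub: "S \<subseteq> {x. norm x > R}"
    proof
      fix x assume "x \<in> S"
      then obtain t where t: "x = t *\<^sub>R y" "1 \<le> t" unfolding S_def by (auto simp del: scaleR_cancel_right)
      then have "1 * norm y \<le> norm x" using mult_right_mono[of 1 t "norm y"] by simp
      then show "x \<in> {x. norm x > R}" using y by simp
    qed
    have loc: "local_lipschitz {0::real} S (\<lambda>_. V)"
      using lip Ssub unfolding locally_lipschitz_on_iff_local_lipschitz
      by (rule local_lipschitz_subset[OF _ order_refl])
    obtain L where L: "L-lipschitz_on S V"
      using local_lipschitz_compact_implies_lipschitz[OF loc S] by (metis compact_sing continuous_on_const singletonI)
    obtain Bd where Bd: "\<And>x. x \<in> S \<Longrightarrow> \<bar>V x\<bar> \<le> Bd"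
      using compact_imp_bounded[OF compact_continuous_image[OF lipschitz_on_continuous_on[OF L] S]]
      by (auto simp: bounded_iff)
    have L0: "L \<ge> 0" using L lipschitz_on_nonneg by blast
    have B0: "Bd \<ge> 0" using Bd[of y] l unfolding S_def by (force simp: image_iff)
    have "(l\<^sup>2 * L * norm y + 2 * l * Bd)-lipschitz_on {1..l} f"
    proof (rule lipschitz_onI)
      fix s t assume s: "s \<in> {1..l}" and t: "t \<in> {1..l}"
      then have SS: "s *\<^sub>R y \<in> S" "t *\<^sub>R y \<in> S" by (auto simp: S_def)
      have "f s - f t = s\<^sup>2 * (V (s *\<^sub>R y) - V (t *\<^sub>R y)) + (s + t) * (s - t) * V (t *\<^sub>R y)"
        by (simp add: f_def power2_eq_square algebra_simps)
      then have "\<bar>f s - f t\<bar> \<le> s\<^sup>2 * \<bar>V (s *\<^sub>R y) - V (t *\<^sub>R y)\<bar> + (s + t) * \<bar>s - t\<bar> * \<bar>V (t *\<^sub>R y)\<bar>"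
        using s t by (auto simp: abs_mult intro!: order.trans[OF abs_triangle_ineq])
      also have "\<dots> \<le> l\<^sup>2 * (L * (\<bar>s - t\<bar> * norm y)) + (2 * l) * \<bar>s - t\<bar> * Bd"
      proof (intro add_mono mult_mono)
        show "\<bar>V (s *\<^sub>R y) - V (t *\<^sub>R y)\<bar> \<le> L * (\<bar>s - t\<bar> * norm y)"
          using lipschitz_onD[OF L SS] by (simp add: dist_norm scaleR_diff_left[symmetric])
      qed (use s t l L0 B0 Bd[OF SS(2)] in \<open>auto intro!: power_mono\<close>)
      finally show "dist (f s) (f t) \<le> (l\<^sup>2 * L * norm y + 2 * l * Bd) * dist s t"
        by (simp add: dist_real_def algebra_simps)
    qed (use l L0 B0 in auto)
    then have "f 1 \<le> f l"
    proof (rule lipschitz_le_of_AE_deriv_nonneg[OF l])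
      show "AE t in lborel. t \<in> {1<..<l} \<longrightarrow> (\<forall>D. (f has_real_derivative D) (at t) \<longrightarrow> D \<ge> 0)"
        using elim
      proof eventually_elim
        case (elim t)
        show ?case
        proof (intro impI allI)
          fix D assume t: "t \<in> {1<..<l}" and D: "(f has_real_derivative D) (at t)"
          have ty: "norm (t *\<^sub>R y) = t * norm y" using t by simp
          have dir: "(t *\<^sub>R y) /\<^sub>R (t * norm y) = y /\<^sub>R norm y"
            using t y0 by simp
          have "1 * norm y \<le> t * norm y" using t by (intro mult_right_mono) auto
          then have tR: "norm (t *\<^sub>R y) > R" using y unfolding ty by linarith
          have "((\<lambda>s. f (s / norm y)) has_real_derivative D * (1 / norm y)) (at (t * norm y))"
          proof (rule DERIV_chain2[where f = f and g = "\<lambda>s. s / norm y"])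
            show "(f has_real_derivative D) (at (t * norm y / norm y))" using D y0 by simp
            show "((\<lambda>s. s / norm y) has_real_derivative 1 / norm y) (at (t * norm y))"
              by (intro derivative_eq_intros) (use y0 in auto)
          qed
          then have "((\<lambda>s. (norm y)\<^sup>2 * f (s / norm y)) has_real_derivative (norm y)\<^sup>2 * (D * (1 / norm y))) (at (t * norm y))"
            by (rule DERIV_cmult)
          also have "(\<lambda>s. (norm y)\<^sup>2 * f (s / norm y)) = (\<lambda>s. s\<^sup>2 * V (s *\<^sub>R (y /\<^sub>R norm y)))"
            using y0 by (auto simp: f_def fun_eq_iff divide_inverse power_mult_distrib power_inverse)
          finally have "has_radial_deriv_r2V V (norm (t *\<^sub>R y)) ((t *\<^sub>R y) /\<^sub>R norm (t *\<^sub>R y)) ((norm y)\<^sup>2 * (D * (1 / norm y)))"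
            unfolding has_radial_deriv_r2V_def ty dir .
          then have "0 \<le> (norm y)\<^sup>2 * (D * (1 / norm y))" using elim t tR by auto
          then show "0 \<le> D" using y0 by (simp add: zero_le_mult_iff zero_le_divide_iff)
        qed
      qed
    qed
    then show "V y \<le> l\<^sup>2 * V (l *\<^sub>R y)" by (simp add: f_def)
  qed
qed

section \<open>The divergence theorem for compactly supported fields\<close>

lemma lborel_integral_translation:
  fixes f :: "'a::euclidean_space \<Rightarrow> real"
  assumes [measurable]: "f \<in> borel_measurable borel"
  shows "(\<integral>x. f (x + c) \<partial>lborel) = (\<integral>x. f x \<partial>lborel)"
proof -
  have "(\<integral>x. f x \<partial>lborel) = (\<integral>x. f x \<partial>(distr lborel borel ((+) c)))"
    by (simp add: lborel_distr_plus)
  also have "\<dots> = (\<integral>x. f (c + x) \<partial>lborel)"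
    by (rule integral_distr) auto
  finally show ?thesis by (simp add: add.commute)
qed

lemma integrable_compactly_supported:
  fixes f :: "'a::euclidean_space \<Rightarrow> real"
  assumes "continuous_on (cball 0 r) f" and "\<And>x. norm x > r \<Longrightarrow> f x = 0"
  shows "integrable lborel f"
proof -
  have "integrable lborel (\<lambda>x. indicator (cball 0 r) x *\<^sub>R f x)"
    by (rule borel_integrable_compact) (use assms in auto)
  also have "(\<lambda>x. indicator (cball 0 r) x *\<^sub>R f x) = f"
    using assms(2) by (force simp: indicator_def fun_eq_iff)
  finally show ?thesis .
qed

lemma bounded_of_compactly_supported:
  fixes f :: "'a::euclidean_space \<Rightarrow> 'b::real_normed_vector"
  assumes "continuous_on UNIV f" and "\<And>x. norm x > r \<Longrightarrow> f x = 0"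
  obtains B where "B \<ge> 0" "\<And>x. norm (f x) \<le> B"
proof -
  have "bounded (f ` cball 0 r)"
    by (intro compact_imp_bounded compact_continuous_image continuous_on_subset[OF assms(1)]) auto
  then obtain B where B: "\<And>x. x \<in> cball 0 r \<Longrightarrow> norm (f x) \<le> B"
    unfolding bounded_iff by blast
  show ?thesis
  proof (rule that[of "max B 0"])
    fix x show "norm (f x) \<le> max B 0"
      using B[of x] assms(2)[of x] by (cases "norm x \<le> r") (auto simp: le_max_iff_disj)
  qed simp
qed

lemma has_derivative_vanishing:
  fixes f :: "'a::real_normed_vector \<Rightarrow> 'b::real_normed_vector"
  assumes "(f has_derivative D) (at x)" and "\<And>y. norm y > r \<Longrightarrow> f y = 0" and "norm x > r"
  shows "D = (\<lambda>_. 0)"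
proof -
  have "open {y. norm (y :: 'a) > r}"
    by (intro open_Collect_less continuous_intros)
  then have "(f has_derivative (\<lambda>_. 0)) (at x)"
  proof (rule has_derivative_transform_within_open[rotated])
    show "((\<lambda>_. 0) has_derivative (\<lambda>_. 0)) (at x)" by (rule has_derivative_const)
  qed (use assms(2,3) in auto)
  then show ?thesis using assms(1) has_derivative_unique by blast
qed

lemma has_real_derivative_along_line:
  fixes f :: "'a::real_normed_vector \<Rightarrow> real"
  assumes "\<And>x. (f has_derivative D x) (at x)"
  shows "((\<lambda>t. f (x + t *\<^sub>R h)) has_real_derivative D (x + t *\<^sub>R h) h) (at t)"
proof -
  have "((\<lambda>t. f (x + t *\<^sub>R h)) has_derivative (\<lambda>s. D (x + t *\<^sub>R h) (s *\<^sub>R h))) (at t)"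
    by (rule has_derivative_compose[OF _ assms]) (auto intro!: derivative_eq_intros)
  moreover have "(\<lambda>s. D (x + t *\<^sub>R h) (s *\<^sub>R h)) = (\<lambda>s. D (x + t *\<^sub>R h) h * s)"
    using has_derivative_linear[OF assms] by (auto simp: linear_cmul)
  ultimately show ?thesis by (simp add: has_field_derivative_def)
qed

text \<open>The difference quotients of \<open>g\<close> in the direction \<open>e\<close> have integral zero by translation invariance; they
converge boundedly to the directional derivative.\<close>

lemma integral_directional_derivative_eq_0:
  fixes g :: "'a::euclidean_space \<Rightarrow> real"
  assumes der: "\<And>x. (g has_derivative G x) (at x)"
    and cont: "continuous_on UNIV (\<lambda>x. G x e)"
    and supp: "\<And>x. norm x > r \<Longrightarrow> g x = 0"
  shows "(\<integral>x. G x e \<partial>lborel) = 0"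
proof -
  have Gsupp: "G x e = 0" if "norm x > r" for x
    using has_derivative_vanishing[OF der supp that] by simp
  obtain B where B: "B \<ge> 0" "\<And>x. norm (G x e) \<le> B"
    using bounded_of_compactly_supported[OF cont Gsupp] by blast
  define h where "h n = 1 / real (Suc n)" for n
  define D where "D n x = (g (x + h n *\<^sub>R e) - g x) / h n" for n x
  have h: "h n > 0" "h n \<le> 1" for n by (auto simp: h_def)
  have h0: "h \<longlonglongrightarrow> 0" unfolding h_def by (rule LIMSEQ_Suc[OF lim_1_over_n])
  have gc: "continuous_on UNIV g"
    using der by (meson continuous_at_imp_continuous_on has_derivative_continuous)
  have gm[measurable]: "g \<in> borel_measurable borel"
    using gc by (rule borel_measurable_continuous_onI)
  have Gm[measurable]: "(\<lambda>x. G x e) \<in> borel_measurable borel"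
    using cont by (rule borel_measurable_continuous_onI)
  have gint: "integrable lborel g"
    using gc supp by (intro integrable_compactly_supported[of r]) (auto intro: continuous_on_subset)
  note line = has_real_derivative_along_line[of g G, OF der]
  have mvt: "\<bar>g (x + s *\<^sub>R e) - g x\<bar> \<le> s * B" if s: "s > 0" for x s
  proof -
    obtain z where "g (x + s *\<^sub>R e) - g (x + 0 *\<^sub>R e) = (s - 0) * G (x + z *\<^sub>R e) e"
      using MVT2[OF s line] by blast
    then show ?thesis using B(2)[of "x + z *\<^sub>R e"] s by (simp add: abs_mult)
  qed
  have "(\<lambda>n. \<integral>x. D n x \<partial>lborel) \<longlonglongrightarrow> (\<integral>x. G x e \<partial>lborel)"
  proof (rule integral_dominated_convergence)
    show "integrable lborel (\<lambda>x. indicator (cball 0 (r + norm e)) x *\<^sub>R B)"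
      by (rule borel_integrable_compact) auto
    show "AE x in lborel. (\<lambda>n. D n x) \<longlonglongrightarrow> G x e"
    proof (rule AE_I2)
      fix x
      have "((\<lambda>t. (g (x + t *\<^sub>R e) - g x) / t) \<longlongrightarrow> G x e) (at 0)"
        using line[of x e 0] unfolding has_field_derivative_iff by simp
      then show "(\<lambda>n. D n x) \<longlonglongrightarrow> G x e"
        unfolding D_def
        by (rule filterlim_compose) (use h0 h(1) in \<open>auto simp: filterlim_at less_imp_neq[symmetric]\<close>)
    qed
    show "AE x in lborel. norm (D n x) \<le> indicator (cball 0 (r + norm e)) x *\<^sub>R B" for n
    proof (rule AE_I2)
      fix x
      show "norm (D n x) \<le> indicator (cball 0 (r + norm e)) x *\<^sub>R B"
      proof (cases "norm x \<le> r + norm e")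
        case True
        have "\<bar>g (x + h n *\<^sub>R e) - g x\<bar> / h n \<le> B"
          using mvt[OF h(1)[of n]] h(1)[of n] by (simp only: pos_divide_le_eq mult.commute[of B])
        then have "\<bar>D n x\<bar> \<le> B" using h(1)[of n] by (simp only: D_def abs_divide abs_of_pos)
        then show ?thesis using True by (simp only: real_norm_def indicator_simps(1) mem_cball_0 scaleR_one)
      next
        case False
        have "norm (h n *\<^sub>R e) \<le> norm e" using h[of n] mult_right_mono[of "h n" 1 "norm e"] by simp
        moreover have "norm x \<le> norm (x + h n *\<^sub>R e) + norm (h n *\<^sub>R e)"
          using norm_triangle_ineq4[of "x + h n *\<^sub>R e" "h n *\<^sub>R e"] by simp
        ultimately have "norm (x + h n *\<^sub>R e) > r" "norm x > r" using False norm_ge_zero[of e] by linarith+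
        then show ?thesis using supp False by (simp add: D_def)
      qed
    qed
  qed (auto simp: D_def[abs_def])
  moreover have "(\<integral>x. D n x \<partial>lborel) = 0" for n
  proof -
    have "integrable lborel (\<lambda>x. g (x + h n *\<^sub>R e))"
    proof -
      have "integrable (distr lborel borel ((+) (h n *\<^sub>R e))) g" using gint by (simp add: lborel_distr_plus)
      then show ?thesis by (subst (asm) integrable_distr_eq) (auto simp: add.commute)
    qed
    then have "(\<integral>x. D n x \<partial>lborel) = ((\<integral>x. g (x + h n *\<^sub>R e) \<partial>lborel) - (\<integral>x. g x \<partial>lborel)) / h n"
      unfolding D_def using gint by simp
    then show ?thesis by (simp add: lborel_integral_translation)
  qed
  ultimately show ?thesis by (simp add: LIMSEQ_const_iff)
qed

text \<open>For the derivative of a vector field this is the divergence, for a Hessian it is the Laplacian.\<close>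

definition lintrace :: "('a::euclidean_space \<Rightarrow> 'a) \<Rightarrow> real" where
  "lintrace L = (\<Sum>b\<in>Basis. L b \<bullet> b)"

lemma lintrace_add: "lintrace (\<lambda>h. L h + L' h) = lintrace L + lintrace L'"
  by (simp add: lintrace_def inner_add_left sum.distrib)

lemma lintrace_diff: "lintrace (\<lambda>h. L h - L' h) = lintrace L - lintrace L'"
  by (simp add: lintrace_def inner_diff_left sum_subtractf)

lemma lintrace_scaleR: "lintrace (\<lambda>h. c *\<^sub>R L h) = c * lintrace L"
  by (simp add: lintrace_def sum_distrib_left)

lemma lintrace_id: "lintrace (\<lambda>h. h :: 'a::euclidean_space) = DIM('a)"
  by (simp add: lintrace_def)

text \<open>For a field \<open>f x *\<^sub>R F x\<close> this computes the part of the divergence that comes from \<open>f\<close>, without coordinates.\<close>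

lemma lintrace_rank_one:
  assumes "linear f"
  shows "lintrace (\<lambda>h. f h *\<^sub>R a) = f a"
proof -
  have "f a = f (\<Sum>b\<in>Basis. (a \<bullet> b) *\<^sub>R b)" by (simp add: euclidean_representation)
  also have "\<dots> = (\<Sum>b\<in>Basis. (a \<bullet> b) * f b)" using assms by (simp add: linear_sum linear_cmul)
  finally show ?thesis by (simp add: lintrace_def mult.commute)
qed

lemma divergence_theorem:
  fixes \<Phi> :: "'a::euclidean_space \<Rightarrow> 'a"
  assumes der: "\<And>x. (\<Phi> has_derivative D x) (at x)"
    and cont: "\<And>b. continuous_on UNIV (\<lambda>x. D x b)"
    and supp: "\<And>x. norm x > r \<Longrightarrow> \<Phi> x = 0"
  shows "(\<integral>x. lintrace (D x) \<partial>lborel) = 0"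
proof -
  have Dsupp: "D x b = 0" if "norm x > r" for x b
    using has_derivative_vanishing[OF der supp that] by simp
  have int: "integrable lborel (\<lambda>x. D x b \<bullet> b)" for b
    using Dsupp by (intro integrable_compactly_supported[of r] continuous_intros continuous_on_subset[OF cont]) auto
  have "(\<integral>x. D x b \<bullet> b \<partial>lborel) = 0" for b
  proof (rule integral_directional_derivative_eq_0[where g = "\<lambda>x. \<Phi> x \<bullet> b" and G = "\<lambda>x h. D x h \<bullet> b" and r = r])
    show "((\<lambda>x. \<Phi> x \<bullet> b) has_derivative (\<lambda>h. D x h \<bullet> b)) (at x)" for x
      by (intro has_derivative_inner_left der)
    show "continuous_on UNIV (\<lambda>x. D x b \<bullet> b)" by (intro continuous_intros cont)
  qed (use supp in auto)
  then show ?thesis unfolding lintrace_def using int by (simp add: Bochner_Integration.integral_sum)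
qed

text \<open>The gradient and the Hessian are carried as data, the latter as a symmetric linear map in each point, so that
divergences can be computed without coordinates.\<close>

definition C2_with :: "('a::euclidean_space \<Rightarrow> real) \<Rightarrow> ('a \<Rightarrow> 'a) \<Rightarrow> ('a \<Rightarrow> 'a \<Rightarrow> 'a) \<Rightarrow> bool" where
  "C2_with v g H \<longleftrightarrow>
     (\<forall>x. (v has_derivative (\<lambda>h. g x \<bullet> h)) (at x)) \<and>
     (\<forall>x. (g has_derivative H x) (at x)) \<and>
     (\<forall>x a b. H x a \<bullet> b = a \<bullet> H x b) \<and>
     (\<forall>b. continuous_on UNIV (\<lambda>x. H x b))"

lemma C2_withD:
  assumes "C2_with v g H"
  shows "(v has_derivative (\<lambda>h. g x \<bullet> h)) (at x)" "(g has_derivative H x) (at x)"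
    "H x a \<bullet> b = a \<bullet> H x b" "continuous_on S (\<lambda>x. H x b)"
    "continuous_on S v" "continuous_on S g" "continuous_on S (\<lambda>x. lintrace (H x))" "linear (H x)"
proof -
  show v: "(v has_derivative (\<lambda>h. g x \<bullet> h)) (at x)" and g: "(g has_derivative H x) (at x)" for x
    using assms unfolding C2_with_def by blast+
  show "H x a \<bullet> b = a \<bullet> H x b" using assms unfolding C2_with_def by blast
  show H: "continuous_on S (\<lambda>x. H x b)" for b
    using assms continuous_on_subset unfolding C2_with_def by blast
  show "continuous_on S v" "continuous_on S g"
    using v g by (meson continuous_at_imp_continuous_on has_derivative_continuous)+
  show "continuous_on S (\<lambda>x. lintrace (H x))"
    unfolding lintrace_def by (intro continuous_intros H)
  show "linear (H x)" using g has_derivative_linear by blast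
qed

lemma C2_with_vanishing:
  assumes C: "C2_with v g H" and supp: "\<And>x. norm x > r \<Longrightarrow> v x = 0" and x: "norm x > r"
  shows "v x = 0" "g x = 0" "H x = (\<lambda>_. 0)" "lintrace (H x) = 0"
proof -
  have g0: "g y = 0" if "norm y > r" for y
    using fun_cong[OF has_derivative_vanishing[OF C2_withD(1)[OF C] supp that], of "g y"] by simp
  then show "v x = 0" "g x = 0" using supp x by auto
  show "H x = (\<lambda>_. 0)" using has_derivative_vanishing[OF C2_withD(2)[OF C] g0 x] .
  then show "lintrace (H x) = 0" by (simp add: lintrace_def)
qed

lemma C2_with_mult:
  assumes 1: "C2_with v g H" and 2: "C2_with v' g' H'"
  shows "C2_with (\<lambda>x. v x * v' x) (\<lambda>x. v x *\<^sub>R g' x + v' x *\<^sub>R g x)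
     (\<lambda>x h. (v x *\<^sub>R H' x h + (g x \<bullet> h) *\<^sub>R g' x) + (v' x *\<^sub>R H x h + (g' x \<bullet> h) *\<^sub>R g x))"
  unfolding C2_with_def
proof (intro conjI allI)
  note d = C2_withD[OF 1] C2_withD[OF 2]
  show "((\<lambda>x. v x * v' x) has_derivative (\<bullet>) (v x *\<^sub>R g' x + v' x *\<^sub>R g x)) (at x)" for x
    by (rule has_derivative_eq_rhs[OF has_derivative_mult[OF d(1) d(9)]])
       (auto simp: inner_add_left fun_eq_iff)
  show "((\<lambda>x. v x *\<^sub>R g' x + v' x *\<^sub>R g x) has_derivative
      (\<lambda>h. (v x *\<^sub>R H' x h + (g x \<bullet> h) *\<^sub>R g' x) + (v' x *\<^sub>R H x h + (g' x \<bullet> h) *\<^sub>R g x))) (at x)" for x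
    by (intro has_derivative_add has_derivative_scaleR d)
  show "((v x *\<^sub>R H' x a + (g x \<bullet> a) *\<^sub>R g' x) + (v' x *\<^sub>R H x a + (g' x \<bullet> a) *\<^sub>R g x)) \<bullet> b
      = a \<bullet> ((v x *\<^sub>R H' x b + (g x \<bullet> b) *\<^sub>R g' x) + (v' x *\<^sub>R H x b + (g' x \<bullet> b) *\<^sub>R g x))" for x a b
    using d(3)[of x a b] d(11)[of x a b] by (simp add: inner_add_left inner_add_right inner_commute)
  show "continuous_on UNIV (\<lambda>x. (v x *\<^sub>R H' x b + (g x \<bullet> b) *\<^sub>R g' x) + (v' x *\<^sub>R H x b + (g' x \<bullet> b) *\<^sub>R g x))" for b
    by (intro continuous_intros d)
qed

lemma lintrace_C2_mult:
  "lintrace (\<lambda>h. (a *\<^sub>R H' h + (g \<bullet> h) *\<^sub>R g') + (a' *\<^sub>R H h + (g' \<bullet> h) *\<^sub>R g))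
     = a * lintrace H' + a' * lintrace H + 2 * (g \<bullet> g')"
proof -
  have "linear (\<lambda>h. g \<bullet> h)" "linear (\<lambda>h. g' \<bullet> h)"
    by (auto intro!: bounded_linear.linear bounded_linear_inner_right)
  then show ?thesis
    by (simp add: lintrace_add lintrace_scaleR lintrace_rank_one inner_commute)
qed

text \<open>The field \<open>(\<eta> x * v x) *\<^sub>R g x - ((v x)\<^sup>2 / 2) *\<^sub>R g' x\<close> has the difference of the two integrands as its
divergence. This bounds the gradient of \<open>v\<close> in the mean by \<open>v\<close> and its Laplacian.\<close>

lemma integral_gradient_square:
  assumes v: "C2_with v g H" and e: "C2_with \<eta> g' H'" and supp: "\<And>x. norm x > r \<Longrightarrow> \<eta> x = 0"
  shows "(\<integral>x. \<eta> x * (g x \<bullet> g x) \<partial>lborel)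
     = (\<integral>x. lintrace (H' x) * (v x)\<^sup>2 / 2 - \<eta> x * v x * lintrace (H x) \<partial>lborel)"
proof -
  note d = C2_withD[OF v] C2_withD[OF e]
  have z: "\<eta> x = 0" "g' x = 0" "lintrace (H' x) = 0" if "norm x > r" for x
    using C2_with_vanishing[OF e supp that] by auto
  define D where "D x h = ((\<eta> x * v x) *\<^sub>R H x h + (\<eta> x * (g x \<bullet> h) + (g' x \<bullet> h) * v x) *\<^sub>R g x)
      - (((v x)\<^sup>2 / 2) *\<^sub>R H' x h + (v x * (g x \<bullet> h)) *\<^sub>R g' x)" for x h
  have "(\<integral>x. lintrace (D x) \<partial>lborel) = 0"
  proof (rule divergence_theorem)
    show "((\<lambda>x. (\<eta> x * v x) *\<^sub>R g x - ((v x)\<^sup>2 / 2) *\<^sub>R g' x) has_derivative D x) (at x)" for x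
    proof -
      have "((\<lambda>x. (1/2) * (v x * v x)) has_derivative (\<lambda>h. (1/2) * (v x * (g x \<bullet> h) + (g x \<bullet> h) * v x))) (at x)"
        by (intro has_derivative_mult_right has_derivative_mult d(1))
      then have "((\<lambda>x. (v x)\<^sup>2 / 2) has_derivative (\<lambda>h. v x * (g x \<bullet> h))) (at x)"
        by (simp add: power2_eq_square mult.commute)
      then show ?thesis
        unfolding D_def by (intro has_derivative_diff has_derivative_scaleR has_derivative_mult d)
    qed
    show "continuous_on UNIV (\<lambda>x. D x b)" for b
      unfolding D_def by (intro continuous_intros d) auto
    show "(\<eta> x * v x) *\<^sub>R g x - ((v x)\<^sup>2 / 2) *\<^sub>R g' x = 0" if "norm x > r" for x
      using z[OF that] by simp
  qed
  moreover have "lintrace (D x) = \<eta> x * (g x \<bullet> g x) - (lintrace (H' x) * (v x)\<^sup>2 / 2 - \<eta> x * v x * lintrace (H x))" for x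
  proof -
    have l: "linear (\<lambda>h. \<eta> x * (g x \<bullet> h) + (g' x \<bullet> h) * v x)" "linear (\<lambda>h. v x * (g x \<bullet> h))"
      by (auto intro!: linearI simp: inner_add_right algebra_simps)
    show ?thesis
      unfolding D_def lintrace_diff lintrace_add lintrace_scaleR l[THEN lintrace_rank_one]
      by (simp add: inner_commute algebra_simps)
  qed
  moreover have "integrable lborel (\<lambda>x. \<eta> x * (g x \<bullet> g x))"
    using z by (intro integrable_compactly_supported[of r] continuous_intros d) auto
  moreover have "integrable lborel (\<lambda>x. lintrace (H' x) * (v x)\<^sup>2 / 2 - \<eta> x * v x * lintrace (H x))"
    using z by (intro integrable_compactly_supported[of r] continuous_intros d) auto
  ultimately show ?thesis by simp
qed

section \<open>The Carleman inequality\<close>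

lemma has_derivative_inner_self_power:
  fixes x :: "'a::euclidean_space"
  shows "((\<lambda>x. (x \<bullet> x) ^ j) has_derivative (\<lambda>h. (2 * real j * (x \<bullet> x) ^ (j - 1)) * (x \<bullet> h))) (at x)"
  by (rule has_derivative_eq_rhs, rule has_derivative_power, rule has_derivative_inner; (rule has_derivative_ident)?)
     (auto simp: fun_eq_iff inner_commute algebra_simps)

lemma power_inner_self_Suc: "real j * (x \<bullet> x) ^ (j - 1) * (x \<bullet> x) = real j * (x \<bullet> x) ^ j"
  by (cases j) auto

text \<open>This is the divergence theorem for the field \<open>((x \<bullet> x) ^ j * (v x)\<^sup>2) *\<^sub>R x\<close>.\<close>

lemma integral_conjugated_euler_weight:
  fixes v :: "'a::euclidean_space \<Rightarrow> real" and k j :: nat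
  assumes v: "C2_with v g H" and supp: "\<And>x. norm x > r \<Longrightarrow> v x = 0"
  defines "Z \<equiv> (\<lambda>x. x \<bullet> g x + (real DIM('a) / 2 + real k) * v x)"
  shows "(\<integral>x. (x \<bullet> x) ^ j * (v x * Z x) \<partial>lborel) = (real k - real j) * (\<integral>x. (x \<bullet> x) ^ j * (v x)\<^sup>2 \<partial>lborel)"
proof -
  note d = C2_withD[OF v]
  have z: "v x = 0" "g x = 0" if "norm x > r" for x
    using C2_with_vanishing[OF v supp that] by auto
  define f where "f x = (x \<bullet> x) ^ j * (v x * v x)" for x
  define f' where "f' x h = (x \<bullet> x) ^ j * (v x * (g x \<bullet> h) + (g x \<bullet> h) * v x)
     + ((2 * real j * (x \<bullet> x) ^ (j - 1)) * (x \<bullet> h)) * (v x * v x)" for x h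
  have df: "(f has_derivative f' x) (at x)" for x
    unfolding f_def f'_def by (intro has_derivative_mult has_derivative_inner_self_power d)
  have "(\<integral>x. lintrace (\<lambda>h. f x *\<^sub>R h + f' x h *\<^sub>R x) \<partial>lborel) = 0"
  proof (rule divergence_theorem)
    show "((\<lambda>x. f x *\<^sub>R x) has_derivative (\<lambda>h. f x *\<^sub>R h + f' x h *\<^sub>R x)) (at x)" for x
      by (intro has_derivative_scaleR df has_derivative_ident)
    show "continuous_on UNIV (\<lambda>x. f x *\<^sub>R b + f' x b *\<^sub>R x)" for b
      unfolding f_def f'_def by (intro continuous_intros d)
    show "f x *\<^sub>R x = 0" if "norm x > r" for x using z[OF that] by (simp add: f_def)
  qed
  moreover have "lintrace (\<lambda>h. f x *\<^sub>R h + f' x h *\<^sub>R x)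
      = 2 * ((x \<bullet> x) ^ j * (v x * Z x)) - 2 * (real k - real j) * ((x \<bullet> x) ^ j * (v x)\<^sup>2)" for x
  proof -
    have "lintrace (\<lambda>h. f x *\<^sub>R h + f' x h *\<^sub>R x) = f x * DIM('a) + f' x x"
      by (simp add: lintrace_add lintrace_scaleR lintrace_id lintrace_rank_one[OF has_derivative_linear[OF df]])
    also have "f' x x = (x \<bullet> x) ^ j * (2 * v x * (x \<bullet> g x)) + 2 * (real j * (x \<bullet> x) ^ (j - 1) * (x \<bullet> x)) * (v x * v x)"
      unfolding f'_def by (simp add: inner_commute)
    finally show ?thesis
      unfolding power_inner_self_Suc by (simp add: f_def Z_def power2_eq_square algebra_simps)
  qed
  moreover have "integrable lborel (\<lambda>x. (x \<bullet> x) ^ j * (v x * Z x))" "integrable lborel (\<lambda>x. (x \<bullet> x) ^ j * (v x)\<^sup>2)"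
    using z unfolding Z_def by (auto intro!: integrable_compactly_supported[of r] continuous_intros d)
  ultimately have "2 * (\<integral>x. (x \<bullet> x) ^ j * (v x * Z x) \<partial>lborel) = (2 * real k - 2 * real j) * (\<integral>x. (x \<bullet> x) ^ j * (v x)\<^sup>2 \<partial>lborel)"
    by simp
  then show ?thesis by (simp add: left_diff_distrib)
qed

text \<open>The two admissible exponents are those for which the factor \<open>real k - real j\<close> above is \<open>1\<close> or \<open>-1\<close>; the
inequality of the arithmetic and geometric means then absorbs half of the left side. One exponent
serves functions supported away from the origin, the other functions supported in a ball.\<close>

lemma weighted_poincare:
  fixes v :: "'a::euclidean_space \<Rightarrow> real" and k j :: nat
  assumes v: "C2_with v g H" and supp: "\<And>x. norm x > r \<Longrightarrow> v x = 0"
    and j: "j = k + 1 \<or> k = j + 1"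
  defines "Z \<equiv> (\<lambda>x. x \<bullet> g x + (real DIM('a) / 2 + real k) * v x)"
  shows "(\<integral>x. (x \<bullet> x) ^ j * (v x)\<^sup>2 \<partial>lborel) \<le> (\<integral>x. (x \<bullet> x) ^ j * (Z x)\<^sup>2 \<partial>lborel)"
proof -
  note d = C2_withD[OF v]
  have z: "v x = 0" "g x = 0" "Z x = 0" if "norm x > r" for x
    using C2_with_vanishing[OF v supp that] by (auto simp: Z_def)
  have int: "integrable lborel (\<lambda>x. (x \<bullet> x) ^ j * (v x * Z x))" "integrable lborel (\<lambda>x. (x \<bullet> x) ^ j * (v x)\<^sup>2)"
    "integrable lborel (\<lambda>x. (x \<bullet> x) ^ j * (Z x)\<^sup>2)"
    using z unfolding Z_def by (auto intro!: integrable_compactly_supported[of r] continuous_intros d)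
  define s :: real where "s = real k - real j"
  have s: "s * s = 1" using j by (auto simp: s_def)
  have "(\<integral>x. (x \<bullet> x) ^ j * (v x * Z x) \<partial>lborel) = s * (\<integral>x. (x \<bullet> x) ^ j * (v x)\<^sup>2 \<partial>lborel)"
    using integral_conjugated_euler_weight[OF v supp, where j = j and k = k] by (simp add: Z_def s_def)
  then have "s * (\<integral>x. (x \<bullet> x) ^ j * (v x * Z x) \<partial>lborel) = s * s * (\<integral>x. (x \<bullet> x) ^ j * (v x)\<^sup>2 \<partial>lborel)"
    by simp
  then have "(\<integral>x. (x \<bullet> x) ^ j * (v x)\<^sup>2 \<partial>lborel) = (\<integral>x. s * ((x \<bullet> x) ^ j * (v x * Z x)) \<partial>lborel)"
    using int s by simp
  also have "\<dots> \<le> (\<integral>x. (1/2) * ((x \<bullet> x) ^ j * (v x)\<^sup>2) + (1/2) * ((x \<bullet> x) ^ j * (Z x)\<^sup>2) \<partial>lborel)"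
  proof (rule integral_mono)
    fix x
    have "0 \<le> (x \<bullet> x) ^ j * (s * v x - Z x)\<^sup>2" by simp
    also have "\<dots> = (x \<bullet> x) ^ j * ((s * s) * (v x)\<^sup>2 - 2 * s * (v x * Z x) + (Z x)\<^sup>2)"
      by (simp add: power2_eq_square algebra_simps)
    finally show "s * ((x \<bullet> x) ^ j * (v x * Z x)) \<le> (1/2) * ((x \<bullet> x) ^ j * (v x)\<^sup>2) + (1/2) * ((x \<bullet> x) ^ j * (Z x)\<^sup>2)"
      unfolding s by (simp add: algebra_simps)
  qed (use int in auto)
  finally show ?thesis using int by simp
qed

text \<open>The divergence theorem for the field of the introduction. With $\tau = n/2 + k$ all terms in the square of the
gradient cancel, and the Hessian terms cancel by symmetry.\<close>

lemma integral_laplacian_conjugated_euler: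
  fixes v :: "'a::euclidean_space \<Rightarrow> real" and k :: nat
  assumes v: "C2_with v g H" and supp: "\<And>x. norm x > r \<Longrightarrow> v x = 0"
  defines "Z \<equiv> (\<lambda>x. x \<bullet> g x + (real DIM('a) / 2 + real k) * v x)"
  shows "(\<integral>x. (x \<bullet> x) ^ (k + 1) * (lintrace (H x) * Z x) \<partial>lborel)
     = - (2 * real k + 2) * (\<integral>x. (x \<bullet> x) ^ k * (Z x)\<^sup>2 \<partial>lborel)"
proof -
  note d = C2_withD[OF v]
  have z: "v x = 0" "g x = 0" "lintrace (H x) = 0" "Z x = 0" if "norm x > r" for x
    using C2_with_vanishing[OF v supp that] by (auto simp: Z_def)
  define \<tau> where "\<tau> = real DIM('a) / 2 + real k"
  \<comment> \<open>the coefficient for which the terms with \<open>(x \<bullet> x) ^ k\<close> combine to a multiple of the square of \<open>Z\<close>\<close>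
  define c where "c = (real k + 1) * \<tau>"
  define f where "f x = (x \<bullet> x) ^ (k + 1) * Z x" for x
  define f' where "f' x h = (x \<bullet> x) ^ (k + 1) * ((x \<bullet> H x h + h \<bullet> g x) + \<tau> * (g x \<bullet> h))
    + ((2 * real (k + 1) * (x \<bullet> x) ^ (k + 1 - 1)) * (x \<bullet> h)) * Z x" for x h
  define e where "e x = c * ((x \<bullet> x) ^ k * (v x * v x)) - (1/2) * ((x \<bullet> x) ^ (k + 1) * (g x \<bullet> g x))" for x
  define e' where "e' x h = c * ((x \<bullet> x) ^ k * (v x * (g x \<bullet> h) + (g x \<bullet> h) * v x)
       + ((2 * real k * (x \<bullet> x) ^ (k - 1)) * (x \<bullet> h)) * (v x * v x))
     - (1/2) * ((x \<bullet> x) ^ (k + 1) * (g x \<bullet> H x h + H x h \<bullet> g x)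
       + ((2 * real (k + 1) * (x \<bullet> x) ^ (k + 1 - 1)) * (x \<bullet> h)) * (g x \<bullet> g x))" for x h
  have df: "(f has_derivative f' x) (at x)" for x
    unfolding f_def f'_def Z_def \<tau>_def[symmetric]
    by (intro has_derivative_mult has_derivative_inner_self_power has_derivative_add has_derivative_inner has_derivative_mult_right has_derivative_ident d)
  have de: "(e has_derivative e' x) (at x)" for x
    unfolding e_def e'_def
    by (intro has_derivative_mult has_derivative_inner_self_power has_derivative_diff has_derivative_inner has_derivative_mult_right has_derivative_ident d)
  have Zc: "continuous_on UNIV Z" unfolding Z_def by (intro continuous_intros d)
  have "(\<integral>x. lintrace (\<lambda>h. (f x *\<^sub>R H x h + f' x h *\<^sub>R g x) + (e x *\<^sub>R h + e' x h *\<^sub>R x)) \<partial>lborel) = 0"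
  proof (rule divergence_theorem)
    show "((\<lambda>x. f x *\<^sub>R g x + e x *\<^sub>R x) has_derivative
        (\<lambda>h. (f x *\<^sub>R H x h + f' x h *\<^sub>R g x) + (e x *\<^sub>R h + e' x h *\<^sub>R x))) (at x)" for x
      by (intro has_derivative_add has_derivative_scaleR df de d has_derivative_ident)
    show "continuous_on UNIV (\<lambda>x. (f x *\<^sub>R H x b + f' x b *\<^sub>R g x) + (e x *\<^sub>R b + e' x b *\<^sub>R x))" for b
      unfolding f_def f'_def e_def e'_def by (intro continuous_intros d Zc)
    show "f x *\<^sub>R g x + e x *\<^sub>R x = 0" if "norm x > r" for x using z[OF that] by (simp add: f_def e_def)
  qed
  moreover have "lintrace (\<lambda>h. (f x *\<^sub>R H x h + f' x h *\<^sub>R g x) + (e x *\<^sub>R h + e' x h *\<^sub>R x))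
      = (x \<bullet> x) ^ (k + 1) * (lintrace (H x) * Z x) + (2 * real k + 2) * ((x \<bullet> x) ^ k * (Z x)\<^sup>2)" for x
  proof -
    have sym: "x \<bullet> H x (g x) = g x \<bullet> H x x" "H x x \<bullet> g x = g x \<bullet> H x x"
      using d(3)[of x x "g x"] by (auto simp: inner_commute)
    have "lintrace (\<lambda>h. (f x *\<^sub>R H x h + f' x h *\<^sub>R g x) + (e x *\<^sub>R h + e' x h *\<^sub>R x))
       = f x * lintrace (H x) + f' x (g x) + (e x * DIM('a) + e' x x)"
      by (simp add: lintrace_add lintrace_scaleR lintrace_id lintrace_rank_one[OF has_derivative_linear[OF df]]
          lintrace_rank_one[OF has_derivative_linear[OF de]])
    also have "real DIM('a) = 2 * \<tau> - 2 * real k" by (simp add: \<tau>_def)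
    also have "e' x x = c * ((x \<bullet> x) ^ k * (2 * v x * (x \<bullet> g x)) + 2 * (real k * (x \<bullet> x) ^ (k - 1) * (x \<bullet> x)) * (v x * v x))
       - (1/2) * ((x \<bullet> x) ^ (k + 1) * (2 * (g x \<bullet> H x x)) + 2 * (real k + 1) * (x \<bullet> x) ^ (k + 1) * (g x \<bullet> g x))"
      unfolding e'_def sym by (simp add: inner_commute algebra_simps)
    also have "\<dots> = c * ((x \<bullet> x) ^ k * (2 * v x * (x \<bullet> g x)) + 2 * (real k * (x \<bullet> x) ^ k) * (v x * v x))
       - (1/2) * ((x \<bullet> x) ^ (k + 1) * (2 * (g x \<bullet> H x x)) + 2 * (real k + 1) * (x \<bullet> x) ^ (k + 1) * (g x \<bullet> g x))"
      unfolding power_inner_self_Suc ..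
    also have "f' x (g x) = (x \<bullet> x) ^ (k + 1) * (g x \<bullet> H x x + (1 + \<tau>) * (g x \<bullet> g x))
       + (2 * real k + 2) * (x \<bullet> x) ^ k * (x \<bullet> g x) * Z x"
      unfolding f'_def sym by (simp add: algebra_simps)
    finally have eq: "lintrace (\<lambda>h. (f x *\<^sub>R H x h + f' x h *\<^sub>R g x) + (e x *\<^sub>R h + e' x h *\<^sub>R x)) = 
       f x * lintrace (H x) +
       ((x \<bullet> x) ^ (k + 1) * (g x \<bullet> H x x + (1 + \<tau>) * (g x \<bullet> g x)) + (2 * real k + 2) * (x \<bullet> x) ^ k * (x \<bullet> g x) * Z x) +
       (e x * (2 * \<tau> - 2 * real k) + (c * ((x \<bullet> x) ^ k * (2 * v x * (x \<bullet> g x)) + 2 * (real k * (x \<bullet> x) ^ k) * (v x * v x))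
       - (1/2) * ((x \<bullet> x) ^ (k + 1) * (2 * (g x \<bullet> H x x)) + 2 * (real k + 1) * (x \<bullet> x) ^ (k + 1) * (g x \<bullet> g x))))" .
    define X G E where "X = (x \<bullet> x) ^ k" and "G = g x \<bullet> g x" and "E = x \<bullet> g x"
    have Z: "Z x = E + \<tau> * v x" by (simp add: Z_def \<tau>_def E_def)
    have X1: "(x \<bullet> x) ^ (k + 1) = (x \<bullet> x) * X" by (simp add: X_def)
    show ?thesis
      by (rule trans[OF eq], unfold e_def f_def X1 X_def[symmetric] G_def[symmetric] E_def[symmetric] Z c_def)
         (simp add: power2_eq_square field_simps)
  qed
  moreover have "integrable lborel (\<lambda>x. (x \<bullet> x) ^ (k + 1) * (lintrace (H x) * Z x))"
    "integrable lborel (\<lambda>x. (x \<bullet> x) ^ k * (Z x)\<^sup>2)"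
    using z by (auto intro!: integrable_compactly_supported[of r] continuous_intros d continuous_on_subset[OF Zc])
  ultimately show ?thesis by (simp add: algebra_simps)
qed

text \<open>Let \<open>F\<close> be the function that is squared on the right. By the preceding identity and the sign of the potential term,
\<open>2 * k + 2\<close> times the integral of \<open>(x \<bullet> x) ^ k * (Z x)\<^sup>2\<close> is at most the integral of \<open>- ((x \<bullet> x) ^ (k + 1) * (F x * Z x))\<close>; completing
a square absorbs one half of the left side.\<close>

theorem carleman:
  fixes v q :: "'a::euclidean_space \<Rightarrow> real" and k :: nat
  assumes v: "C2_with v g H" and supp: "\<And>x. norm x > r \<Longrightarrow> v x = 0"
  defines "Z \<equiv> (\<lambda>x. x \<bullet> g x + (real DIM('a) / 2 + real k) * v x)"
  assumes qint: "integrable lborel (\<lambda>x. q x * ((x \<bullet> x) ^ (k + 1) * (v x * Z x)))"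
    and q: "(\<integral>x. q x * ((x \<bullet> x) ^ (k + 1) * (v x * Z x)) \<partial>lborel) \<le> 0"
    and Fint: "integrable lborel (\<lambda>x. (x \<bullet> x) ^ (k + 2) * (lintrace (H x) + q x * v x)\<^sup>2)"
  shows "(2 * real k + 2)\<^sup>2 * (\<integral>x. (x \<bullet> x) ^ k * (Z x)\<^sup>2 \<partial>lborel)
     \<le> (\<integral>x. (x \<bullet> x) ^ (k + 2) * (lintrace (H x) + q x * v x)\<^sup>2 \<partial>lborel)"
proof -
  note d = C2_withD[OF v]
  have z: "v x = 0" "g x = 0" "lintrace (H x) = 0" "Z x = 0" if "norm x > r" for x
    using C2_with_vanishing[OF v supp that] by (auto simp: Z_def)
  have Zc: "continuous_on UNIV Z" unfolding Z_def by (intro continuous_intros d)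
  have int: "integrable lborel (\<lambda>x. (x \<bullet> x) ^ (k + 1) * (lintrace (H x) * Z x))"
    "integrable lborel (\<lambda>x. (x \<bullet> x) ^ k * (Z x)\<^sup>2)"
    using z by (auto intro!: integrable_compactly_supported[of r] continuous_intros d continuous_on_subset[OF Zc])
  define N where "N = 2 * real k + 2"
  have N: "N > 0" by (simp add: N_def)
  define F where "F x = lintrace (H x) + q x * v x" for x
  define I where "I = (\<integral>x. (x \<bullet> x) ^ k * (Z x)\<^sup>2 \<partial>lborel)"
  define J where "J = (\<integral>x. (x \<bullet> x) ^ (k + 2) * (F x)\<^sup>2 \<partial>lborel)"
  have "(\<integral>x. (x \<bullet> x) ^ (k + 1) * (lintrace (H x) * Z x) \<partial>lborel) = - N * I"
    unfolding N_def I_def Z_def by (rule integral_laplacian_conjugated_euler[OF v supp])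
  then have "N * I = - (\<integral>x. (x \<bullet> x) ^ (k + 1) * (lintrace (H x) * Z x) \<partial>lborel)"
    by simp
  also have "\<dots> \<le> - (\<integral>x. q x * ((x \<bullet> x) ^ (k + 1) * (v x * Z x)) + (x \<bullet> x) ^ (k + 1) * (lintrace (H x) * Z x) \<partial>lborel)"
    using q unfolding Bochner_Integration.integral_add[OF qint int(1)] by simp
  also have "\<dots> = (\<integral>x. - (q x * ((x \<bullet> x) ^ (k + 1) * (v x * Z x)) + (x \<bullet> x) ^ (k + 1) * (lintrace (H x) * Z x)) \<partial>lborel)"
    by (simp only: integral_minus)
  also have "\<dots> \<le> (\<integral>x. (N / 2) * ((x \<bullet> x) ^ k * (Z x)\<^sup>2) + (1 / (2 * N)) * ((x \<bullet> x) ^ (k + 2) * (F x)\<^sup>2) \<partial>lborel)"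
  proof (rule integral_mono)
    show "integrable lborel (\<lambda>x. (N / 2) * ((x \<bullet> x) ^ k * (Z x)\<^sup>2) + (1 / (2 * N)) * ((x \<bullet> x) ^ (k + 2) * (F x)\<^sup>2))"
      using int Fint unfolding F_def by auto
    fix x
    have "0 \<le> (x \<bullet> x) ^ k * (N * Z x + (x \<bullet> x) * F x)\<^sup>2 / (2 * N)" using N by simp
    also have "\<dots> = (N / 2) * ((x \<bullet> x) ^ k * (Z x)\<^sup>2) + (1 / (2 * N)) * ((x \<bullet> x) ^ (k + 2) * (F x)\<^sup>2)
       + (x \<bullet> x) ^ (k + 1) * (F x * Z x)"
      using N by (simp add: power2_eq_square field_simps)
    finally show "- (q x * ((x \<bullet> x) ^ (k + 1) * (v x * Z x)) + (x \<bullet> x) ^ (k + 1) * (lintrace (H x) * Z x))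
      \<le> (N / 2) * ((x \<bullet> x) ^ k * (Z x)\<^sup>2) + (1 / (2 * N)) * ((x \<bullet> x) ^ (k + 2) * (F x)\<^sup>2)"
      by (simp add: F_def algebra_simps)
  qed (use qint int in auto)
  also have "\<dots> = (N / 2) * I + (1 / (2 * N)) * J"
    using int Fint unfolding I_def J_def F_def by simp
  finally have "N * I \<le> J / N" by (simp add: field_simps)
  then have "N\<^sup>2 * I \<le> J" using N by (simp add: field_simps power2_eq_square)
  then show ?thesis unfolding N_def I_def J_def F_def .
qed

section \<open>Smooth bump functions\<close>

text \<open>The functions $t^{-k} e^{-1/t}$ span a space that is closed under differentiation (\<open>has_derivative_kappa\<close>).\<close>

definition kappa :: "nat \<Rightarrow> real \<Rightarrow> real" where
  "kappa k t = (if t > 0 then exp (- 1 / t) / t ^ k else 0)"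

lemma kappa_tendsto_0: "(kappa k \<longlongrightarrow> 0) (at 0)"
proof (rule filterlim_split_at)
  show "(kappa k \<longlongrightarrow> 0) (at_left 0)"
    by (rule tendsto_eventually) (auto simp: kappa_def eventually_at_filter)
  have "((\<lambda>t. (inverse t) ^ k / exp (inverse t)) \<longlongrightarrow> 0) (at_right (0::real))"
    by (rule filterlim_compose[OF tendsto_power_div_exp_0 filterlim_inverse_at_top_right])
  then show "(kappa k \<longlongrightarrow> 0) (at_right 0)"
    by (rule Lim_transform_eventually)
       (auto simp: eventually_at_filter kappa_def exp_minus power_inverse field_simps)
qed

lemma has_derivative_kappa:
  "(kappa k has_real_derivative (kappa (k + 2) t - real k * kappa (k + 1) t)) (at t)"
proof -
  consider "t > 0" | "t < 0" | "t = 0" by linarith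
  then show ?thesis
  proof cases
    case 1
    have "((\<lambda>t. exp (- 1 / t) / t ^ k) has_real_derivative
        ((exp (- 1 / t) * (1 / t\<^sup>2)) * t ^ k - exp (- 1 / t) * (real k * t ^ (k - 1))) / (t ^ k * t ^ k)) (at t)"
      by (rule derivative_eq_intros refl | use 1 in \<open>simp add: power2_eq_square field_simps\<close>)+
    also have "((exp (- 1 / t) * (1 / t\<^sup>2)) * t ^ k - exp (- 1 / t) * (real k * t ^ (k - 1))) / (t ^ k * t ^ k)
       = kappa (k + 2) t - real k * kappa (k + 1) t"
      using 1 by (cases k) (auto simp: kappa_def field_simps power2_eq_square)
    finally show ?thesis
      by (rule has_field_derivative_transform_within_open[where S = "{0<..}"]) (use 1 in \<open>auto simp: kappa_def\<close>)
  next
    case 2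
    have "((\<lambda>t. 0) has_real_derivative 0) (at t)" by simp
    then have "(kappa k has_real_derivative 0) (at t)"
      by (rule has_field_derivative_transform_within_open[where S = "{..<0}"]) (use 2 in \<open>auto simp: kappa_def\<close>)
    then show ?thesis using 2 by (simp add: kappa_def)
  next
    case 3
    have "((\<lambda>h. (kappa k (0 + h) - kappa k 0) / h) \<longlongrightarrow> 0) (at 0)"
      by (rule Lim_transform_eventually[OF kappa_tendsto_0[of "k + 1"]])
         (auto simp: eventually_at_filter kappa_def)
    then show ?thesis using 3 by (simp add: kappa_def DERIV_def)
  qed
qed

text \<open>The functions spanned by products of coordinates with \<open>kappa k (s\<^sup>2 - (x - a) \<bullet> (x - a))\<close>. They vanish outside the
ball of radius \<open>s\<close> around \<open>a\<close> and are closed under partial differentiation, which yields smoothness of all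
orders at once.\<close>

inductive bump :: "real \<Rightarrow> real ^ 'n \<Rightarrow> (real ^ 'n \<Rightarrow> real) \<Rightarrow> bool" for s a where
  kappa: "bump s a (\<lambda>x. kappa k (s\<^sup>2 - (x - a) \<bullet> (x - a)))"
| coord: "bump s a f \<Longrightarrow> bump s a (\<lambda>x. (x - a) $ i * f x)"
| scale: "bump s a f \<Longrightarrow> bump s a (\<lambda>x. c * f x)"
| add: "bump s a f \<Longrightarrow> bump s a g \<Longrightarrow> bump s a (\<lambda>x. f x + g x)"

lemma has_derivative_kappa_radial:
  fixes a :: "'a::real_inner"
  shows "((\<lambda>x. kappa k (r - (x - a) \<bullet> (x - a))) has_derivative
    (\<lambda>h. (kappa (k + 2) (r - (x - a) \<bullet> (x - a)) - real k * kappa (k + 1) (r - (x - a) \<bullet> (x - a))) * (- 2 * ((x - a) \<bullet> h)))) (at x)"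
proof -
  have "((\<lambda>x. r - (x - a) \<bullet> (x - a)) has_derivative (\<lambda>h. - 2 * ((x - a) \<bullet> h))) (at x)"
    by (auto intro!: derivative_eq_intros simp: inner_commute)
  from has_derivative_compose[OF this has_derivative_kappa[unfolded has_field_derivative_def]]
  show ?thesis .
qed

lemma bump_has_derivative:
  assumes "bump s a f"
  shows "\<exists>D. (\<forall>x. (f has_derivative D x) (at x)) \<and> (\<forall>i. bump s a (\<lambda>x. D x (axis i 1)))"
  using assms
proof induction
  case (kappa k)
  let ?q = "\<lambda>j x. kappa j (s\<^sup>2 - (x - a) \<bullet> (x - a))"
  have "bump s a (\<lambda>x. (?q (k + 2) x - real k * ?q (k + 1) x) * (- 2 * ((x - a) \<bullet> axis i 1)))" for i
  proof -
    have "bump s a (\<lambda>x. (- 2) * ((x - a) $ i * (?q (k + 2) x + (- real k) * ?q (k + 1) x)))"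
      by (intro bump.intros)
    then show ?thesis by (simp add: inner_axis algebra_simps)
  qed
  then show ?case
    by (intro exI[of _ "\<lambda>x h. (?q (k + 2) x - real k * ?q (k + 1) x) * (- 2 * ((x - a) \<bullet> h))"]
        conjI allI has_derivative_kappa_radial)
next
  case (coord f i)
  then obtain D where D: "\<And>x. (f has_derivative D x) (at x)" "\<And>i. bump s a (\<lambda>x. D x (axis i 1))"
    by blast
  have "((\<lambda>x. (x - a) $ i * f x) has_derivative (\<lambda>h. (x - a) $ i * D x h + h $ i * f x)) (at x)" for x
    by (rule has_derivative_mult[OF _ D(1)]) (auto intro!: derivative_eq_intros bounded_linear_imp_has_derivative bounded_linear_vec_nth)
  moreover have "bump s a (\<lambda>x. (x - a) $ i * D x (axis j 1) + axis j 1 $ i * f x)" for j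
    using D coord.hyps by (intro bump.intros) auto
  ultimately show ?case by (intro exI[of _ "\<lambda>x h. (x - a) $ i * D x h + h $ i * f x"]) auto
next
  case (scale f c)
  then obtain D where D: "\<And>x. (f has_derivative D x) (at x)" "\<And>i. bump s a (\<lambda>x. D x (axis i 1))"
    by blast
  then show ?case
    by (intro exI[of _ "\<lambda>x h. c * D x h"]) (auto intro!: bump.intros has_derivative_mult_right)
next
  case (add f g)
  then obtain D E where D: "\<And>x. (f has_derivative D x) (at x)" "\<And>i. bump s a (\<lambda>x. D x (axis i 1))"
    and E: "\<And>x. (g has_derivative E x) (at x)" "\<And>i. bump s a (\<lambda>x. E x (axis i 1))"
    by blast
  then show ?case
    by (intro exI[of _ "\<lambda>x h. D x h + E x h"]) (auto intro!: bump.intros has_derivative_add)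
qed

lemma linear_axis_expansion:
  assumes "linear (D :: real ^ 'n \<Rightarrow> real)"
  shows "D h = (\<Sum>i\<in>UNIV. h $ i * D (axis i 1))"
proof -
  have "D h = D (\<Sum>i\<in>UNIV. h $ i *\<^sub>R axis i 1)"
    using basis_expansion[of h] by (simp add: scalar_mult_eq_scaleR)
  also have "\<dots> = (\<Sum>i\<in>UNIV. h $ i * D (axis i 1))"
    using assms by (simp add: linear_sum linear_cmul)
  finally show ?thesis .
qed

lemma partial_deriv_eq:
  assumes "\<And>x. (f has_derivative D x) (at x)"
  shows "partial_deriv i f = (\<lambda>x. D x (axis i 1))"
  using frechet_derivative_at[OF assms] by (simp add: partial_deriv_def fun_eq_iff)

lemma bump_partial_deriv:
  assumes "bump s a f"
  shows "bump s a (partial_deriv i f)"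
    "(f has_derivative (\<lambda>h. \<Sum>i\<in>UNIV. h $ i * partial_deriv i f x)) (at x)"
proof -
  obtain D where D: "\<And>x. (f has_derivative D x) (at x)" "\<And>i. bump s a (\<lambda>x. D x (axis i 1))"
    using bump_has_derivative[OF assms] by blast
  show "bump s a (partial_deriv i f)" unfolding partial_deriv_eq[OF D(1)] by (rule D(2))
  have "D x = (\<lambda>h. \<Sum>i\<in>UNIV. h $ i * partial_deriv i f x)"
    unfolding partial_deriv_eq[OF D(1)] using linear_axis_expansion[OF has_derivative_linear[OF D(1)]] by (rule ext)
  then show "(f has_derivative (\<lambda>h. \<Sum>i\<in>UNIV. h $ i * partial_deriv i f x)) (at x)"
    using D(1)[of x] by simp
qed

lemma bump_vanishes:
  assumes "bump s a f" "s > 0" "norm (x - a) \<ge> s"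
  shows "f x = 0"
  using assms(1)
proof induction
  case (kappa k)
  have "s\<^sup>2 \<le> (norm (x - a))\<^sup>2" using assms by (intro power_mono) auto
  then show ?case by (simp add: kappa_def power2_norm_eq_inner)
qed auto

lemma bump_continuous: "bump s a f \<Longrightarrow> continuous_on S f"
  by (meson bump_partial_deriv(2) continuous_at_imp_continuous_on has_derivative_continuous)

lemma bump_test_function:
  assumes "bump s a f" "s > 0"
  shows "test_function f"
proof -
  have "bump s a (foldr partial_deriv is f)" for "is"
    using assms(1) by (induction "is") (auto intro: bump_partial_deriv)
  then have "smooth f"
    unfolding smooth_def differentiable_def using bump_partial_deriv(2) by blast
  moreover have "support_on UNIV f \<subseteq> cball a s"
  proof
    fix x assume "x \<in> support_on UNIV f"
    then have "f x \<noteq> 0" by (simp add: support_on_def)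
    then have "norm (x - a) < s" using bump_vanishes[OF assms] by (meson not_le)
    then show "x \<in> cball a s" by (simp add: dist_norm norm_minus_commute)
  qed
  then have "compact (closure (support_on UNIV f))"
    by (meson bounded_cball bounded_subset compact_closure)
  ultimately show ?thesis by (simp add: test_function_def)
qed

lemma mvt_segment:
  fixes f :: "'a::real_normed_vector \<Rightarrow> real"
  assumes "\<And>x. (f has_derivative D x) (at x)"
  shows "\<exists>t. 0 < t \<and> t < 1 \<and> f (z + h) - f z = D (z + t *\<^sub>R h) h"
  using MVT2[OF zero_less_one has_real_derivative_along_line[of f D z h, OF assms]] by auto

lemma abs_sum_coordinates_le:
  fixes h :: "real ^ 'n" and c :: "'n \<Rightarrow> real" and B :: real
  assumes "\<And>i. \<bar>c i\<bar> \<le> B"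
  shows "\<bar>\<Sum>i\<in>UNIV. h $ i * c i\<bar> \<le> CARD('n) * B * norm h"
proof -
  have "\<bar>\<Sum>i\<in>UNIV. h $ i * c i\<bar> \<le> (\<Sum>i\<in>UNIV. \<bar>h $ i * c i\<bar>)" by (rule sum_abs)
  also have "\<dots> \<le> (\<Sum>i\<in>(UNIV::'n set). norm h * B)"
  proof (rule sum_mono)
    fix i show "\<bar>h $ i * c i\<bar> \<le> norm h * B"
      unfolding abs_mult using component_le_norm_cart[of h i] assms[of i] by (intro mult_mono) auto
  qed
  finally show ?thesis by (simp add: mult_ac)
qed

lemma bump_bounded:
  assumes "bump s a f" "s > 0"
  obtains B where "B \<ge> 0" "\<And>x. \<bar>f x\<bar> \<le> B"
proof -
  have "f x = 0" if "norm x > norm a + s" for x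
  proof (rule bump_vanishes[OF assms])
    have "norm x \<le> norm (x - a) + norm a" using norm_triangle_ineq[of "x - a" a] by simp
    then show "s \<le> norm (x - a)" using that by simp
  qed
  from bounded_of_compactly_supported[OF bump_continuous[OF assms(1)] this] that
  show ?thesis by (metis real_norm_def)
qed

lemma bump_uniformly_bounded:
  fixes f :: "'i::finite \<Rightarrow> real ^ 'n \<Rightarrow> real"
  assumes "\<And>i. bump s a (f i)" "s > 0"
  obtains B where "B \<ge> 0" "\<And>i x. \<bar>f i x\<bar> \<le> B"
proof -
  have "\<exists>B. B \<ge> 0 \<and> (\<forall>x. \<bar>f i x\<bar> \<le> B)" for i
    using bump_bounded[OF assms(1) assms(2)] by metis
  then obtain B where B: "\<And>i. B i \<ge> 0" "\<And>i x. \<bar>f i x\<bar> \<le> B i" by metis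
  show ?thesis
  proof (rule that[of "\<Sum>i\<in>UNIV. B i"])
    show "0 \<le> (\<Sum>i\<in>UNIV. B i)" using B(1) by (simp add: sum_nonneg)
    show "\<bar>f i x\<bar> \<le> (\<Sum>i\<in>UNIV. B i)" for i x
      using B(2)[of i x] member_le_sum[of i UNIV B] B(1) by force
  qed
qed

lemma bump_lipschitz:
  fixes f :: "'i::finite \<Rightarrow> real ^ 'n \<Rightarrow> real"
  assumes "\<And>i. bump s a (f i)" "s > 0"
  obtains B where "B \<ge> 0" "\<And>i z h. \<bar>f i (z + h) - f i z\<bar> \<le> B * norm h"
proof -
  obtain B where B: "B \<ge> 0" "\<And>p x. \<bar>(\<lambda>(i,j). partial_deriv j (f i)) p x\<bar> \<le> B"
    using bump_uniformly_bounded[where f = "\<lambda>(i,j). partial_deriv j (f i)" and s = s and a = a]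
      bump_partial_deriv(1)[OF assms(1)] assms(2) by (metis (mono_tags, lifting) case_prod_conv surj_pair)
  show ?thesis
  proof (rule that[of "CARD('n) * B"])
    fix i z h
    obtain t where "f i (z + h) - f i z = (\<Sum>j\<in>UNIV. h $ j * partial_deriv j (f i) (z + t *\<^sub>R h))"
      using mvt_segment[OF bump_partial_deriv(2)[OF assms(1)]] by blast
    then show "\<bar>f i (z + h) - f i z\<bar> \<le> CARD('n) * B * norm h"
      using B(2)[of "(i, _)"] by (simp add: abs_sum_coordinates_le)
  qed (use B in simp)
qed

text \<open>The quadratic remainder is uniform in \<open>z\<close>, which allows differentiation under the integral sign in convolutions
with functions that are only locally integrable.\<close>

lemma bump_taylor:
  fixes f :: "real ^ 'n \<Rightarrow> real"
  assumes "bump s a f" "s > 0"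
  obtains B where "B \<ge> 0"
    "\<And>z h. \<bar>f (z + h) - f z - (\<Sum>i\<in>UNIV. h $ i * partial_deriv i f z)\<bar> \<le> B * (norm h)\<^sup>2"
proof -
  obtain B where B: "B \<ge> 0" "\<And>i z h. \<bar>partial_deriv i f (z + h) - partial_deriv i f z\<bar> \<le> B * norm h"
    using bump_lipschitz[where f = "\<lambda>i. partial_deriv i f", OF bump_partial_deriv(1)[OF assms(1)] assms(2)] by blast
  show ?thesis
  proof (rule that[of "CARD('n) * B"])
    fix z h :: "real ^ 'n"
    obtain t where t: "0 < t" "t < 1" "f (z + h) - f z = (\<Sum>j\<in>UNIV. h $ j * partial_deriv j f (z + t *\<^sub>R h))"
      using mvt_segment[OF bump_partial_deriv(2)[OF assms(1)]] by blast
    have "norm (t *\<^sub>R h) \<le> norm h" using t mult_right_mono[of t 1 "norm h"] by simp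
    then have "\<bar>partial_deriv i f (z + t *\<^sub>R h) - partial_deriv i f z\<bar> \<le> B * norm h" for i
      using B(2)[of i z "t *\<^sub>R h"] mult_left_mono[OF _ B(1)] by (meson order.trans)
    from abs_sum_coordinates_le[of _ _ h, OF this]
    have "\<bar>\<Sum>i\<in>UNIV. h $ i * (partial_deriv i f (z + t *\<^sub>R h) - partial_deriv i f z)\<bar> \<le> CARD('n) * (B * norm h) * norm h" .
    then show "\<bar>f (z + h) - f z - (\<Sum>i\<in>UNIV. h $ i * partial_deriv i f z)\<bar> \<le> CARD('n) * B * (norm h)\<^sup>2"
      unfolding t(3) by (simp add: right_diff_distrib sum_subtractf power2_eq_square mult_ac)
  qed (use B in simp)
qed

section \<open>Mollified weak solutions\<close>

definition conv :: "('a::euclidean_space \<Rightarrow> real) \<Rightarrow> ('a \<Rightarrow> real) \<Rightarrow> 'a \<Rightarrow> real" where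
  "conv u f x = (\<integral>y. u y * f (x - y) \<partial>lborel)"

definition loc_integrable :: "('a::euclidean_space \<Rightarrow> real) \<Rightarrow> bool" where
  "loc_integrable u \<longleftrightarrow> u \<in> borel_measurable borel \<and>
     (\<forall>r. integrable lborel (\<lambda>y. indicator (cball 0 r) y * u y))"

lemma integrable_conv:
  fixes u f :: "'a::euclidean_space \<Rightarrow> real"
  assumes u: "loc_integrable u" and [measurable]: "f \<in> borel_measurable borel"
    and B: "\<And>z. \<bar>f z\<bar> \<le> B" and supp: "\<And>z. norm z \<ge> s \<Longrightarrow> f z = 0"
  shows "integrable lborel (\<lambda>y. u y * f (x - y))"
proof (rule Bochner_Integration.integrable_bound)
  have [measurable]: "u \<in> borel_measurable borel" using u by (simp add: loc_integrable_def)
  show "integrable lborel (\<lambda>y. B * \<bar>indicator (cball 0 (norm x + s)) y * u y\<bar>)"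
    using u by (intro integrable_mult_right integrable_abs) (simp add: loc_integrable_def)
  show "(\<lambda>y. u y * f (x - y)) \<in> borel_measurable lborel" by measurable
  show "AE y in lborel. norm (u y * f (x - y)) \<le> norm (B * \<bar>indicator (cball 0 (norm x + s)) y * u y\<bar>)"
  proof (rule AE_I2)
    fix y
    show "norm (u y * f (x - y)) \<le> norm (B * \<bar>indicator (cball 0 (norm x + s)) y * u y\<bar>)"
    proof (cases "norm y \<le> norm x + s")
      case True
      have "\<bar>u y\<bar> * \<bar>f (x - y)\<bar> \<le> \<bar>u y\<bar> * \<bar>B\<bar>"
        using B[of "x - y"] by (intro mult_left_mono) auto
      then show ?thesis using True by (simp add: abs_mult mult.commute)
    next
      case False
      then have "norm (x - y) \<ge> s" using norm_triangle_ineq3[of x y] by linarith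
      then show ?thesis using supp by simp
    qed
  qed
qed

lemma has_derivative_of_quadratic_bound:
  fixes f :: "'a::real_normed_vector \<Rightarrow> real"
  assumes L: "bounded_linear L" and C: "\<And>h. norm h \<le> 1 \<Longrightarrow> \<bar>f (x + h) - f x - L h\<bar> \<le> C * (norm h)\<^sup>2"
  shows "(f has_derivative L) (at x)"
  unfolding has_derivative_at
proof
  have "((\<lambda>h::'a. C * norm h) \<longlongrightarrow> C * norm (0::'a)) (at 0)"
    by (intro tendsto_intros)
  then have "((\<lambda>h::'a. C * norm h) \<longlongrightarrow> 0) (at 0)" by simp
  then show "(\<lambda>h. norm (f (x + h) - f x - L h) / norm h) \<midarrow>0\<rightarrow> 0"
  proof (rule Lim_null_comparison[rotated])
    have "eventually (\<lambda>h::'a. h \<noteq> 0 \<and> norm h \<le> 1) (at 0)"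
      unfolding eventually_at by (intro exI[of _ 1]) auto
    then show "eventually (\<lambda>h. norm (norm (f (x + h) - f x - L h) / norm h) \<le> C * norm h) (at 0)"
    proof eventually_elim
      case (elim h)
      then show ?case using C[of h] by (simp add: divide_le_eq power2_eq_square mult.assoc)
    qed
  qed
qed (rule L)

lemma bump_conv_integrable:
  assumes u: "loc_integrable u" and f: "bump s 0 f" "s > 0"
  shows "integrable lborel (\<lambda>y. u y * f (x - y))"
proof -
  obtain B where B: "\<And>z. \<bar>f z\<bar> \<le> B" using bump_bounded[OF f] by blast
  show ?thesis
    by (rule integrable_conv[OF u _ B])
      (use f bump_vanishes[OF f] in \<open>auto intro: borel_measurable_continuous_onI bump_continuous\<close>)
qed

lemma has_derivative_conv:
  fixes u f :: "real ^ 'n \<Rightarrow> real"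
  assumes u: "loc_integrable u" and f: "bump s 0 f" "s > 0"
  shows "(conv u f has_derivative (\<lambda>h. \<Sum>i\<in>UNIV. h $ i * conv u (partial_deriv i f) x)) (at x)"
proof -
  obtain B where B: "B \<ge> 0"
    "\<And>z h. \<bar>f (z + h) - f z - (\<Sum>i\<in>UNIV. h $ i * partial_deriv i f z)\<bar> \<le> B * (norm h)\<^sup>2"
    using bump_taylor[OF f] by blast
  note f' = bump_partial_deriv(1)[OF f(1)]
  let ?b = "\<lambda>y. indicator (cball 0 (norm x + s + 1)) y * u y"
  define C where "C = B * (\<integral>y. \<bar>?b y\<bar> \<partial>lborel)"
  have bi: "integrable lborel ?b" using u by (simp add: loc_integrable_def)
  show ?thesis
  proof (rule has_derivative_of_quadratic_bound)
    show "bounded_linear (\<lambda>h. \<Sum>i\<in>UNIV. h $ i * conv u (partial_deriv i f) x)"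
      by (intro bounded_linear_sum bounded_linear_mult_const bounded_linear_vec_nth)
    fix h :: "real ^ 'n" assume h: "norm h \<le> 1"
    note int = bump_conv_integrable[OF u f] bump_conv_integrable[OF u f' f(2)]
    have "conv u f (x + h) - conv u f x - (\<Sum>i\<in>UNIV. h $ i * conv u (partial_deriv i f) x)
      = (\<integral>y. u y * f (x + h - y) - u y * f (x - y) - (\<Sum>i\<in>UNIV. h $ i * (u y * partial_deriv i f (x - y))) \<partial>lborel)"
      unfolding conv_def using int by simp
    also have "\<bar>\<dots>\<bar> \<le> (\<integral>y. \<bar>?b y\<bar> * (B * (norm h)\<^sup>2) \<partial>lborel)"
    proof (rule order_trans[OF integral_norm_bound[where 'a = real, unfolded real_norm_def]], rule integral_mono)
      show "integrable lborel (\<lambda>y. \<bar>u y * f (x + h - y) - u y * f (x - y) - (\<Sum>i\<in>UNIV. h $ i * (u y * partial_deriv i f (x - y)))\<bar>)"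
        using int by auto
      show "integrable lborel (\<lambda>y. \<bar>?b y\<bar> * (B * (norm h)\<^sup>2))" using bi by auto
      fix y
      have eq: "u y * f (x + h - y) - u y * f (x - y) - (\<Sum>i\<in>UNIV. h $ i * (u y * partial_deriv i f (x - y)))
        = u y * (f ((x - y) + h) - f (x - y) - (\<Sum>i\<in>UNIV. h $ i * partial_deriv i f (x - y)))"
        by (simp add: right_diff_distrib sum_distrib_left mult.left_commute add_diff_eq add.commute diff_add_eq)
      show "\<bar>u y * f (x + h - y) - u y * f (x - y) - (\<Sum>i\<in>UNIV. h $ i * (u y * partial_deriv i f (x - y)))\<bar>
         \<le> \<bar>?b y\<bar> * (B * (norm h)\<^sup>2)"
      proof (cases "norm y \<le> norm x + s + 1")
        case True
        then show ?thesis unfolding eq abs_mult using B(2)[of "x - y" h] by (simp add: mult_left_mono)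
      next
        case False
        have "norm (x - y) \<ge> s" using norm_triangle_ineq3[of x y] False by linarith
        moreover have "norm ((x - y) + h) \<ge> s"
          using norm_triangle_ineq3[of "x + h" y] norm_triangle_ineq[of x h] h False
          by (simp add: algebra_simps)
        ultimately have "f ((x - y) + h) = 0" "f (x - y) = 0" "\<And>i. partial_deriv i f (x - y) = 0"
          using bump_vanishes[OF f] bump_vanishes[OF f' f(2)] by auto
        then show ?thesis unfolding eq using B(1) by simp
      qed
    qed
    also have "\<dots> = C * (norm h)\<^sup>2" by (simp add: C_def)
    finally show "\<bar>conv u f (x + h) - conv u f x - (\<Sum>i\<in>UNIV. h $ i * conv u (partial_deriv i f) x)\<bar> \<le> C * (norm h)\<^sup>2" .
  qed
qed

lemma continuous_on_conv:
  fixes u f :: "real ^ 'n \<Rightarrow> real"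
  assumes u: "loc_integrable u" and f: "bump s 0 f" "s > 0"
  shows "continuous_on S (conv u f)"
  using has_derivative_conv[OF assms] by (meson continuous_at_imp_continuous_on has_derivative_continuous)

definition kern :: "real \<Rightarrow> 'a::euclidean_space \<Rightarrow> real" where
  "kern s z = kappa 0 (s\<^sup>2 - z \<bullet> z)"

lemma bump_kern: "bump s 0 (kern s)"
  using bump.kappa[of s 0 0] by (simp add: kern_def[abs_def])

lemma axis_one_nth: "axis i (1::real) $ j = (if j = i then 1 else 0)"
  by (simp add: axis_def)

lemma partial_deriv_kern:
  "partial_deriv i (kern s) = (\<lambda>z. - 2 * (z $ i * kappa 2 (s\<^sup>2 - z \<bullet> z)))"
  unfolding kern_def[abs_def]
  using partial_deriv_eq[OF has_derivative_kappa_radial[of 0 "s\<^sup>2" 0], of i]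
  by (simp add: inner_axis mult_ac numeral_2_eq_2)

text \<open>The explicit form shows that the Hessian is symmetric and even.\<close>

lemma partial_deriv2_kern:
  fixes i j :: "'n::finite"
  shows "partial_deriv j (partial_deriv i (kern s)) = (\<lambda>z. - 2 * ((if i = j then 1 else 0) * kappa 2 (s\<^sup>2 - z \<bullet> z))
     + 4 * (z $ i * z $ j) * (kappa 4 (s\<^sup>2 - z \<bullet> z) - 2 * kappa 3 (s\<^sup>2 - z \<bullet> z)))"
proof -
  have "((\<lambda>z. - 2 * (z $ i * kappa 2 (s\<^sup>2 - z \<bullet> z))) has_derivative
     (\<lambda>h. - 2 * (z $ i * ((kappa 4 (s\<^sup>2 - z \<bullet> z) - 2 * kappa 3 (s\<^sup>2 - z \<bullet> z)) * (- 2 * (z \<bullet> h))) + h $ i * kappa 2 (s\<^sup>2 - z \<bullet> z)))) (at z)"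
    for z :: "real ^ 'n"
    using has_derivative_kappa_radial[of 2 "s\<^sup>2" 0 z]
    by (intro has_derivative_mult_right has_derivative_mult bounded_linear_imp_has_derivative bounded_linear_vec_nth)
       (simp add: eval_nat_numeral)
  note d = partial_deriv_eq[OF this, of j]
  show ?thesis
    unfolding partial_deriv_kern d by (simp add: inner_axis axis_one_nth algebra_simps fun_eq_iff)
qed

lemma partial_deriv_translate:
  fixes f :: "real ^ 'n \<Rightarrow> real"
  assumes "bump s 0 f"
  shows "partial_deriv i (\<lambda>y. f (y - x)) = (\<lambda>y. partial_deriv i f (y - x))"
proof -
  have d: "((\<lambda>y. y - x) has_derivative (\<lambda>h. h)) (at y)" for y
    by (auto intro!: derivative_eq_intros)
  have "((\<lambda>y. f (y - x)) has_derivative (\<lambda>h. \<Sum>j\<in>UNIV. h $ j * partial_deriv j f (y - x))) (at y)" for y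
    by (rule has_derivative_compose[OF d bump_partial_deriv(2)[OF assms]])
  from partial_deriv_eq[OF this, of i] show ?thesis
    by (simp add: axis_one_nth if_distrib[where f = "\<lambda>t. t * _"] sum.delta cong: if_cong)
qed

lemma laplacian_kern_translate:
  "laplacian (\<lambda>y. kern s (y - x)) y = laplacian (kern s) (x - y)"
proof -
  have sym: "(y - x) \<bullet> (y - x) = (x - y) \<bullet> (x - y)" by (metis inner_minus_left inner_minus_right minus_diff_eq verit_minus_simplify(4))
  show ?thesis
    unfolding laplacian_def partial_deriv_translate[OF bump_kern]
      partial_deriv_translate[OF bump_partial_deriv(1)[OF bump_kern]] partial_deriv2_kern sym
    by (intro sum.cong refl) (simp add: algebra_simps)
qed

lemma Basis_vec_real: "(Basis :: (real ^ 'n) set) = (\<lambda>i. axis i 1) ` UNIV"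
  by (auto simp: Basis_vec_def)

lemma sum_Basis_vec: "(\<Sum>b\<in>(Basis :: (real ^ 'n) set). f b) = (\<Sum>i\<in>UNIV. f (axis i 1))"
  unfolding Basis_vec_real by (subst sum.reindex) (auto simp: inj_on_def axis_eq_axis)

text \<open>The kernel \<open>kern s (y - x)\<close> is a test function of \<open>y\<close>, so that the weak equation identifies the Laplacian of the
mollified \<open>u\<close> with the mollified \<open>f\<close>.\<close>

lemma C2_with_conv_kern:
  fixes u :: "real ^ 'n \<Rightarrow> real"
  assumes u: "loc_integrable u" and s: "s > 0"
    and weak: "\<And>\<phi>. test_function \<phi> \<Longrightarrow> (\<integral>x. u x * laplacian \<phi> x \<partial>lborel) = (\<integral>x. f x * \<phi> x \<partial>lborel)"
  obtains g H where "C2_with (conv u (kern s)) g H" "\<And>x. lintrace (H x) = conv f (kern s) x"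
proof -
  define g where "g x = (\<chi> i. conv u (partial_deriv i (kern s)) x)" for x
  define H where "H x h = (\<chi> i. \<Sum>j\<in>UNIV. h $ j * conv u (partial_deriv j (partial_deriv i (kern s))) x)" for x h
  note k1 = bump_partial_deriv(1)[OF bump_kern]
  note k2 = bump_partial_deriv(1)[OF k1]
  have sym: "partial_deriv j (partial_deriv i (kern s)) = partial_deriv i (partial_deriv j (kern s))" for i j :: 'n
    unfolding partial_deriv2_kern by (auto simp: mult_ac)
  have C2: "C2_with (conv u (kern s)) g H"
    unfolding C2_with_def
  proof (intro conjI allI)
    show "(conv u (kern s) has_derivative (\<bullet>) (g x)) (at x)" for x
    proof -
      have "(\<bullet>) (g x) = (\<lambda>h. \<Sum>i\<in>UNIV. h $ i * conv u (partial_deriv i (kern s)) x)"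
        by (simp add: g_def inner_vec_def mult.commute fun_eq_iff)
      then show ?thesis using has_derivative_conv[OF u bump_kern s, of x] by simp
    qed
    show "(g has_derivative H x) (at x)" for x
    proof (subst has_derivative_componentwise_within, intro ballI)
      fix b :: "real ^ 'n" assume "b \<in> Basis"
      then obtain i where b: "b = axis i 1" by (auto simp: Basis_vec_real)
      show "((\<lambda>x. g x \<bullet> b) has_derivative (\<lambda>h. H x h \<bullet> b)) (at x)"
        using has_derivative_conv[OF u k1 s, of i x] by (simp add: b inner_axis g_def H_def)
    qed
    show "H x a \<bullet> b = a \<bullet> H x b" for x a b
    proof -
      have "H x a \<bullet> b = (\<Sum>i\<in>UNIV. \<Sum>j\<in>UNIV. a $ j * conv u (partial_deriv j (partial_deriv i (kern s))) x * b $ i)"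
        by (simp add: H_def inner_vec_def sum_distrib_right)
      also have "\<dots> = (\<Sum>j\<in>UNIV. \<Sum>i\<in>UNIV. a $ j * conv u (partial_deriv j (partial_deriv i (kern s))) x * b $ i)"
        by (rule sum.swap)
      also have "\<dots> = a \<bullet> H x b"
        unfolding H_def inner_vec_def by (subst sym) (simp add: sum_distrib_left mult_ac)
      finally show ?thesis .
    qed
    show "continuous_on UNIV (\<lambda>x. H x b)" for b
      unfolding H_def by (intro continuous_on_vec_lambda continuous_intros continuous_on_conv[OF u k2 s])
  qed
  have "lintrace (H x) = conv f (kern s) x" for x
  proof -
    let ?\<phi> = "\<lambda>y. kern s (y - x)"
    have "bump s x ?\<phi>" using bump.kappa[of s x 0] by (simp add: kern_def)
    then have t: "test_function ?\<phi>" using s by (rule bump_test_function)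
    have "lintrace (H x) = (\<Sum>i\<in>UNIV. conv u (partial_deriv i (partial_deriv i (kern s))) x)"
      by (simp add: lintrace_def sum_Basis_vec inner_axis H_def axis_one_nth if_distrib[where f = "\<lambda>t. t * _"] sum.delta cong: if_cong)
    also have "\<dots> = (\<integral>y. (\<Sum>i\<in>UNIV. u y * partial_deriv i (partial_deriv i (kern s)) (x - y)) \<partial>lborel)"
      unfolding conv_def using bump_conv_integrable[OF u k2 s] by (simp add: Bochner_Integration.integral_sum)
    also have "\<dots> = (\<integral>y. u y * laplacian ?\<phi> y \<partial>lborel)"
      unfolding laplacian_kern_translate by (simp add: laplacian_def sum_distrib_left)
    also have "\<dots> = (\<integral>y. f y * ?\<phi> y \<partial>lborel)" by (rule weak[OF t])
    also have "\<dots> = conv f (kern s) x"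
      by (simp add: conv_def kern_def inner_diff_left inner_diff_right inner_commute algebra_simps)
    finally show ?thesis .
  qed
  with C2 show ?thesis by (rule that)
qed

section \<open>Mollification in mean square\<close>

lemma lborel_distr_reflect:
  fixes x :: "'a::euclidean_space"
  shows "distr lborel borel (\<lambda>z. x - z) = lborel"
proof -
  have "lborel = density (distr lborel borel (\<lambda>z::'a. x + (- 1) *\<^sub>R z)) (\<lambda>_. ennreal (\<bar>- 1\<bar> ^ DIM('a)))"
    by (rule lborel_affine) simp
  then show ?thesis by (simp add: density_1)
qed

lemma lborel_reflect:
  fixes x :: "'a::euclidean_space"
  shows "g \<in> borel_measurable borel \<Longrightarrow> (\<integral>\<^sup>+z. g (x - z) \<partial>lborel) = (\<integral>\<^sup>+z. g z \<partial>lborel)"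
    and "f \<in> borel_measurable borel \<Longrightarrow> (\<integral>z. f (x - z) \<partial>lborel) = (\<integral>z. (f z :: real) \<partial>lborel)"
    and "f \<in> borel_measurable borel \<Longrightarrow> integrable lborel (\<lambda>z. f (x - z)) \<longleftrightarrow> integrable lborel f"
proof -
  show "(\<integral>\<^sup>+z. g (x - z) \<partial>lborel) = (\<integral>\<^sup>+z. g z \<partial>lborel)" if [measurable]: "g \<in> borel_measurable borel"
    using nn_integral_distr[of "\<lambda>z. x - z" lborel borel g] by (simp add: lborel_distr_reflect)
  show "(\<integral>z. f (x - z) \<partial>lborel) = (\<integral>z. f z \<partial>lborel)" if [measurable]: "f \<in> borel_measurable borel"
    using integral_distr[of "\<lambda>z. x - z" lborel borel f] by (simp add: lborel_distr_reflect)
  show "integrable lborel (\<lambda>z. f (x - z)) \<longleftrightarrow> integrable lborel f" if [measurable]: "f \<in> borel_measurable borel"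
    using integrable_distr_eq[of "\<lambda>z. x - z" lborel borel f] by (simp add: lborel_distr_reflect)
qed

lemma nn_integral_lborel_translation:
  fixes g :: "'a::euclidean_space \<Rightarrow> ennreal"
  assumes [measurable]: "g \<in> borel_measurable borel"
  shows "(\<integral>\<^sup>+x. g (x - c) \<partial>lborel) = (\<integral>\<^sup>+x. g x \<partial>lborel)"
  using nn_integral_distr[of "(+) (- c)" lborel borel g] by (simp add: lborel_distr_plus)

text \<open>Truncation of the values reduces to bounded functions; these are almost everywhere limits of continuous
functions, and dominated convergence applies after truncation and multiplication with the cut-off \<open>\<zeta>\<close>.\<close>

lemma L2_approx_continuous:
  fixes U :: "'a::euclidean_space \<Rightarrow> real"
  assumes [measurable]: "U \<in> borel_measurable borel" and U2: "integrable lborel (\<lambda>x. (U x)\<^sup>2)"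
    and supp: "\<And>x. norm x > r \<Longrightarrow> U x = 0" and e: "e > 0"
  obtains g where "continuous_on UNIV g" "\<And>x. norm x > r + 1 \<Longrightarrow> g x = 0"
    "(\<integral>\<^sup>+x. ennreal ((U x - g x)\<^sup>2) \<partial>lborel) \<le> ennreal e"
proof -
  define T where "T b t = max (- b) (min b t)" for b t :: real
  have Tb: "\<bar>T b t\<bar> \<le> b" if "b \<ge> 0" for b t using that by (auto simp: T_def)
  have Tm[measurable]: "T b \<in> borel_measurable borel" for b unfolding T_def[abs_def] by measurable
  have Tc: "continuous_on S (T b)" for b S unfolding T_def[abs_def] by (intro continuous_intros)
  have "(\<lambda>n. \<integral>x. (U x - T (real n) (U x))\<^sup>2 \<partial>lborel) \<longlonglongrightarrow> (\<integral>x. 0 \<partial>(lborel::'a measure))"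
  proof (rule integral_dominated_convergence[where w = "\<lambda>x. (U x)\<^sup>2"])
    show "AE x in lborel. (\<lambda>n. (U x - T (real n) (U x))\<^sup>2) \<longlonglongrightarrow> 0"
    proof (rule AE_I2)
      fix x
      obtain N :: nat where N: "\<bar>U x\<bar> \<le> real N" using real_arch_simple by blast
      show "(\<lambda>n. (U x - T (real n) (U x))\<^sup>2) \<longlonglongrightarrow> 0"
      proof (rule tendsto_eventually, rule eventually_sequentiallyI[of N])
        fix n assume "N \<le> n"
        then have "\<bar>U x\<bar> \<le> real n" using N by linarith
        then show "(U x - T (real n) (U x))\<^sup>2 = 0" by (auto simp: T_def)
      qed
    qed
    show "AE x in lborel. norm ((U x - T (real n) (U x))\<^sup>2) \<le> (U x)\<^sup>2" for n
    proof (rule AE_I2)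
      fix x
      have "\<bar>U x - T (real n) (U x)\<bar> \<le> \<bar>U x\<bar>" by (auto simp: T_def)
      then show "norm ((U x - T (real n) (U x))\<^sup>2) \<le> (U x)\<^sup>2" by (simp add: abs_le_square_iff)
    qed
  qed (use U2 in auto)
  then have "eventually (\<lambda>n. (\<integral>x. (U x - T (real n) (U x))\<^sup>2 \<partial>lborel) < e / 4) sequentially"
    using e by (intro order_tendstoD) auto
  then obtain n where n: "(\<integral>x. (U x - T (real n) (U x))\<^sup>2 \<partial>lborel) < e / 4"
    using eventually_happens by force
  define b where "b = real n"
  have b: "b \<ge> 0" by (simp add: b_def)
  have UTint: "integrable lborel (\<lambda>x. (U x - T b (U x))\<^sup>2)"
  proof (rule Bochner_Integration.integrable_bound[OF U2])
    show "AE x in lborel. norm ((U x - T b (U x))\<^sup>2) \<le> norm ((U x)\<^sup>2)"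
    proof (rule AE_I2)
      fix x
      have "\<bar>U x - T b (U x)\<bar> \<le> \<bar>U x\<bar>" using b by (auto simp: T_def)
      then show "norm ((U x - T b (U x))\<^sup>2) \<le> norm ((U x)\<^sup>2)" by (simp add: abs_le_square_iff)
    qed
  qed simp
  have "U \<in> borel_measurable lebesgue" by (rule measurable_completion) simp
  then have "U measurable_on UNIV" by (rule lebesgue_measurable_imp_measurable_on_real) simp
  then obtain N f where N: "negligible N" and f: "\<And>n. continuous_on UNIV (f n)"
    and lim: "\<And>x. x \<notin> N \<Longrightarrow> (\<lambda>n. f n x) \<longlonglongrightarrow> U x"
    unfolding measurable_on_def by auto
  have AEN: "AE x in lborel. x \<notin> N"
  proof -
    have "AE x in lebesgue. x \<notin> N" using N by (simp add: negligible_iff_null_sets AE_not_in)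
    then show ?thesis by (simp add: AE_completion_iff)
  qed
  define \<zeta> where "\<zeta> x = max 0 (min 1 (r + 1 - norm x))" for x :: 'a
  have \<zeta>c: "continuous_on S \<zeta>" for S unfolding \<zeta>_def[abs_def] by (intro continuous_intros)
  have \<zeta>: "0 \<le> \<zeta> x" "\<zeta> x \<le> 1" "norm x > r + 1 \<Longrightarrow> \<zeta> x = 0" "norm x \<le> r \<Longrightarrow> \<zeta> x = 1" for x
    by (auto simp: \<zeta>_def)
  define g where "g n x = \<zeta> x * T b (f n x)" for n x
  have gc: "continuous_on UNIV (g n)" for n
    unfolding g_def by (intro continuous_intros \<zeta>c continuous_on_compose2[OF Tc f]) auto
  have gm[measurable]: "g n \<in> borel_measurable borel" for n
    using gc by (rule borel_measurable_continuous_onI)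
  have gb: "\<bar>g n x\<bar> \<le> b" for n x
    unfolding g_def abs_mult using Tb[OF b, of "f n x"] \<zeta>[of x] mult_mono[of "\<bar>\<zeta> x\<bar>" 1 "\<bar>T b (f n x)\<bar>" b] by simp
  have dom: "norm ((T b (U x) - g n x)\<^sup>2) \<le> indicator (cball 0 (r + 1)) x *\<^sub>R (2 * b)\<^sup>2" for n x
  proof (cases "norm x \<le> r + 1")
    case True
    have "\<bar>T b (U x) - g n x\<bar> \<le> \<bar>2 * b\<bar>" using Tb[OF b, of "U x"] gb[of n x] by linarith
    then have "(T b (U x) - g n x)\<^sup>2 \<le> (2 * b)\<^sup>2" using abs_le_square_iff by blast
    then show ?thesis using True by simp
  next
    case False
    then show ?thesis using supp[of x] \<zeta>(3)[of x] b by (simp add: g_def T_def)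
  qed
  have domint: "integrable lborel (\<lambda>x::'a. indicator (cball 0 (r + 1)) x *\<^sub>R (2 * b)\<^sup>2)"
    by (rule borel_integrable_compact) auto
  have "(\<lambda>n. \<integral>x. (T b (U x) - g n x)\<^sup>2 \<partial>lborel) \<longlonglongrightarrow> (\<integral>x. 0 \<partial>(lborel::'a measure))"
  proof (rule integral_dominated_convergence[OF _ _ domint])
    show "AE x in lborel. (\<lambda>n. (T b (U x) - g n x)\<^sup>2) \<longlonglongrightarrow> 0"
      using AEN
    proof eventually_elim
      case (elim x)
      have "isCont (T b) (U x)" using Tc[of UNIV b] by (simp add: continuous_on_eq_continuous_at)
      then have "(\<lambda>n. T b (f n x)) \<longlonglongrightarrow> T b (U x)"
        using lim[OF elim] by (rule isCont_tendsto_compose)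
      then have "(\<lambda>n. (T b (U x) - g n x)\<^sup>2) \<longlonglongrightarrow> (T b (U x) - \<zeta> x * T b (U x))\<^sup>2"
        unfolding g_def by (intro tendsto_intros)
      also have "T b (U x) - \<zeta> x * T b (U x) = 0"
        using \<zeta>(4)[of x] supp[of x] b by (cases "norm x \<le> r") (auto simp: T_def)
      finally show ?case by simp
    qed
  qed (use dom in auto)
  then have "eventually (\<lambda>n. (\<integral>x. (T b (U x) - g n x)\<^sup>2 \<partial>lborel) < e / 4) sequentially"
    using e by (intro order_tendstoD) auto
  then obtain m where m: "(\<integral>x. (T b (U x) - g m x)\<^sup>2 \<partial>lborel) < e / 4"
    using eventually_happens by force
  have Tgint: "integrable lborel (\<lambda>x. (T b (U x) - g m x)\<^sup>2)"
  proof (rule Bochner_Integration.integrable_bound[OF domint])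
    show "AE x in lborel. norm ((T b (U x) - g m x)\<^sup>2) \<le> norm (indicator (cball 0 (r + 1)) x *\<^sub>R (2 * b)\<^sup>2)"
      using dom by (intro AE_I2) (metis abs_ge_self order.trans real_norm_def)
  qed simp
  show ?thesis
  proof (rule that[OF gc])
    show "g m x = 0" if "norm x > r + 1" for x using \<zeta>(3)[OF that] by (simp add: g_def)
    have "(\<integral>\<^sup>+x. ennreal ((U x - g m x)\<^sup>2) \<partial>lborel) \<le> (\<integral>\<^sup>+x. ennreal (2 * (U x - T b (U x))\<^sup>2 + 2 * (T b (U x) - g m x)\<^sup>2) \<partial>lborel)"
    proof (intro nn_integral_mono ennreal_leI)
      fix x
      have "2 * (U x - T b (U x))\<^sup>2 + 2 * (T b (U x) - g m x)\<^sup>2 - (U x - g m x)\<^sup>2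
        = ((U x - T b (U x)) - (T b (U x) - g m x))\<^sup>2" by (simp add: power2_eq_square algebra_simps)
      then show "(U x - g m x)\<^sup>2 \<le> 2 * (U x - T b (U x))\<^sup>2 + 2 * (T b (U x) - g m x)\<^sup>2"
        using zero_le_power2[of "(U x - T b (U x)) - (T b (U x) - g m x)"] by linarith
    qed
    also have "\<dots> = ennreal (\<integral>x. 2 * (U x - T b (U x))\<^sup>2 + 2 * (T b (U x) - g m x)\<^sup>2 \<partial>lborel)"
      using UTint Tgint by (intro nn_integral_eq_integral) auto
    also have "\<dots> \<le> ennreal e"
      using UTint Tgint n m by (intro ennreal_leI) (simp add: b_def)
    finally show "(\<integral>\<^sup>+x. ennreal ((U x - g m x)\<^sup>2) \<partial>lborel) \<le> ennreal e" .
  qed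
qed

lemma square_sum3_le: "(a + b + c)\<^sup>2 \<le> 3 * (a\<^sup>2 + b\<^sup>2 + (c::real)\<^sup>2)"
proof -
  have "3 * (a\<^sup>2 + b\<^sup>2 + c\<^sup>2) - (a + b + c)\<^sup>2 = (a - b)\<^sup>2 + (b - c)\<^sup>2 + (a - c)\<^sup>2"
    by (simp add: power2_eq_square algebra_simps)
  then show ?thesis using zero_le_power2[of "a - b"] zero_le_power2[of "b - c"] zero_le_power2[of "a - c"] by linarith
qed

text \<open>A continuous function with compact support is uniformly continuous; the general case follows by approximation.\<close>

lemma L2_translation_continuous:
  fixes U :: "'a::euclidean_space \<Rightarrow> real"
  assumes [measurable]: "U \<in> borel_measurable borel" and U2: "integrable lborel (\<lambda>x. (U x)\<^sup>2)"
    and supp: "\<And>x. norm x > r \<Longrightarrow> U x = 0" and e: "e > 0"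
  shows "\<exists>\<delta>>0. \<forall>z. norm z < \<delta> \<longrightarrow> (\<integral>\<^sup>+x. ennreal ((U (x - z) - U x)\<^sup>2) \<partial>lborel) \<le> ennreal e"
proof -
  have e9: "e / 9 > 0" using e by simp
  obtain g where gc: "continuous_on UNIV g" and g0: "\<And>x. norm x > r + 1 \<Longrightarrow> g x = 0"
    and gU: "(\<integral>\<^sup>+x. ennreal ((U x - g x)\<^sup>2) \<partial>lborel) \<le> ennreal (e / 9)"
    using L2_approx_continuous[OF assms(1) U2 supp e9] by blast
  have gm[measurable]: "g \<in> borel_measurable borel"
    using gc by (rule borel_measurable_continuous_onI)
  define K where "K = cball (0::'a) (r + 2)"
  define m where "m = measure lborel K"
  have Km: "emeasure lborel K = ennreal m"
    unfolding m_def K_def by (rule emeasure_eq_ennreal_measure) (use emeasure_compact_finite[of "cball (0::'a) (r + 2)"] in auto)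
  have m0: "m \<ge> 0" by (simp add: m_def)
  define \<eta> where "\<eta> = sqrt (e / (9 * (m + 1)))"
  have \<eta>: "\<eta> > 0" "\<eta>\<^sup>2 * m \<le> e / 9"
    using e m0 by (auto simp: \<eta>_def field_simps)
  have "uniformly_continuous_on K g"
    unfolding K_def by (intro compact_uniformly_continuous continuous_on_subset[OF gc]) auto
  then obtain d where d: "d > 0" "\<And>x y. x \<in> K \<Longrightarrow> y \<in> K \<Longrightarrow> dist y x < d \<Longrightarrow> dist (g y) (g x) < \<eta>"
    unfolding uniformly_continuous_on_def using \<eta> by blast
  show ?thesis
  proof (intro exI[of _ "min d 1"] conjI allI impI)
    show "0 < min d 1" using d by simp
    fix z :: 'a assume z: "norm z < min d 1"
    have gz: "(g (x - z) - g x)\<^sup>2 \<le> \<eta>\<^sup>2 * indicator K x" for x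
    proof (cases "x \<in> K")
      case True
      have "\<bar>g (x - z) - g x\<bar> \<le> \<eta>"
      proof (cases "x - z \<in> K")
        case True
        then show ?thesis using d(2)[OF \<open>x \<in> K\<close> True] z by (simp add: dist_norm)
      next
        case False
        then have "norm (x - z) > r + 2" by (simp add: K_def)
        moreover have "norm (x - z) \<le> norm x + norm z" by (rule norm_triangle_ineq4)
        ultimately have "g (x - z) = 0" "g x = 0" using z by (auto intro!: g0)
        then show ?thesis using \<eta> by simp
      qed
      then show ?thesis using True \<eta> by (simp add: abs_le_square_iff[symmetric])
    next
      case False
      then have "norm x > r + 2" by (simp add: K_def)
      moreover have "norm x \<le> norm (x - z) + norm z" using norm_triangle_ineq[of "x - z" z] by simp
      ultimately have "g (x - z) = 0" "g x = 0" using z by (auto intro!: g0)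
      then show ?thesis by simp
    qed
    have "(\<integral>\<^sup>+x. ennreal ((U (x - z) - U x)\<^sup>2) \<partial>lborel)
      \<le> (\<integral>\<^sup>+x. 3 * (ennreal ((U (x - z) - g (x - z))\<^sup>2) + ennreal (\<eta>\<^sup>2) * indicator K x + ennreal ((U x - g x)\<^sup>2)) \<partial>lborel)"
    proof (rule nn_integral_mono)
      fix x
      have "(U (x - z) - U x)\<^sup>2 = ((U (x - z) - g (x - z)) + (g (x - z) - g x) + (g x - U x))\<^sup>2" by simp
      also have "\<dots> \<le> 3 * ((U (x - z) - g (x - z))\<^sup>2 + (g (x - z) - g x)\<^sup>2 + (g x - U x)\<^sup>2)"
        by (rule square_sum3_le)
      also have "\<dots> \<le> 3 * ((U (x - z) - g (x - z))\<^sup>2 + \<eta>\<^sup>2 * indicator K x + (U x - g x)\<^sup>2)"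
        using gz[of x] by (simp add: power2_commute)
      finally have "ennreal ((U (x - z) - U x)\<^sup>2) \<le> ennreal (3 * ((U (x - z) - g (x - z))\<^sup>2 + \<eta>\<^sup>2 * indicator K x + (U x - g x)\<^sup>2))"
        by (rule ennreal_leI)
      also have "\<dots> = 3 * (ennreal ((U (x - z) - g (x - z))\<^sup>2) + ennreal (\<eta>\<^sup>2) * indicator K x + ennreal ((U x - g x)\<^sup>2))"
        by (simp add: ennreal_mult ennreal_plus indicator_def del: ennreal_plus[symmetric])
      finally show "ennreal ((U (x - z) - U x)\<^sup>2) \<le> \<dots>" .
    qed
    also have "\<dots> = 3 * ((\<integral>\<^sup>+x. ennreal ((U (x - z) - g (x - z))\<^sup>2) \<partial>lborel) + ennreal (\<eta>\<^sup>2) * emeasure lborel K + (\<integral>\<^sup>+x. ennreal ((U x - g x)\<^sup>2) \<partial>lborel))"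
    proof -
      have [measurable]: "K \<in> sets borel" by (simp add: K_def)
      show ?thesis
        by (subst nn_integral_cmult, measurable, subst nn_integral_add, measurable, subst nn_integral_add, measurable)
           (simp add: nn_integral_cmult_indicator)
    qed
    also have "(\<integral>\<^sup>+x. ennreal ((U (x - z) - g (x - z))\<^sup>2) \<partial>lborel) = (\<integral>\<^sup>+x. ennreal ((U x - g x)\<^sup>2) \<partial>lborel)"
      by (rule nn_integral_lborel_translation) simp
    also have "ennreal (\<eta>\<^sup>2) * emeasure lborel K \<le> ennreal (e / 9)"
      unfolding Km using m0 ennreal_leI[OF \<eta>(2)] by (simp add: ennreal_mult[symmetric])
    finally have "(\<integral>\<^sup>+x. ennreal ((U (x - z) - U x)\<^sup>2) \<partial>lborel) \<le> 3 * (ennreal (e / 9) + ennreal (e / 9) + ennreal (e / 9))"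
      using gU by (meson add_mono mult_left_mono order.trans order.refl zero_le)
    also have "\<dots> = ennreal e"
    proof -
      have "3 * (ennreal (e / 9) + ennreal (e / 9) + ennreal (e / 9)) = ennreal 3 * ennreal (e / 9 + e / 9 + e / 9)"
        using e by (simp only: ennreal_plus ennreal_numeral)
      also have "\<dots> = ennreal e" using e by (subst ennreal_mult[symmetric]) auto
      finally show ?thesis .
    qed
    finally show "(\<integral>\<^sup>+x. ennreal ((U (x - z) - U x)\<^sup>2) \<partial>lborel) \<le> ennreal e" .
  qed
qed

text \<open>Borel measurability, instead of Lebesgue measurability, makes \<open>U (x - z)\<close> jointly measurable for Fubini's theorem.\<close>

definition L2_loc_borel :: "('a::euclidean_space \<Rightarrow> real) \<Rightarrow> bool" where
  "L2_loc_borel u \<longleftrightarrow> u \<in> borel_measurable borel \<and>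
     (\<forall>r. integrable lborel (\<lambda>y. indicator (cball 0 r) y * (u y)\<^sup>2))"

lemma L2_loc_borel_loc_integrable:
  assumes "L2_loc_borel u"
  shows "loc_integrable u"
  unfolding loc_integrable_def
proof (intro conjI allI)
  show um: "u \<in> borel_measurable borel" using assms by (simp add: L2_loc_borel_def)
  fix r
  show "integrable lborel (\<lambda>y. indicator (cball 0 r) y * u y)"
  proof (rule Bochner_Integration.integrable_bound)
    have "integrable lborel (\<lambda>y::'a. indicator (cball 0 r) y *\<^sub>R (1::real))"
      by (rule borel_integrable_compact) auto
    then show "integrable lborel (\<lambda>y. indicator (cball 0 r) y + indicator (cball 0 r) y * (u y)\<^sup>2)"
      using assms by (simp add: L2_loc_borel_def)
    show "AE y in lborel. norm (indicator (cball 0 r) y * u y) \<le> norm (indicator (cball 0 r) y + indicator (cball 0 r) y * (u y)\<^sup>2)"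
    proof (rule AE_I2)
      fix y
      have "2 * \<bar>u y\<bar> \<le> 1 + (u y)\<^sup>2"
        using zero_le_power2[of "\<bar>u y\<bar> - 1"] by (simp add: power2_eq_square algebra_simps)
      then have "\<bar>u y\<bar> \<le> 1 + (u y)\<^sup>2" by linarith
      then show "norm (indicator (cball 0 r) y * u y) \<le> norm (indicator (cball 0 r) y + indicator (cball 0 r) y * (u y)\<^sup>2)"
        by (simp add: indicator_def)
    qed
    show "(\<lambda>y. indicator (cball 0 r) y * u y) \<in> borel_measurable lborel"
      using um by (intro borel_measurable_times borel_measurable_indicator) auto
  qed
qed

text \<open>Jensen's inequality for the probability density \<open>m (x - y)\<close>: the variance is nonnegative.\<close>

lemma conv_minus_square_le:
  fixes U m :: "'a::euclidean_space \<Rightarrow> real"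
  assumes U: "L2_loc_borel U" and [measurable]: "m \<in> borel_measurable borel"
    and m0: "\<And>z. 0 \<le> m z" and mB: "\<And>z. m z \<le> B" and ms: "\<And>z. norm z \<ge> s \<Longrightarrow> m z = 0"
    and m1: "(\<integral>z. m z \<partial>lborel) = 1"
  shows "ennreal ((conv U m x - U x)\<^sup>2) \<le> (\<integral>\<^sup>+y. ennreal (m (x - y) * (U y - U x)\<^sup>2) \<partial>lborel)"
proof -
  have [measurable]: "U \<in> borel_measurable borel" using U by (simp add: L2_loc_borel_def)
  have mb: "\<bar>m z\<bar> \<le> B" for z using m0 mB by simp
  have mint: "integrable lborel m"
    using m1 not_integrable_integral_eq by fastforce
  have m_int: "integrable lborel (\<lambda>y. m (x - y))" and m_1: "(\<integral>y. m (x - y) \<partial>lborel) = 1"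
    using lborel_reflect(2,3)[of m x] mint m1 by auto
  have Um: "integrable lborel (\<lambda>y. U y * m (x - y))"
    by (rule integrable_conv[OF L2_loc_borel_loc_integrable[OF U] _ mb ms]) simp
  have "loc_integrable (\<lambda>y. (U y)\<^sup>2)"
    using U by (simp add: loc_integrable_def L2_loc_borel_def)
  then have U2m: "integrable lborel (\<lambda>y. (U y)\<^sup>2 * m (x - y))"
    by (rule integrable_conv[OF _ _ mb ms]) simp
  define c where "c = conv U m x - U x"
  have exp: "m (x - y) * (U y - U x - t)\<^sup>2 = (U y)\<^sup>2 * m (x - y) - 2 * (U x + t) * (U y * m (x - y)) + (U x + t)\<^sup>2 * m (x - y)" for y t
    by (simp add: power2_eq_square algebra_simps)
  have int: "integrable lborel (\<lambda>y. m (x - y) * (U y - U x - t)\<^sup>2)" for t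
    unfolding exp using m_int Um U2m by auto
  have val: "(\<integral>y. m (x - y) * (U y - U x - t)\<^sup>2 \<partial>lborel) = (\<integral>y. (U y)\<^sup>2 * m (x - y) \<partial>lborel) - 2 * (U x + t) * (c + U x) + (U x + t)\<^sup>2" for t
    unfolding exp using m_int Um U2m by (simp add: m_1 c_def conv_def)
  have "0 \<le> (\<integral>y. m (x - y) * (U y - U x - c)\<^sup>2 \<partial>lborel)"
    using m0 by (intro integral_nonneg_AE) auto
  also have "\<dots> = (\<integral>y. m (x - y) * (U y - U x - 0)\<^sup>2 \<partial>lborel) - c\<^sup>2"
    unfolding val by (simp add: power2_eq_square algebra_simps)
  finally have "c\<^sup>2 \<le> (\<integral>y. m (x - y) * (U y - U x)\<^sup>2 \<partial>lborel)" by simp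
  then have "ennreal (c\<^sup>2) \<le> ennreal (\<integral>y. m (x - y) * (U y - U x)\<^sup>2 \<partial>lborel)" by (rule ennreal_leI)
  also have "\<dots> = (\<integral>\<^sup>+y. ennreal (m (x - y) * (U y - U x)\<^sup>2) \<partial>lborel)"
    using int[of 0] m0 by (intro nn_integral_eq_integral[symmetric]) auto
  finally show ?thesis by (simp add: c_def)
qed

lemma L2_conv_error_le:
  fixes U m :: "'a::euclidean_space \<Rightarrow> real"
  assumes U: "L2_loc_borel U" and [measurable]: "m \<in> borel_measurable borel"
    and m0: "\<And>z. 0 \<le> m z" and mB: "\<And>z. m z \<le> B" and ms: "\<And>z. norm z \<ge> s \<Longrightarrow> m z = 0"
    and m1: "(\<integral>z. m z \<partial>lborel) = 1"
    and tr: "\<And>z. norm z < s \<Longrightarrow> (\<integral>\<^sup>+x. ennreal ((U (x - z) - U x)\<^sup>2) \<partial>lborel) \<le> e"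
  shows "(\<integral>\<^sup>+x. ennreal ((conv U m x - U x)\<^sup>2) \<partial>lborel) \<le> e"
proof -
  have [measurable]: "U \<in> borel_measurable borel" using U by (simp add: L2_loc_borel_def)
  have mint: "integrable lborel m"
    using m1 not_integrable_integral_eq by fastforce
  have "(\<integral>\<^sup>+x. ennreal ((conv U m x - U x)\<^sup>2) \<partial>lborel)
     \<le> (\<integral>\<^sup>+x. (\<integral>\<^sup>+y. ennreal (m (x - y) * (U y - U x)\<^sup>2) \<partial>lborel) \<partial>lborel)"
    by (intro nn_integral_mono conv_minus_square_le[OF U _ m0 mB ms m1]) auto
  also have "\<dots> = (\<integral>\<^sup>+x. (\<integral>\<^sup>+z. ennreal (m z * (U (x - z) - U x)\<^sup>2) \<partial>lborel) \<partial>lborel)"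
  proof (rule nn_integral_cong)
    fix x
    show "(\<integral>\<^sup>+y. ennreal (m (x - y) * (U y - U x)\<^sup>2) \<partial>lborel) = (\<integral>\<^sup>+z. ennreal (m z * (U (x - z) - U x)\<^sup>2) \<partial>lborel)"
      using lborel_reflect(1)[of "\<lambda>y. ennreal (m (x - y) * (U y - U x)\<^sup>2)" x] by simp
  qed
  also have "\<dots> = (\<integral>\<^sup>+z. (\<integral>\<^sup>+x. ennreal (m z * (U (x - z) - U x)\<^sup>2) \<partial>lborel) \<partial>lborel)"
    by (rule lborel_pair.Fubini'[symmetric]) measurable
  also have "\<dots> \<le> (\<integral>\<^sup>+z. ennreal (m z) * e \<partial>lborel)"
  proof (rule nn_integral_mono)
    fix z
    have "(\<integral>\<^sup>+x. ennreal (m z * (U (x - z) - U x)\<^sup>2) \<partial>lborel) = ennreal (m z) * (\<integral>\<^sup>+x. ennreal ((U (x - z) - U x)\<^sup>2) \<partial>lborel)"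
      using m0 by (simp add: ennreal_mult nn_integral_cmult)
    also have "\<dots> \<le> ennreal (m z) * e"
      using tr[of z] ms[of z] by (cases "norm z < s") (auto intro: mult_left_mono)
    finally show "(\<integral>\<^sup>+x. ennreal (m z * (U (x - z) - U x)\<^sup>2) \<partial>lborel) \<le> ennreal (m z) * e" .
  qed
  also have "\<dots> = (\<integral>\<^sup>+z. ennreal (m z) \<partial>lborel) * e"
    by (rule nn_integral_multc) simp
  also have "(\<integral>\<^sup>+z. ennreal (m z) \<partial>lborel) = 1"
    using mint m0 m1 by (subst nn_integral_eq_integral) auto
  finally show ?thesis by simp
qed

definition mollifier :: "nat \<Rightarrow> 'a::euclidean_space \<Rightarrow> real" where
  "mollifier n z = kern (1 / Suc n) z / (\<integral>y. kern (1 / Suc n) y \<partial>(lborel :: 'a measure))"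

lemma kern_nonneg: "0 \<le> kern s z"
  by (simp add: kern_def kappa_def)

lemma kern_vanishes: "s > 0 \<Longrightarrow> norm z \<ge> s \<Longrightarrow> kern s z = 0"
  using power_mono[of s "norm z" 2] by (simp add: kern_def kappa_def power2_norm_eq_inner)

lemma kern_continuous: "continuous_on S (kern s :: 'a::euclidean_space \<Rightarrow> real)"
proof -
  have "(kern s :: 'a \<Rightarrow> real) = (\<lambda>z. kappa 0 (s\<^sup>2 - (z - 0) \<bullet> (z - 0)))" by (simp add: kern_def[abs_def])
  moreover have "isCont (\<lambda>z. kappa 0 (s\<^sup>2 - (z - 0) \<bullet> (z - 0))) x" for x :: 'a
    by (rule has_derivative_continuous[OF has_derivative_kappa_radial])
  ultimately show ?thesis by (auto intro!: continuous_at_imp_continuous_on)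
qed

lemma kern_integral_pos:
  assumes s: "s > 0"
  shows "(\<integral>y. kern s y \<partial>(lborel :: 'a::euclidean_space measure)) > 0"
proof (rule ccontr)
  have int: "integrable lborel (kern s :: 'a \<Rightarrow> real)"
    by (rule integrable_compactly_supported[of s]) (auto intro: kern_continuous kern_vanishes[OF s])
  have "0 \<le> (\<integral>y. kern s y \<partial>(lborel :: 'a measure))"
    by (intro integral_nonneg_AE) (simp add: kern_nonneg)
  moreover assume "\<not> ?thesis"
  ultimately have "AE y in (lborel :: 'a measure). kern s y = 0"
    using integral_nonneg_eq_0_iff_AE[OF int] kern_nonneg by auto
  moreover have [measurable]: "{y :: 'a. kern s y \<noteq> 0} \<in> sets borel"
    by (intro borel_open open_Collect_neq kern_continuous continuous_on_const)
  ultimately have "emeasure lborel {y :: 'a. kern s y \<noteq> 0} = 0"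
    by (subst (asm) AE_iff_measurable) auto
  then have "{y :: 'a. kern s y \<noteq> 0} \<in> null_sets lborel"
    by (auto simp: null_sets_def)
  then have "negligible {y :: 'a. kern s y \<noteq> 0}"
    by (simp add: negligible_iff_null_sets null_sets_completionI)
  then have "negligible (ball (0::'a) s)"
  proof (rule negligible_subset)
    show "ball (0::'a) s \<subseteq> {y. kern s y \<noteq> 0}"
    proof
      fix y :: 'a assume "y \<in> ball 0 s"
      then have "(norm y)\<^sup>2 < s\<^sup>2" by (intro power_strict_mono) auto
      then show "y \<in> {y. kern s y \<noteq> 0}" by (simp add: kern_def kappa_def power2_norm_eq_inner)
    qed
  qed
  then show False using s open_not_negligible[of "ball (0::'a) s"] by auto
qed

lemma mollifier_props:
  fixes n :: nat
  defines "m \<equiv> (mollifier n :: 'a::euclidean_space \<Rightarrow> real)"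
  shows "m \<in> borel_measurable borel" "0 \<le> m z"
    "norm z \<ge> 1 / Suc n \<Longrightarrow> m z = 0" "(\<integral>z. m z \<partial>lborel) = 1"
    "\<exists>B. \<forall>z. m z \<le> B"
proof -
  let ?s = "1 / real (Suc n)" and ?I = "\<integral>y. kern (1 / Suc n) y \<partial>(lborel :: 'a measure)"
  have s: "?s > 0" by simp
  have I: "?I > 0" by (rule kern_integral_pos[OF s])
  have c: "continuous_on UNIV m"
    unfolding m_def mollifier_def[abs_def] using I by (intro continuous_intros kern_continuous) auto
  show "m \<in> borel_measurable borel" by (rule borel_measurable_continuous_onI[OF c])
  show "0 \<le> m z" using I by (simp add: m_def mollifier_def kern_nonneg)
  show z: "m z = 0" if "norm z \<ge> ?s" for z
    using kern_vanishes[OF s that] by (simp add: m_def mollifier_def)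
  show "(\<integral>z. m z \<partial>lborel) = 1"
    unfolding m_def mollifier_def using I by simp
  have "m z = 0" if "norm z > ?s" for z using z that by simp
  from bounded_of_compactly_supported[OF c this] show "\<exists>B. \<forall>z. m z \<le> B"
    by (metis abs_le_D1 real_norm_def)
qed

lemma L2_loc_borelD:
  assumes "L2_loc_borel u"
  shows "u \<in> borel_measurable borel" "integrable lborel (\<lambda>y. indicator (cball 0 r) y * (u y)\<^sup>2)"
  using assms by (auto simp: L2_loc_borel_def)

lemma continuous_L2_loc_borel:
  fixes v :: "'a::euclidean_space \<Rightarrow> real"
  assumes "continuous_on UNIV v"
  shows "L2_loc_borel v"
  unfolding L2_loc_borel_def
proof (intro conjI allI)
  show "v \<in> borel_measurable borel" using assms by (rule borel_measurable_continuous_onI)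
  fix r
  have "integrable lborel (\<lambda>y. indicator (cball 0 r) y *\<^sub>R (v y)\<^sup>2)"
    by (intro borel_integrable_compact continuous_intros continuous_on_subset[OF assms]) auto
  then show "integrable lborel (\<lambda>y. indicator (cball 0 r) y * (v y)\<^sup>2)" by simp
qed

lemma L2_loc_borel_diff:
  assumes u: "L2_loc_borel u" and v: "L2_loc_borel v"
  shows "L2_loc_borel (\<lambda>x. u x - v x)"
  unfolding L2_loc_borel_def
proof (intro conjI allI)
  note m = L2_loc_borelD(1)[OF u] L2_loc_borelD(1)[OF v]
  show d: "(\<lambda>x. u x - v x) \<in> borel_measurable borel" using m by simp
  fix r
  show "integrable lborel (\<lambda>y. indicator (cball 0 r) y * (u y - v y)\<^sup>2)"
  proof (rule Bochner_Integration.integrable_bound)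
    show "integrable lborel (\<lambda>y. 2 * (indicator (cball 0 r) y * (u y)\<^sup>2) + 2 * (indicator (cball 0 r) y * (v y)\<^sup>2))"
      using L2_loc_borelD(2)[OF u] L2_loc_borelD(2)[OF v] by auto
    show "(\<lambda>y. indicator (cball 0 r) y * (u y - v y)\<^sup>2) \<in> borel_measurable lborel"
      using d by (intro borel_measurable_times borel_measurable_indicator borel_measurable_power) auto
    show "AE y in lborel. norm (indicator (cball 0 r) y * (u y - v y)\<^sup>2)
       \<le> norm (2 * (indicator (cball 0 r) y * (u y)\<^sup>2) + 2 * (indicator (cball 0 r) y * (v y)\<^sup>2))"
    proof (rule AE_I2)
      fix y
      have "2 * (u y)\<^sup>2 + 2 * (v y)\<^sup>2 - (u y - v y)\<^sup>2 = (u y + v y)\<^sup>2" by (simp add: power2_eq_square algebra_simps)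
      then have "(u y - v y)\<^sup>2 \<le> 2 * (u y)\<^sup>2 + 2 * (v y)\<^sup>2" using zero_le_power2[of "u y + v y"] by linarith
      then show "norm (indicator (cball 0 r) y * (u y - v y)\<^sup>2)
       \<le> norm (2 * (indicator (cball 0 r) y * (u y)\<^sup>2) + 2 * (indicator (cball 0 r) y * (v y)\<^sup>2))"
        by (simp add: indicator_def)
    qed
  qed
qed

lemma L2_loc_borel_mult_bounded:
  assumes u: "L2_loc_borel u" and [measurable]: "a \<in> borel_measurable borel"
    and a: "\<And>r. \<exists>A. \<forall>x. norm x \<le> r \<longrightarrow> \<bar>a x\<bar> \<le> A"
  shows "L2_loc_borel (\<lambda>x. a x * u x)"
  unfolding L2_loc_borel_def
proof (intro conjI allI)
  note [measurable] = L2_loc_borelD(1)[OF u]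
  show d: "(\<lambda>x. a x * u x) \<in> borel_measurable borel" by simp
  fix r
  obtain A where A: "\<And>x. norm x \<le> r \<Longrightarrow> \<bar>a x\<bar> \<le> A" using a by blast
  show "integrable lborel (\<lambda>y. indicator (cball 0 r) y * (a y * u y)\<^sup>2)"
  proof (rule Bochner_Integration.integrable_bound)
    show "integrable lborel (\<lambda>y. A\<^sup>2 * (indicator (cball 0 r) y * (u y)\<^sup>2))"
      using L2_loc_borelD(2)[OF u] by auto
    show "(\<lambda>y. indicator (cball 0 r) y * (a y * u y)\<^sup>2) \<in> borel_measurable lborel"
      using d by (intro borel_measurable_times borel_measurable_indicator borel_measurable_power) auto
    show "AE y in lborel. norm (indicator (cball 0 r) y * (a y * u y)\<^sup>2) \<le> norm (A\<^sup>2 * (indicator (cball 0 r) y * (u y)\<^sup>2))"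
    proof (rule AE_I2)
      fix y
      have "(a y)\<^sup>2 \<le> A\<^sup>2" if "norm y \<le> r"
        using A[OF that] power_mono[of "\<bar>a y\<bar>" A 2] by simp
      then have "norm y \<le> r \<Longrightarrow> (a y)\<^sup>2 * (u y)\<^sup>2 \<le> A\<^sup>2 * (u y)\<^sup>2" by (simp add: mult_right_mono)
      then show "norm (indicator (cball 0 r) y * (a y * u y)\<^sup>2) \<le> norm (A\<^sup>2 * (indicator (cball 0 r) y * (u y)\<^sup>2))"
        by (simp add: indicator_def power_mult_distrib)
    qed
  qed
qed

lemma two_mult_le: "2 * \<bar>x * y\<bar> \<le> d * x\<^sup>2 + (1 / d) * (y::real)\<^sup>2" if d: "d > 0"
proof -
  have "0 \<le> (d * \<bar>x\<bar> - \<bar>y\<bar>)\<^sup>2 / d" using d by simp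
  also have "\<dots> = d * x\<^sup>2 + (1 / d) * y\<^sup>2 - 2 * \<bar>x * y\<bar>"
    using d by (simp add: power2_eq_square abs_mult field_simps)
  finally show ?thesis by simp
qed

lemma integrable_weighted_product:
  fixes u v a :: "'a::euclidean_space \<Rightarrow> real"
  assumes u: "L2_loc_borel u" and v: "L2_loc_borel v" and [measurable]: "a \<in> borel_measurable borel"
    and A: "\<And>x. \<bar>a x\<bar> \<le> A" and supp: "\<And>x. norm x > r \<Longrightarrow> a x = 0"
  shows "integrable lborel (\<lambda>x. a x * (u x * v x))"
proof (rule Bochner_Integration.integrable_bound)
  note [measurable] = L2_loc_borelD(1)[OF u] L2_loc_borelD(1)[OF v]
  show "integrable lborel (\<lambda>x. A * (indicator (cball 0 r) x * (u x)\<^sup>2 + indicator (cball 0 r) x * (v x)\<^sup>2))"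
    using L2_loc_borelD(2)[OF u] L2_loc_borelD(2)[OF v] by auto
  show "(\<lambda>x. a x * (u x * v x)) \<in> borel_measurable lborel" by simp
  show "AE x in lborel. norm (a x * (u x * v x)) \<le> norm (A * (indicator (cball 0 r) x * (u x)\<^sup>2 + indicator (cball 0 r) x * (v x)\<^sup>2))"
  proof (rule AE_I2)
    fix x
    have "\<bar>u x * v x\<bar> \<le> (u x)\<^sup>2 + (v x)\<^sup>2" using two_mult_le[of 1 "u x" "v x"] by simp
    moreover have "A \<ge> 0" using A[of x] by linarith
    ultimately have "\<bar>a x\<bar> * \<bar>u x * v x\<bar> \<le> A * ((u x)\<^sup>2 + (v x)\<^sup>2)"
      using A[of x] by (intro mult_mono) auto
    then show "norm (a x * (u x * v x)) \<le> norm (A * (indicator (cball 0 r) x * (u x)\<^sup>2 + indicator (cball 0 r) x * (v x)\<^sup>2))"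
      using supp[of x] \<open>A \<ge> 0\<close> by (cases "norm x \<le> r") (auto simp: abs_mult)
  qed
qed

lemma integral_combination4:
  fixes P Q R S :: "'a \<Rightarrow> real"
  assumes "integrable M P" "integrable M Q" "integrable M R" "integrable M S"
  shows "(\<integral>x. A * (c * (P x + Q x) + d * (R x + S x)) \<partial>M)
     = A * (c * ((\<integral>x. P x \<partial>M) + (\<integral>x. Q x \<partial>M)) + d * ((\<integral>x. R x \<partial>M) + (\<integral>x. S x \<partial>M)))"
  using assms by simp

text \<open>The difference of the products is \<open>p * q + u x * q + v x * p\<close> with the errors \<open>p\<close> and \<open>q\<close>. Each mixed product is split
with a small parameter \<open>d\<close>, so that errors enter with a large factor and \<open>u\<close>, \<open>v\<close> with a small one.\<close>

lemma tendsto_weighted_product: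
  fixes u v a :: "'a::euclidean_space \<Rightarrow> real"
  assumes u: "L2_loc_borel u" and v: "L2_loc_borel v"
    and un: "\<And>n. L2_loc_borel (un n)" and vn: "\<And>n. L2_loc_borel (vn n)"
    and ulim: "(\<lambda>n. \<integral>x. indicator (cball 0 r) x * (un n x - u x)\<^sup>2 \<partial>lborel) \<longlonglongrightarrow> 0"
    and vlim: "(\<lambda>n. \<integral>x. indicator (cball 0 r) x * (vn n x - v x)\<^sup>2 \<partial>lborel) \<longlonglongrightarrow> 0"
    and [measurable]: "a \<in> borel_measurable borel"
    and A: "\<And>x. \<bar>a x\<bar> \<le> A" and supp: "\<And>x. norm x > r \<Longrightarrow> a x = 0"
  shows "(\<lambda>n. \<integral>x. a x * (un n x * vn n x) \<partial>lborel) \<longlonglongrightarrow> (\<integral>x. a x * (u x * v x) \<partial>lborel)"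
proof -
  let ?I = "\<lambda>w. \<integral>x. indicator (cball 0 r) x * (w x)\<^sup>2 \<partial>lborel"
  define E where "E n = ?I (\<lambda>x. un n x - u x) + ?I (\<lambda>x. vn n x - v x)" for n
  define M where "M = ?I u + ?I v"
  have E0: "E \<longlonglongrightarrow> 0" unfolding E_def using tendsto_add[OF ulim vlim] by simp
  have M0: "M \<ge> 0" unfolding M_def by (intro add_nonneg_nonneg integral_nonneg_AE AE_I2) auto
  have A0: "A \<ge> 0" using A[of undefined] by linarith
  have bound: "\<bar>(\<integral>x. a x * (un n x * vn n x) \<partial>lborel) - (\<integral>x. a x * (u x * v x) \<partial>lborel)\<bar> \<le> A * ((1 + 1 / d) * E n + d * M)"
    if d: "d > 0" for d n
  proof -
    note D = L2_loc_borel_diff[OF un[of n] u] L2_loc_borel_diff[OF vn[of n] v]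
    note int = L2_loc_borelD(2)[OF D(1), of r] L2_loc_borelD(2)[OF D(2), of r] L2_loc_borelD(2)[OF u, of r] L2_loc_borelD(2)[OF v, of r]
    note i1 = integrable_weighted_product[OF un[of n] vn[of n] _ A supp]
    note i2 = integrable_weighted_product[OF u v _ A supp]
    have "\<bar>(\<integral>x. a x * (un n x * vn n x) \<partial>lborel) - (\<integral>x. a x * (u x * v x) \<partial>lborel)\<bar>
       = \<bar>\<integral>x. a x * (un n x * vn n x) - a x * (u x * v x) \<partial>lborel\<bar>"
      using i1 i2 by simp
    also have "\<dots> \<le> (\<integral>x. A * ((1 + 1 / d) * (indicator (cball 0 r) x * (un n x - u x)\<^sup>2 + indicator (cball 0 r) x * (vn n x - v x)\<^sup>2)
         + d * (indicator (cball 0 r) x * (u x)\<^sup>2 + indicator (cball 0 r) x * (v x)\<^sup>2)) \<partial>lborel)"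
    proof (rule order_trans[OF integral_norm_bound[where 'a = real, unfolded real_norm_def]], rule integral_mono)
      show "integrable lborel (\<lambda>x. \<bar>a x * (un n x * vn n x) - a x * (u x * v x)\<bar>)" using i1 i2 by auto
      show "integrable lborel (\<lambda>x. A * ((1 + 1 / d) * (indicator (cball 0 r) x * (un n x - u x)\<^sup>2 + indicator (cball 0 r) x * (vn n x - v x)\<^sup>2)
         + d * (indicator (cball 0 r) x * (u x)\<^sup>2 + indicator (cball 0 r) x * (v x)\<^sup>2)))"
        using int by auto
      fix x
      define p q where "p = un n x - u x" and "q = vn n x - v x"
      have eq: "a x * (un n x * vn n x) - a x * (u x * v x) = a x * (p * q + u x * q + v x * p)"
        by (simp add: p_def q_def algebra_simps)
      have "\<bar>p * q + u x * q + v x * p\<bar> \<le> \<bar>p * q\<bar> + \<bar>u x * q\<bar> + \<bar>v x * p\<bar>" by linarith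
      also have "\<dots> \<le> (1 + 1 / d) * (p\<^sup>2 + q\<^sup>2) + d * ((u x)\<^sup>2 + (v x)\<^sup>2)"
      proof -
        have "0 \<le> p\<^sup>2" "0 \<le> q\<^sup>2" "0 \<le> (1/d) * p\<^sup>2" "0 \<le> (1/d) * q\<^sup>2" "0 \<le> d * (u x)\<^sup>2" "0 \<le> d * (v x)\<^sup>2"
          using d by auto
        then show ?thesis
          using two_mult_le[of 1 p q] two_mult_le[OF d, of "u x" q] two_mult_le[OF d, of "v x" p]
          by (simp only: ring_distribs) linarith
      qed
      finally have "\<bar>a x\<bar> * \<bar>p * q + u x * q + v x * p\<bar> \<le> A * ((1 + 1 / d) * (p\<^sup>2 + q\<^sup>2) + d * ((u x)\<^sup>2 + (v x)\<^sup>2))"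
        using A[of x] A0 by (intro mult_mono) auto
      then show "\<bar>a x * (un n x * vn n x) - a x * (u x * v x)\<bar>
        \<le> A * ((1 + 1 / d) * (indicator (cball 0 r) x * (un n x - u x)\<^sup>2 + indicator (cball 0 r) x * (vn n x - v x)\<^sup>2)
         + d * (indicator (cball 0 r) x * (u x)\<^sup>2 + indicator (cball 0 r) x * (v x)\<^sup>2))"
        unfolding eq p_def[symmetric] q_def[symmetric] using supp[of x]
        by (cases "norm x \<le> r") (auto simp: abs_mult)
    qed
    also have "\<dots> = A * ((1 + 1 / d) * E n + d * M)"
      by (simp only: integral_combination4[OF int, of A "1 + 1 / d" d] E_def M_def)
    finally show ?thesis .
  qed
  show ?thesis
  proof (rule LIMSEQ_I)
    fix e :: real assume e: "e > 0"
    define d where "d = e / (2 * (A * M + 1))"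
    have AM: "A * M \<ge> 0" using A0 M0 by simp
    have d: "d > 0" using e AM by (simp add: d_def)
    have dM: "A * (d * M) \<le> e / 2"
    proof -
      have "A * (d * M) = (e / 2) * ((A * M) / (A * M + 1))" by (simp add: d_def)
      also have "\<dots> \<le> (e / 2) * 1" using e AM by (intro mult_left_mono) auto
      finally show ?thesis by simp
    qed
    have "(\<lambda>n. A * ((1 + 1 / d) * E n)) \<longlonglongrightarrow> A * ((1 + 1 / d) * 0)" by (intro tendsto_intros E0)
    then have "eventually (\<lambda>n. A * ((1 + 1 / d) * E n) < e / 2) sequentially"
      using e by (intro order_tendstoD) auto
    then obtain N where N: "\<And>n. n \<ge> N \<Longrightarrow> A * ((1 + 1 / d) * E n) < e / 2"
      by (auto simp: eventually_sequentially)
    show "\<exists>N. \<forall>n\<ge>N. norm ((\<integral>x. a x * (un n x * vn n x) \<partial>lborel) - (\<integral>x. a x * (u x * v x) \<partial>lborel)) < e"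
    proof (intro exI allI impI)
      fix n assume "n \<ge> N"
      then have "A * ((1 + 1 / d) * E n + d * M) < e" unfolding distrib_left using N[of n] dM by linarith
      then show "norm ((\<integral>x. a x * (un n x * vn n x) \<partial>lborel) - (\<integral>x. a x * (u x * v x) \<partial>lborel)) < e"
        using bound[OF d, of n] by simp
    qed
  qed
qed

lemma conv_mollifier:
  "conv u (mollifier n) = conv (\<lambda>x. u x / (\<integral>y. kern (1 / Suc n) y \<partial>(lborel :: 'a::euclidean_space measure))) (kern (1 / Suc n))"
  for u :: "'a::euclidean_space \<Rightarrow> real"
  unfolding conv_def[abs_def] mollifier_def by (simp add: mult.commute)

lemma C2_with_mollified:
  fixes u :: "real ^ 'n \<Rightarrow> real"
  assumes u: "loc_integrable u"
    and weak: "\<And>\<phi>. test_function \<phi> \<Longrightarrow> (\<integral>x. u x * laplacian \<phi> x \<partial>lborel) = (\<integral>x. f x * \<phi> x \<partial>lborel)"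
  obtains g H where "C2_with (conv u (mollifier n)) g H" "\<And>x. lintrace (H x) = conv f (mollifier n) x"
proof -
  let ?I = "\<integral>y. kern (1 / Suc n) y \<partial>(lborel :: (real ^ 'n) measure)"
  show ?thesis
  proof (rule C2_with_conv_kern[where u = "\<lambda>x. u x / ?I" and f = "\<lambda>x. f x / ?I" and s = "1 / Suc n"])
    show "loc_integrable (\<lambda>x. u x / ?I)" using u by (auto simp: loc_integrable_def)
    show "(\<integral>x. u x / ?I * laplacian \<phi> x \<partial>lborel) = (\<integral>x. f x / ?I * \<phi> x \<partial>lborel)" if "test_function \<phi>" for \<phi>
      using weak[OF that] by simp
    show thesis if "C2_with (conv (\<lambda>x. u x / ?I) (kern (1 / Suc n))) g H"
      "\<And>x. lintrace (H x) = conv (\<lambda>x. f x / ?I) (kern (1 / Suc n)) x" for g H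
      using that by (intro \<open>\<And>g H. C2_with (conv u (mollifier n)) g H \<Longrightarrow> (\<And>x. lintrace (H x) = conv f (mollifier n) x) \<Longrightarrow> thesis\<close>)
        (simp_all only: conv_mollifier)
  qed simp
qed

lemma L2_loc_borel_mollified:
  fixes u :: "real ^ 'n \<Rightarrow> real"
  assumes "L2_loc_borel u"
  shows "L2_loc_borel (conv u (mollifier n))"
proof (rule continuous_L2_loc_borel)
  have "loc_integrable (\<lambda>x. u x / (\<integral>y. kern (1 / Suc n) y \<partial>(lborel :: (real ^ 'n) measure)))"
    using L2_loc_borel_loc_integrable[OF assms] by (auto simp: loc_integrable_def)
  then show "continuous_on UNIV (conv u (mollifier n))"
    unfolding conv_mollifier by (rule continuous_on_conv[OF _ bump_kern]) simp
qed

text \<open>Near the ball of radius \<open>r\<close> only the values of \<open>u\<close> in a slightly larger ball matter, so \<open>u\<close> may be replaced by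
its restriction \<open>U\<close>, for which translations are continuous in the mean.\<close>

lemma mollified_tendsto_L2_loc:
  fixes u :: "real ^ 'n \<Rightarrow> real"
  assumes u: "L2_loc_borel u"
  shows "(\<lambda>n. \<integral>x. indicator (cball 0 r) x * (conv u (mollifier n) x - u x)\<^sup>2 \<partial>lborel) \<longlonglongrightarrow> 0"
proof -
  define U where "U x = indicator (cball 0 (r + 1)) x * u x" for x
  have [measurable]: "u \<in> borel_measurable borel" by (rule L2_loc_borelD(1)[OF u])
  have Um[measurable]: "U \<in> borel_measurable borel"
    unfolding U_def[abs_def] by (intro borel_measurable_times borel_measurable_indicator) auto
  have UL: "L2_loc_borel U"
    unfolding U_def[abs_def]
    by (rule L2_loc_borel_mult_bounded[OF u]) (auto intro!: exI[of _ 1] borel_measurable_indicator simp: indicator_def)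
  have U2: "integrable lborel (\<lambda>x. (U x)\<^sup>2)"
  proof -
    have "(\<lambda>x. (U x)\<^sup>2) = (\<lambda>x. indicator (cball 0 (r + 1)) x * (u x)\<^sup>2)"
      by (auto simp: U_def indicator_def fun_eq_iff)
    then show ?thesis using L2_loc_borelD(2)[OF u, of "r + 1"] by simp
  qed
  have Us: "U x = 0" if "norm x > r + 1" for x using that by (simp add: U_def)
  show ?thesis
  proof (rule LIMSEQ_I)
    fix e :: real assume e: "e > 0"
    then have e2: "e / 2 > 0" by simp
    obtain \<delta> where \<delta>: "\<delta> > 0"
      "\<And>z. norm z < \<delta> \<Longrightarrow> (\<integral>\<^sup>+x. ennreal ((U (x - z) - U x)\<^sup>2) \<partial>lborel) \<le> ennreal (e / 2)"
      using L2_translation_continuous[OF Um U2 Us e2] by blast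
    obtain N where N: "1 / real (Suc N) < \<delta>" using \<delta>(1) by (metis nat_approx_posE)
    show "\<exists>N. \<forall>n\<ge>N. norm ((\<integral>x. indicator (cball 0 r) x * (conv u (mollifier n) x - u x)\<^sup>2 \<partial>lborel) - 0) < e"
    proof (intro exI allI impI)
      fix n assume n: "n \<ge> N"
      have "1 / real (Suc n) \<le> 1 / real (Suc N)" using n by (intro divide_left_mono) auto
      then have nd: "1 / real (Suc n) < \<delta>" using N by linarith
      obtain B where B: "\<And>z :: real ^ 'n. mollifier n z \<le> B" using mollifier_props(5) by blast
      have err: "(\<integral>\<^sup>+x. ennreal ((conv U (mollifier n) x - U x)\<^sup>2) \<partial>lborel) \<le> ennreal (e / 2)"
      proof (rule L2_conv_error_le[OF UL mollifier_props(1,2) B mollifier_props(3,4)])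
        fix z :: "real ^ 'n" assume "norm z < 1 / real (Suc n)"
        then show "(\<integral>\<^sup>+x. ennreal ((U (x - z) - U x)\<^sup>2) \<partial>lborel) \<le> ennreal (e / 2)"
          using nd by (intro \<delta>(2)) simp
      qed
      have same: "conv u (mollifier n) x = conv U (mollifier n) x" "u x = U x" if x: "norm x \<le> r" for x
      proof -
        show "u x = U x" using x by (simp add: U_def)
        show "conv u (mollifier n) x = conv U (mollifier n) x"
          unfolding conv_def
        proof (rule Bochner_Integration.integral_cong[OF refl])
          fix y
          show "u y * mollifier n (x - y) = U y * mollifier n (x - y)"
          proof (cases "norm y \<le> r + 1")
            case False
            then have "norm (x - y) \<ge> 1" using x norm_triangle_ineq3[of x y] by linarith
            moreover have "1 / real (Suc n) \<le> 1" by simp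
            ultimately have "mollifier n (x - y) = 0" by (intro mollifier_props(3)) linarith
            then show ?thesis by simp
          qed (simp add: U_def)
        qed
      qed
      have "(\<integral>x. indicator (cball 0 r) x * (conv u (mollifier n) x - u x)\<^sup>2 \<partial>lborel)
        = enn2real (\<integral>\<^sup>+x. ennreal (indicator (cball 0 r) x * (conv u (mollifier n) x - u x)\<^sup>2) \<partial>lborel)"
        using L2_loc_borelD(2)[OF L2_loc_borel_diff[OF L2_loc_borel_mollified[OF u] u], of r]
        by (intro integral_eq_nn_integral) auto
      also have "\<dots> \<le> e / 2"
      proof (rule enn2real_leI)
        have "(\<integral>\<^sup>+x. ennreal (indicator (cball 0 r) x * (conv u (mollifier n) x - u x)\<^sup>2) \<partial>lborel)
           \<le> (\<integral>\<^sup>+x. ennreal ((conv U (mollifier n) x - U x)\<^sup>2) \<partial>lborel)"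
          by (intro nn_integral_mono ennreal_leI) (auto simp: indicator_def same)
        also have "\<dots> \<le> ennreal (e / 2)" by (rule err)
        finally show "(\<integral>\<^sup>+x. ennreal (indicator (cball 0 r) x * (conv u (mollifier n) x - u x)\<^sup>2) \<partial>lborel) \<le> ennreal (e / 2)" .
      qed (use e in simp)
      also have "\<dots> < e" using e by simp
      finally have "(\<integral>x. indicator (cball 0 r) x * (conv u (mollifier n) x - u x)\<^sup>2 \<partial>lborel) < e" .
      moreover have "0 \<le> (\<integral>x. indicator (cball 0 r) x * (conv u (mollifier n) x - u x)\<^sup>2 \<partial>lborel)"
        by (intro integral_nonneg_AE AE_I2) auto
      ultimately show "norm ((\<integral>x. indicator (cball 0 r) x * (conv u (mollifier n) x - u x)\<^sup>2 \<partial>lborel) - 0) < e" by simp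
    qed
  qed
qed

section \<open>The Carleman inequality with cut-offs\<close>

text \<open>The Carleman inequality for \<open>v = \<xi> * w\<close>. The Laplacian of the product contributes \<open>2 * (g\<xi> x \<bullet> g x)\<close>; the function
\<open>\<eta>\<close> dominates the weighted square of its coefficient and turns the square of the gradient of \<open>w\<close> into \<open>w\<close> and its Laplacian.\<close>

lemma weighted_cutoff_inequality:
  fixes w q \<xi> \<eta> :: "'a::euclidean_space \<Rightarrow> real" and k j :: nat
  assumes w: "C2_with w g H" and chi: "C2_with \<xi> g\<xi> H\<xi>" and eta: "C2_with \<eta> g\<eta> H\<eta>"
    and supp: "\<And>x. norm x > r \<Longrightarrow> \<xi> x = 0" "\<And>x. norm x > r \<Longrightarrow> \<eta> x = 0"
    and grad: "\<And>x. (x \<bullet> x) ^ (k + 2) * (4 * (g\<xi> x \<bullet> g\<xi> x)) \<le> \<eta> x"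
    and j: "j = k + 1 \<or> k = j + 1"
    and c: "c \<ge> 0" "\<And>x. \<xi> x \<noteq> 0 \<or> g\<xi> x \<noteq> 0 \<Longrightarrow> (x \<bullet> x) ^ j \<le> c * (x \<bullet> x) ^ k"
    and [measurable]: "q \<in> borel_measurable borel"
    and qb: "\<And>x. norm x \<le> r \<Longrightarrow> \<bar>q x\<bar> \<le> A"
    and pot: "\<And>v g H. C2_with v g H \<Longrightarrow> (\<And>x. \<xi> x = 0 \<Longrightarrow> v x = 0) \<Longrightarrow>
        (\<integral>x. q x * ((x \<bullet> x) ^ (k + 1) * (v x * (x \<bullet> g x + (real DIM('a) / 2 + real k) * v x))) \<partial>lborel) \<le> 0"
  shows "(2 * real k + 2)\<^sup>2 * (\<integral>x. ((x \<bullet> x) ^ j * (\<xi> x)\<^sup>2) * (w x * w x) \<partial>lborel)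
    \<le> 3 * c * ((\<integral>x. ((x \<bullet> x) ^ (k + 2) * (\<xi> x)\<^sup>2) * ((lintrace (H x) + q x * w x) * (lintrace (H x) + q x * w x)) \<partial>lborel)
       + (\<integral>x. ((x \<bullet> x) ^ (k + 2) * (lintrace (H\<xi> x))\<^sup>2 + lintrace (H\<eta> x) / 2) * (w x * w x) \<partial>lborel)
       - (\<integral>x. \<eta> x * (w x * lintrace (H x)) \<partial>lborel))"
proof -
  note d = C2_withD[OF w] and dc = C2_withD[OF chi] and de = C2_withD[OF eta]
  define v where "v x = \<xi> x * w x" for x
  define gv where "gv x = \<xi> x *\<^sub>R g x + w x *\<^sub>R g\<xi> x" for x
  define Hv where "Hv x h = (\<xi> x *\<^sub>R H x h + (g\<xi> x \<bullet> h) *\<^sub>R g x) + (w x *\<^sub>R H\<xi> x h + (g x \<bullet> h) *\<^sub>R g\<xi> x)" for x h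
  have v: "C2_with v gv Hv"
    using C2_with_mult[OF chi w] unfolding v_def gv_def Hv_def .
  note dv = C2_withD[OF v]
  have trv: "lintrace (Hv x) = \<xi> x * lintrace (H x) + w x * lintrace (H\<xi> x) + 2 * (g\<xi> x \<bullet> g x)" for x
    unfolding Hv_def by (rule lintrace_C2_mult)
  have vs: "v x = 0" if "norm x > r" for x using supp that by (simp add: v_def)
  have zv: "v x = 0" "gv x = 0" "lintrace (Hv x) = 0" if "norm x > r" for x
    using C2_with_vanishing[OF v vs that] by auto
  have zc: "\<xi> x = 0" "g\<xi> x = 0" "lintrace (H\<xi> x) = 0" if "norm x > r" for x
    using C2_with_vanishing[OF chi supp(1) that] by auto
  have ze: "\<eta> x = 0" "lintrace (H\<eta> x) = 0" if "norm x > r" for x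
    using C2_with_vanishing[OF eta supp(2) that] by auto
  define Z where "Z x = x \<bullet> gv x + (real DIM('a) / 2 + real k) * v x" for x
  have Zc: "continuous_on S Z" for S unfolding Z_def by (intro continuous_intros dv)
  have zZ: "Z x = 0" if "norm x > r" for x using zv[OF that] by (simp add: Z_def)
  have L: "L2_loc_borel f" if "continuous_on UNIV f" for f :: "'a \<Rightarrow> real"
    by (rule continuous_L2_loc_borel[OF that])
  have qint: "integrable lborel (\<lambda>x. q x * f x)" if f: "continuous_on UNIV f" "\<And>x. norm x > r \<Longrightarrow> f x = 0" for f
  proof (rule Bochner_Integration.integrable_bound)
    show "integrable lborel (\<lambda>x. A * f x)"
      using f by (intro integrable_mult_right integrable_compactly_supported[of r]) (auto intro: continuous_on_subset)
    have [measurable]: "f \<in> borel_measurable borel" using f(1) by (rule borel_measurable_continuous_onI)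
    show "(\<lambda>x. q x * f x) \<in> borel_measurable lborel" by simp
    show "AE x in lborel. norm (q x * f x) \<le> norm (A * f x)"
    proof (rule AE_I2)
      fix x show "norm (q x * f x) \<le> norm (A * f x)"
        using f(2)[of x] qb[of x] by (cases "norm x \<le> r") (auto simp: abs_mult intro!: mult_right_mono)
    qed
  qed
  have q2int: "integrable lborel (\<lambda>x. (q x)\<^sup>2 * f x)" if f: "continuous_on UNIV f" "\<And>x. norm x > r \<Longrightarrow> f x = 0" for f
  proof (rule Bochner_Integration.integrable_bound)
    show "integrable lborel (\<lambda>x. A\<^sup>2 * f x)"
      using f by (intro integrable_mult_right integrable_compactly_supported[of r]) (auto intro: continuous_on_subset)
    have [measurable]: "f \<in> borel_measurable borel" using f(1) by (rule borel_measurable_continuous_onI)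
    show "(\<lambda>x. (q x)\<^sup>2 * f x) \<in> borel_measurable lborel" by simp
    show "AE x in lborel. norm ((q x)\<^sup>2 * f x) \<le> norm (A\<^sup>2 * f x)"
    proof (rule AE_I2)
      fix x show "norm ((q x)\<^sup>2 * f x) \<le> norm (A\<^sup>2 * f x)"
        using f(2)[of x] qb[of x] power_mono[of "\<bar>q x\<bar>" A 2]
        by (cases "norm x \<le> r") (auto simp: abs_mult intro!: mult_right_mono)
    qed
  qed
  have cint: "integrable lborel f" if "continuous_on UNIV f" "\<And>x. norm x > r \<Longrightarrow> f x = 0" for f :: "'a \<Rightarrow> real"
    using that by (intro integrable_compactly_supported[of r]) (auto intro: continuous_on_subset)
  \<comment> \<open>\<open>q\<close> is only measurable and bounded, so squares are expanded to separate it from continuous factors\<close>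
  have sq: "integrable lborel (\<lambda>x. a x * (b x + q x * e x)\<^sup>2)"
    if "continuous_on UNIV a" "continuous_on UNIV b" "continuous_on UNIV e"
      "\<And>x. norm x > r \<Longrightarrow> a x * b x = 0" "\<And>x. norm x > r \<Longrightarrow> a x * e x = 0" for a b e :: "'a \<Rightarrow> real"
  proof -
    have "integrable lborel (\<lambda>x. a x * (b x)\<^sup>2 + q x * (2 * (a x * b x * e x)) + (q x)\<^sup>2 * (a x * (e x)\<^sup>2))"
    proof (intro Bochner_Integration.integrable_add)
      show "integrable lborel (\<lambda>x. a x * (b x)\<^sup>2)"
        using that by (intro cint continuous_intros) (auto simp: power2_eq_square mult.assoc[symmetric])
      show "integrable lborel (\<lambda>x. q x * (2 * (a x * b x * e x)))"
        using that by (intro qint continuous_intros) auto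
      show "integrable lborel (\<lambda>x. (q x)\<^sup>2 * (a x * (e x)\<^sup>2))"
        using that by (intro q2int continuous_intros) (auto simp: power2_eq_square mult.assoc[symmetric])
    qed
    moreover have "(\<lambda>x. a x * (b x)\<^sup>2 + q x * (2 * (a x * b x * e x)) + (q x)\<^sup>2 * (a x * (e x)\<^sup>2)) = (\<lambda>x. a x * (b x + q x * e x)\<^sup>2)"
      by (simp add: power2_eq_square algebra_simps fun_eq_iff)
    ultimately show ?thesis by simp
  qed
  have Xc: "continuous_on UNIV (\<lambda>x::'a. (x \<bullet> x) ^ i)" for i by (intro continuous_intros)
  have carl: "(2 * real k + 2)\<^sup>2 * (\<integral>x. (x \<bullet> x) ^ k * (Z x)\<^sup>2 \<partial>lborel)
     \<le> (\<integral>x. (x \<bullet> x) ^ (k + 2) * (lintrace (Hv x) + q x * v x)\<^sup>2 \<partial>lborel)"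
    unfolding Z_def
  proof (rule carleman[OF v vs])
    show "integrable lborel (\<lambda>x. q x * ((x \<bullet> x) ^ (k + 1) * (v x * (x \<bullet> gv x + (real DIM('a) / 2 + real k) * v x))))"
      using zv by (intro qint continuous_intros dv) auto
    show "(\<integral>x. q x * ((x \<bullet> x) ^ (k + 1) * (v x * (x \<bullet> gv x + (real DIM('a) / 2 + real k) * v x))) \<partial>lborel) \<le> 0"
      by (rule pot[OF v]) (simp add: v_def)
    show "integrable lborel (\<lambda>x. (x \<bullet> x) ^ (k + 2) * (lintrace (Hv x) + q x * v x)\<^sup>2)"
      using zv by (intro sq Xc dv) auto
  qed
  have "(\<integral>x. (x \<bullet> x) ^ j * (v x)\<^sup>2 \<partial>lborel) \<le> (\<integral>x. (x \<bullet> x) ^ j * (Z x)\<^sup>2 \<partial>lborel)"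
    unfolding Z_def by (rule weighted_poincare[OF v vs j])
  also have "\<dots> \<le> (\<integral>x. c * ((x \<bullet> x) ^ k * (Z x)\<^sup>2) \<partial>lborel)"
  proof (rule integral_mono)
    show "integrable lborel (\<lambda>x. (x \<bullet> x) ^ j * (Z x)\<^sup>2)" "integrable lborel (\<lambda>x. c * ((x \<bullet> x) ^ k * (Z x)\<^sup>2))"
      using zZ by (auto intro!: cint continuous_intros Zc)
    fix x
    show "(x \<bullet> x) ^ j * (Z x)\<^sup>2 \<le> c * ((x \<bullet> x) ^ k * (Z x)\<^sup>2)"
    proof (cases "\<xi> x \<noteq> 0 \<or> g\<xi> x \<noteq> 0")
      case True
      from mult_right_mono[OF c(2)[OF True], of "(Z x)\<^sup>2"] show ?thesis by (simp add: mult.assoc)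
    next
      case False
      then have "Z x = 0" by (simp add: Z_def gv_def v_def)
      then show ?thesis by simp
    qed
  qed
  also have "\<dots> = c * (\<integral>x. (x \<bullet> x) ^ k * (Z x)\<^sup>2 \<partial>lborel)" by simp
  finally have "(2 * real k + 2)\<^sup>2 * (\<integral>x. (x \<bullet> x) ^ j * (v x)\<^sup>2 \<partial>lborel) \<le> (2 * real k + 2)\<^sup>2 * (c * (\<integral>x. (x \<bullet> x) ^ k * (Z x)\<^sup>2 \<partial>lborel))"
    by (intro mult_left_mono) auto
  also have "\<dots> = c * ((2 * real k + 2)\<^sup>2 * (\<integral>x. (x \<bullet> x) ^ k * (Z x)\<^sup>2 \<partial>lborel))" by simp
  also have "\<dots> \<le> c * (\<integral>x. (x \<bullet> x) ^ (k + 2) * (lintrace (Hv x) + q x * v x)\<^sup>2 \<partial>lborel)"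
    using carl c by (intro mult_left_mono)
  finally have step1: "(2 * real k + 2)\<^sup>2 * (\<integral>x. (x \<bullet> x) ^ j * (v x)\<^sup>2 \<partial>lborel) \<le> c * (\<integral>x. (x \<bullet> x) ^ (k + 2) * (lintrace (Hv x) + q x * v x)\<^sup>2 \<partial>lborel)" .
  define P1 where "P1 x = ((x \<bullet> x) ^ (k + 2) * (\<xi> x)\<^sup>2) * (lintrace (H x) + q x * w x)\<^sup>2" for x
  define P2 where "P2 x = ((x \<bullet> x) ^ (k + 2) * (lintrace (H\<xi> x))\<^sup>2) * (w x)\<^sup>2" for x
  define P3 where "P3 x = \<eta> x * (g x \<bullet> g x)" for x
  have i1: "integrable lborel P1"
    unfolding P1_def using zc by (intro sq continuous_intros d dc) auto
  have i2: "integrable lborel P2"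
    unfolding P2_def using zc by (intro cint continuous_intros d dc) auto
  have i3: "integrable lborel P3"
    unfolding P3_def using ze by (intro cint continuous_intros d de) auto
  have ie: "integrable lborel (\<lambda>x. lintrace (H\<eta> x) / 2 * (w x)\<^sup>2)" "integrable lborel (\<lambda>x. \<eta> x * (w x * lintrace (H x)))"
    using ze by (auto intro!: cint continuous_intros d de)
  have "(\<integral>x. (x \<bullet> x) ^ (k + 2) * (lintrace (Hv x) + q x * v x)\<^sup>2 \<partial>lborel) \<le> (\<integral>x. 3 * (P1 x + P2 x + P3 x) \<partial>lborel)"
  proof (rule integral_mono)
    show "integrable lborel (\<lambda>x. (x \<bullet> x) ^ (k + 2) * (lintrace (Hv x) + q x * v x)\<^sup>2)"
      using zv by (intro sq Xc dv) auto
    show "integrable lborel (\<lambda>x. 3 * (P1 x + P2 x + P3 x))" using i1 i2 i3 by auto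
    fix x
    have "lintrace (Hv x) + q x * v x = \<xi> x * (lintrace (H x) + q x * w x) + lintrace (H\<xi> x) * w x + 2 * (g\<xi> x \<bullet> g x)"
      unfolding trv v_def by (simp add: algebra_simps)
    then have "(lintrace (Hv x) + q x * v x)\<^sup>2 \<le> 3 * ((\<xi> x * (lintrace (H x) + q x * w x))\<^sup>2 + (lintrace (H\<xi> x) * w x)\<^sup>2 + (2 * (g\<xi> x \<bullet> g x))\<^sup>2)"
      using square_sum3_le by (simp only:)
    then have "(x \<bullet> x) ^ (k + 2) * (lintrace (Hv x) + q x * v x)\<^sup>2
      \<le> (x \<bullet> x) ^ (k + 2) * (3 * ((\<xi> x * (lintrace (H x) + q x * w x))\<^sup>2 + (lintrace (H\<xi> x) * w x)\<^sup>2 + (2 * (g\<xi> x \<bullet> g x))\<^sup>2))"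
      by (intro mult_left_mono) auto
    also have "\<dots> = 3 * (P1 x + P2 x + (x \<bullet> x) ^ (k + 2) * (2 * (g\<xi> x \<bullet> g x))\<^sup>2)"
      unfolding P1_def P2_def power_mult_distrib[of "\<xi> x"] power_mult_distrib[of "lintrace (H\<xi> x)"]
      by (simp only: distrib_left mult_ac)
    also have "(x \<bullet> x) ^ (k + 2) * (2 * (g\<xi> x \<bullet> g x))\<^sup>2 \<le> P3 x"
    proof -
      have "(g\<xi> x \<bullet> g x)\<^sup>2 \<le> (g\<xi> x \<bullet> g\<xi> x) * (g x \<bullet> g x)" by (rule Cauchy_Schwarz_ineq)
      then have "(x \<bullet> x) ^ (k + 2) * (4 * (g\<xi> x \<bullet> g x)\<^sup>2) \<le> (x \<bullet> x) ^ (k + 2) * (4 * ((g\<xi> x \<bullet> g\<xi> x) * (g x \<bullet> g x)))"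
        by (intro mult_left_mono) auto
      also have "\<dots> = ((x \<bullet> x) ^ (k + 2) * (4 * (g\<xi> x \<bullet> g\<xi> x))) * (g x \<bullet> g x)" by (simp only: mult.assoc)
      also have "\<dots> \<le> \<eta> x * (g x \<bullet> g x)" using grad by (intro mult_right_mono) auto
      finally show ?thesis by (simp add: P3_def power_mult_distrib)
    qed
    finally show "(x \<bullet> x) ^ (k + 2) * (lintrace (Hv x) + q x * v x)\<^sup>2 \<le> 3 * (P1 x + P2 x + P3 x)" by simp
  qed
  also have "\<dots> = 3 * ((\<integral>x. P1 x \<partial>lborel) + (\<integral>x. P2 x \<partial>lborel) + (\<integral>x. P3 x \<partial>lborel))"
    using i1 i2 i3 by simp
  also have "(\<integral>x. P3 x \<partial>lborel) = (\<integral>x. lintrace (H\<eta> x) / 2 * (w x)\<^sup>2 - \<eta> x * (w x * lintrace (H x)) \<partial>lborel)"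
    unfolding P3_def using integral_gradient_square[OF w eta supp(2), of r] by (simp add: mult.assoc)
  also have "\<dots> = (\<integral>x. lintrace (H\<eta> x) / 2 * (w x)\<^sup>2 \<partial>lborel) - (\<integral>x. \<eta> x * (w x * lintrace (H x)) \<partial>lborel)"
    using ie by simp
  finally have step2: "(\<integral>x. (x \<bullet> x) ^ (k + 2) * (lintrace (Hv x) + q x * v x)\<^sup>2 \<partial>lborel)
    \<le> 3 * ((\<integral>x. P1 x \<partial>lborel) + (\<integral>x. P2 x \<partial>lborel) + ((\<integral>x. lintrace (H\<eta> x) / 2 * (w x)\<^sup>2 \<partial>lborel) - (\<integral>x. \<eta> x * (w x * lintrace (H x)) \<partial>lborel)))" .
  have "(\<integral>x. P2 x \<partial>lborel) + (\<integral>x. lintrace (H\<eta> x) / 2 * (w x)\<^sup>2 \<partial>lborel)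
     = (\<integral>x. P2 x + lintrace (H\<eta> x) / 2 * (w x)\<^sup>2 \<partial>lborel)"
    using i2 ie by simp
  also have "\<dots> = (\<integral>x. ((x \<bullet> x) ^ (k + 2) * (lintrace (H\<xi> x))\<^sup>2 + lintrace (H\<eta> x) / 2) * (w x * w x) \<partial>lborel)"
    unfolding P2_def by (simp only: distrib_right power2_eq_square[of "w _"])
  finally have P2: "(\<integral>x. P2 x \<partial>lborel) + (\<integral>x. lintrace (H\<eta> x) / 2 * (w x)\<^sup>2 \<partial>lborel) = \<dots>" .
  have P1: "(\<integral>x. P1 x \<partial>lborel) = (\<integral>x. ((x \<bullet> x) ^ (k + 2) * (\<xi> x)\<^sup>2) * ((lintrace (H x) + q x * w x) * (lintrace (H x) + q x * w x)) \<partial>lborel)"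
    unfolding P1_def by (simp only: power2_eq_square)
  have lhs: "(\<integral>x. (x \<bullet> x) ^ j * (v x)\<^sup>2 \<partial>lborel) = (\<integral>x. ((x \<bullet> x) ^ j * (\<xi> x)\<^sup>2) * (w x * w x) \<partial>lborel)"
    unfolding v_def by (simp only: power_mult_distrib power2_eq_square[of "w _"] mult.assoc)
  from order_trans[OF step1 mult_left_mono[OF step2 c(1)]]
  show ?thesis unfolding lhs P1[symmetric] P2[symmetric] by (simp add: algebra_simps)
qed

section \<open>The potential term\<close>

lemma lborel_integral_scaleR:
  fixes f :: "'a::euclidean_space \<Rightarrow> real"
  assumes c: "c > 0" and [measurable]: "f \<in> borel_measurable borel"
  shows "(\<integral>x. f x \<partial>lborel) = c ^ DIM('a) * (\<integral>x. f (c *\<^sub>R x) \<partial>lborel)"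
  using c
  by (subst lborel_affine[of c 0])
     (auto simp: integral_density integral_distr)

text \<open>Write \<open>p\<close> for the exponent \<open>DIM('a) + 2 * k\<close> and \<open>h l x = l ^ p * (v (l *\<^sub>R x))\<^sup>2\<close>. The derivative of \<open>h\<close> in \<open>l\<close> at \<open>1\<close>
is \<open>2 * (v x * Z x)\<close>. Substituting \<open>y = l *\<^sub>R x\<close> moves the dilation from \<open>v\<close> to \<open>V\<close>, where the monotonicity along rays
shows that the weighted integral of \<open>h l\<close> does not exceed that of \<open>h 1\<close> for \<open>l\<close> slightly above \<open>1\<close>.\<close>

lemma potential_term_nonpos:
  fixes V :: "'a::euclidean_space \<Rightarrow> real" and k :: nat
  assumes v: "C2_with v g H" and R: "0 < R" "R < R1"
    and v0: "\<And>x. norm x \<le> R1 \<Longrightarrow> v x = 0" and vr: "\<And>x. norm x > r \<Longrightarrow> v x = 0"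
    and Vm[measurable]: "V \<in> borel_measurable borel" and VA: "\<And>x. norm x \<le> r \<Longrightarrow> \<bar>V x\<bar> \<le> A"
    and mono: "\<And>l. l > 1 \<Longrightarrow> AE y in lborel. norm y > R \<longrightarrow> V y \<le> l\<^sup>2 * V (l *\<^sub>R y)"
  shows "(\<integral>x. V x * ((x \<bullet> x) ^ (k + 1) * (v x * (x \<bullet> g x + (real DIM('a) / 2 + real k) * v x))) \<partial>lborel) \<le> 0"
proof (cases "r \<ge> 0")
  case False
  then have "v x = 0" for x using vr[of x] norm_ge_zero[of x] by linarith
  then show ?thesis by simp
next
  case r0: True
  note d = C2_withD[OF v]
  define Z where "Z x = x \<bullet> g x + (real DIM('a) / 2 + real k) * v x" for x
  define p where "p = DIM('a) + 2 * k"
  define h where "h l x = l ^ p * (v (l *\<^sub>R x))\<^sup>2" for l x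
  define h' where "h' l x = real p * l ^ (p - 1) * (v (l *\<^sub>R x))\<^sup>2 + l ^ p * (2 * v (l *\<^sub>R x) * (g (l *\<^sub>R x) \<bullet> x))" for l x
  have vc: "continuous_on UNIV v" by (rule d)
  have vm[measurable]: "v \<in> borel_measurable borel" by (rule borel_measurable_continuous_onI[OF vc])
  have gm[measurable]: "g \<in> borel_measurable borel" by (rule borel_measurable_continuous_onI[OF d(6)])
  have hm[measurable]: "h l \<in> borel_measurable borel" for l unfolding h_def[abs_def] by measurable
  have hd: "((\<lambda>l. h l x) has_real_derivative h' l x) (at l)" for l x
  proof -
    have "((\<lambda>l. v (l *\<^sub>R x)) has_derivative (\<lambda>s. g (l *\<^sub>R x) \<bullet> (s *\<^sub>R x))) (at l)"
      by (rule has_derivative_compose[OF _ d(1)]) (auto intro!: derivative_eq_intros)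
    then have "((\<lambda>l. v (l *\<^sub>R x)) has_real_derivative (g (l *\<^sub>R x) \<bullet> x)) (at l)"
      by (simp add: has_field_derivative_def mult.commute[of _ "g (l *\<^sub>R x) \<bullet> x"])
    then show ?thesis
      unfolding h_def h'_def by (auto intro!: derivative_eq_intros)
  qed
  obtain Bv where Bv: "Bv \<ge> 0" "\<And>x. norm (v x) \<le> Bv"
    using bounded_of_compactly_supported[OF vc vr] by blast
  have "g x = 0" if "norm x > r" for x using C2_with_vanishing[OF v vr that] by simp
  then obtain Bg where Bg: "Bg \<ge> 0" "\<And>x. norm (g x) \<le> Bg"
    using bounded_of_compactly_supported[OF d(6)] by blast
  define B where "B = real p * 2 ^ (p - 1) * Bv\<^sup>2 + 2 ^ p * (2 * Bv * (Bg * r))"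
  have hB: "\<bar>h' l x\<bar> \<le> B" if l: "1 \<le> l" "l \<le> 2" and x: "norm x \<le> r" for l x
  proof -
    have "\<bar>h' l x\<bar> \<le> real p * l ^ (p - 1) * (v (l *\<^sub>R x))\<^sup>2 + l ^ p * (2 * \<bar>v (l *\<^sub>R x)\<bar> * \<bar>g (l *\<^sub>R x) \<bullet> x\<bar>)"
      unfolding h'_def using l by (intro order_trans[OF abs_triangle_ineq]) (simp add: abs_mult)
    also have "\<dots> \<le> B"
      unfolding B_def
    proof (intro add_mono mult_mono)
      show "(v (l *\<^sub>R x))\<^sup>2 \<le> Bv\<^sup>2" using Bv(2)[of "l *\<^sub>R x"] power_mono[of "\<bar>v (l *\<^sub>R x)\<bar>" Bv 2] by simp
      show "\<bar>v (l *\<^sub>R x)\<bar> \<le> Bv" using Bv(2)[of "l *\<^sub>R x"] by simp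
      have "\<bar>g (l *\<^sub>R x) \<bullet> x\<bar> \<le> norm (g (l *\<^sub>R x)) * norm x" by (rule Cauchy_Schwarz_ineq2)
      also have "\<dots> \<le> Bg * r" using Bg x r0 by (intro mult_mono) auto
      finally show "\<bar>g (l *\<^sub>R x) \<bullet> x\<bar> \<le> Bg * r" .
    qed (use l Bv in \<open>auto intro!: power_mono\<close>)
    finally show ?thesis .
  qed
  have hvan: "h l x = 0" if "1 \<le> l" "norm x > r" for l x
  proof -
    have "1 * norm x \<le> l * norm x" using that by (intro mult_right_mono) auto
    then have "norm (l *\<^sub>R x) > r" using that by simp
    then show ?thesis using vr by (simp add: h_def)
  qed
  define t where "t i = 1 / real (Suc i)" for i
  have t: "0 < t i" "t i \<le> 1" for i by (auto simp: t_def)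
  have t0: "t \<longlonglongrightarrow> 0" unfolding t_def by (rule LIMSEQ_Suc[OF lim_1_over_n])
  define W where "W x = V x * (x \<bullet> x) ^ (k + 1)" for x
  have [measurable]: "W \<in> borel_measurable borel" unfolding W_def[abs_def] by measurable
  define D where "D i x = W x * ((h (1 + t i) x - h 1 x) / t i)" for i x
  have A0: "A \<ge> 0" using VA[of 0] r0 by simp
  have WB: "\<bar>W x\<bar> \<le> A * (r\<^sup>2) ^ (k + 1)" if "norm x \<le> r" for x
  proof -
    have "x \<bullet> x \<le> r\<^sup>2" using power_mono[OF that, of 2] by (simp add: power2_norm_eq_inner)
    then have "(x \<bullet> x) ^ (k + 1) \<le> (r\<^sup>2) ^ (k + 1)" by (intro power_mono) auto
    then have "\<bar>V x\<bar> * (x \<bullet> x) ^ (k + 1) \<le> A * (r\<^sup>2) ^ (k + 1)"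
      using VA[OF that] A0 by (intro mult_mono) auto
    then show ?thesis by (simp add: W_def abs_mult)
  qed
  have B0: "B \<ge> 0" using hB[of 1 0] r0 by simp
  have lim: "(\<lambda>i. \<integral>x. D i x \<partial>lborel) \<longlonglongrightarrow> (\<integral>x. W x * (2 * (v x * Z x)) \<partial>lborel)"
  proof (rule integral_dominated_convergence)
    show "integrable lborel (\<lambda>x::'a. indicator (cball 0 r) x *\<^sub>R (A * (r\<^sup>2) ^ (k + 1) * B))"
      by (rule borel_integrable_compact) auto
    show "AE x in lborel. (\<lambda>i. D i x) \<longlonglongrightarrow> W x * (2 * (v x * Z x))"
    proof (rule AE_I2)
      fix x
      have "((\<lambda>s. (h (1 + s) x - h 1 x) / s) \<longlongrightarrow> h' 1 x) (at 0)"
        using hd[of x 1] by (simp add: DERIV_def)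
      then have "(\<lambda>i. (h (1 + t i) x - h 1 x) / t i) \<longlonglongrightarrow> h' 1 x"
        by (rule filterlim_compose) (use t0 t(1) in \<open>auto simp: filterlim_at less_imp_neq[symmetric]\<close>)
      then have "(\<lambda>i. D i x) \<longlonglongrightarrow> W x * h' 1 x" unfolding D_def by (intro tendsto_intros)
      also have "h' 1 x = 2 * (v x * Z x)"
        by (simp add: h'_def Z_def p_def power2_eq_square inner_commute algebra_simps)
      finally show "(\<lambda>i. D i x) \<longlonglongrightarrow> W x * (2 * (v x * Z x))" .
    qed
    show "AE x in lborel. norm (D i x) \<le> indicator (cball 0 r) x *\<^sub>R (A * (r\<^sup>2) ^ (k + 1) * B)" for i
    proof (rule AE_I2)
      fix x
      show "norm (D i x) \<le> indicator (cball 0 r) x *\<^sub>R (A * (r\<^sup>2) ^ (k + 1) * B)"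
      proof (cases "norm x \<le> r")
        case True
        have "1 < 1 + t i" using t by simp
        from MVT2[OF this hd] obtain z where z: "1 < z" "z < 1 + t i" "h (1 + t i) x - h 1 x = (1 + t i - 1) * h' z x"
          by blast
        then have "(h (1 + t i) x - h 1 x) / t i = h' z x" using t(1)[of i] by simp
        then have "\<bar>D i x\<bar> = \<bar>W x\<bar> * \<bar>h' z x\<bar>" by (simp add: D_def abs_mult)
        also have "\<dots> \<le> (A * (r\<^sup>2) ^ (k + 1)) * B"
          using WB[OF True] hB[of z x] z t(2)[of i] True A0 by (intro mult_mono) auto
        finally show ?thesis using True by simp
      next
        case False
        then show ?thesis using hvan[of "1 + t i" x] hvan[of 1 x] t(1)[of i] by (simp add: D_def)
      qed
    qed
  qed (auto simp: D_def[abs_def] Z_def[abs_def])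
  have Whint: "integrable lborel (\<lambda>x. W x * h l x)" if l: "1 \<le> l" "l \<le> 2" for l
  proof (rule Bochner_Integration.integrable_bound)
    show "integrable lborel (\<lambda>x::'a. indicator (cball 0 r) x *\<^sub>R (A * (r\<^sup>2) ^ (k + 1) * (2 ^ p * Bv\<^sup>2)))"
      by (rule borel_integrable_compact) auto
    show "(\<lambda>x. W x * h l x) \<in> borel_measurable lborel" by simp
    show "AE x in lborel. norm (W x * h l x) \<le> norm (indicator (cball 0 r) x *\<^sub>R (A * (r\<^sup>2) ^ (k + 1) * (2 ^ p * Bv\<^sup>2)))"
    proof (rule AE_I2)
      fix x
      show "norm (W x * h l x) \<le> norm (indicator (cball 0 r) x *\<^sub>R (A * (r\<^sup>2) ^ (k + 1) * (2 ^ p * Bv\<^sup>2)))"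
      proof (cases "norm x \<le> r")
        case True
        have "\<bar>h l x\<bar> \<le> 2 ^ p * Bv\<^sup>2"
          unfolding h_def abs_mult using l Bv(2)[of "l *\<^sub>R x"] power_mono[of "\<bar>v (l *\<^sub>R x)\<bar>" Bv 2]
          by (intro mult_mono) (auto intro!: power_mono)
        then have "\<bar>W x\<bar> * \<bar>h l x\<bar> \<le> (A * (r\<^sup>2) ^ (k + 1)) * (2 ^ p * Bv\<^sup>2)"
          using WB[OF True] A0 by (intro mult_mono) auto
        then show ?thesis using True A0 by (simp add: abs_mult)
      next
        case False
        then show ?thesis using hvan[OF l(1)] by simp
      qed
    qed
  qed
  \<comment> \<open>the bound \<open>l * R < R1\<close> keeps \<open>y / l\<close> outside the ball of radius \<open>R\<close> for \<open>y\<close> in the support of \<open>v\<close>\<close>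
  have Jle: "(\<integral>x. W x * h l x \<partial>lborel) \<le> (\<integral>x. W x * h 1 x \<partial>lborel)" if l: "1 < l" "l \<le> 2" "l * R < R1" for l
  proof -
    define f where "f y = W ((1 / l) *\<^sub>R y) * h l ((1 / l) *\<^sub>R y)" for y
    have fm[measurable]: "f \<in> borel_measurable borel" unfolding f_def[abs_def] by measurable
    have fl: "f (l *\<^sub>R x) = W x * h l x" for x using l by (simp add: f_def)
    have fint: "integrable lborel (\<lambda>x. f (l *\<^sub>R x))" unfolding fl using Whint[of l] l by simp
    have eq: "(\<integral>x. f x \<partial>lborel) = l ^ DIM('a) * (\<integral>x. W x * h l x \<partial>lborel)"
      using lborel_integral_scaleR[of l f] l by (simp add: fl)
    have AEl: "AE y in lborel. norm ((1 / l) *\<^sub>R y) > R \<longrightarrow> V ((1 / l) *\<^sub>R y) \<le> l\<^sup>2 * V (l *\<^sub>R ((1 / l) *\<^sub>R y))"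
      by (rule AE_lborel_scaleR[OF mono]) (use l in auto)
    have "AE y in lborel. f y \<le> l ^ DIM('a) * (W y * h 1 y)"
      using AEl
    proof eventually_elim
      case (elim y)
      show ?case
      proof (cases "norm y \<le> R1")
        case True
        then show ?thesis using v0 l by (simp add: f_def h_def)
      next
        case False
        then have "l * R < norm y" using l by linarith
        then have "norm ((1 / l) *\<^sub>R y) > R" using l by (simp add: field_simps)
        then have V: "V ((1 / l) *\<^sub>R y) \<le> l\<^sup>2 * V y" using elim l by simp
        have "f y = V ((1 / l) *\<^sub>R y) * ((y \<bullet> y) ^ (k + 1) * (1 / l) ^ (2 * k + 2) * l ^ p * (v y)\<^sup>2)"
        proof -
          have "((1 / l) *\<^sub>R y) \<bullet> ((1 / l) *\<^sub>R y) = (1 / l)\<^sup>2 * (y \<bullet> y)" by (simp add: power2_eq_square)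
          then have "(((1 / l) *\<^sub>R y) \<bullet> ((1 / l) *\<^sub>R y)) ^ (k + 1) = (1 / l) ^ (2 * (k + 1)) * (y \<bullet> y) ^ (k + 1)"
            by (simp only: power_mult_distrib power_mult)
          then show ?thesis using l by (auto simp: f_def W_def h_def mult_ac)
        qed
        also have "\<dots> \<le> (l\<^sup>2 * V y) * ((y \<bullet> y) ^ (k + 1) * (1 / l) ^ (2 * k + 2) * l ^ p * (v y)\<^sup>2)"
          using V l by (intro mult_right_mono) auto
        also have "\<dots> = (l\<^sup>2 * (1 / l) ^ (2 * k + 2) * l ^ p) * (W y * (v y)\<^sup>2)"
          by (simp add: W_def mult_ac)
        also have "l\<^sup>2 * (1 / l) ^ (2 * k + 2) * l ^ p = l ^ DIM('a)"
          using l by (simp add: p_def power_add power_one_over field_simps power2_eq_square)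
        finally show ?thesis by (simp add: h_def)
      qed
    qed
    moreover have "integrable lborel f"
    proof -
      have "integrable lborel (\<lambda>x. f (0 + l *\<^sub>R x))" using fint by simp
      then show ?thesis
        using l by (subst lborel_affine[of l 0]) (auto simp: integrable_density integrable_distr_eq)
    qed
    moreover have "integrable lborel (\<lambda>y. l ^ DIM('a) * (W y * h 1 y))" using Whint[of 1] by simp
    ultimately have "(\<integral>x. f x \<partial>lborel) \<le> (\<integral>y. l ^ DIM('a) * (W y * h 1 y) \<partial>lborel)"
      by (intro integral_mono_AE)
    then show ?thesis unfolding eq using l by simp
  qed
  have "eventually (\<lambda>i. (1 + t i) * R < R1) sequentially"
  proof (rule order_tendstoD(2))
    show "(\<lambda>i. (1 + t i) * R) \<longlonglongrightarrow> (1 + 0) * R" by (intro tendsto_intros t0)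
  qed (use R in simp)
  then have "eventually (\<lambda>i. (\<integral>x. D i x \<partial>lborel) \<le> 0) sequentially"
  proof eventually_elim
    case (elim i)
    have "(\<integral>x. D i x \<partial>lborel) = (\<integral>x. (1 / t i) * (W x * h (1 + t i) x) - (1 / t i) * (W x * h 1 x) \<partial>lborel)"
      by (simp add: D_def right_diff_distrib diff_divide_distrib)
    also have "\<dots> = (1 / t i) * ((\<integral>x. W x * h (1 + t i) x \<partial>lborel) - (\<integral>x. W x * h 1 x \<partial>lborel))"
      using Whint[of "1 + t i"] Whint[of 1] t[of i] by (simp add: right_diff_distrib)
    also have "\<dots> \<le> 0"
      using Jle[of "1 + t i"] t[of i] elim by (intro mult_nonneg_nonpos) auto
    finally show ?case .
  qed
  from tendsto_upperbound[OF lim this]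
  have "(\<integral>x. W x * (2 * (v x * Z x)) \<partial>lborel) \<le> 0" by simp
  also have "(\<lambda>x. W x * (2 * (v x * Z x))) = (\<lambda>x. 2 * (V x * ((x \<bullet> x) ^ (k + 1) * (v x * Z x))))"
    by (simp add: W_def fun_eq_iff mult_ac)
  finally show ?thesis unfolding Z_def by simp
qed

section \<open>The cut-off inequality for weak solutions\<close>

lemma tendsto_weighted_product_continuous:
  fixes u v a :: "'a::euclidean_space \<Rightarrow> real"
  assumes "L2_loc_borel u" "L2_loc_borel v"
    and "\<And>n. L2_loc_borel (un n)" "\<And>n. L2_loc_borel (vn n)"
    and "\<And>r. (\<lambda>n. \<integral>x. indicator (cball 0 r) x * (un n x - u x)\<^sup>2 \<partial>lborel) \<longlonglongrightarrow> 0"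
    and "\<And>r. (\<lambda>n. \<integral>x. indicator (cball 0 r) x * (vn n x - v x)\<^sup>2 \<partial>lborel) \<longlonglongrightarrow> 0"
    and a: "continuous_on UNIV a" "\<And>x. norm x > r \<Longrightarrow> a x = 0"
  shows "(\<lambda>n. \<integral>x. a x * (un n x * vn n x) \<partial>lborel) \<longlonglongrightarrow> (\<integral>x. a x * (u x * v x) \<partial>lborel)"
proof -
  obtain A where A: "\<And>x. \<bar>a x\<bar> \<le> A"
    using bounded_of_compactly_supported[OF a] by (metis real_norm_def)
  show ?thesis
    by (rule tendsto_weighted_product[OF assms(1-6) borel_measurable_continuous_onI[OF a(1)] A a(2)])
qed

lemma L2_loc_tendsto_linear_combination:
  fixes u f q :: "'a::euclidean_space \<Rightarrow> real"
  assumes u: "L2_loc_borel u" and f: "L2_loc_borel f"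
    and un: "\<And>n. L2_loc_borel (un n)" and fn: "\<And>n. L2_loc_borel (fn n)"
    and ulim: "(\<lambda>n. \<integral>x. indicator (cball 0 r) x * (un n x - u x)\<^sup>2 \<partial>lborel) \<longlonglongrightarrow> 0"
    and flim: "(\<lambda>n. \<integral>x. indicator (cball 0 r) x * (fn n x - f x)\<^sup>2 \<partial>lborel) \<longlonglongrightarrow> 0"
    and q[measurable]: "q \<in> borel_measurable borel" and qb: "\<And>x. norm x \<le> r \<Longrightarrow> \<bar>q x\<bar> \<le> A"
  shows "(\<lambda>n. \<integral>x. indicator (cball 0 r) x * ((fn n x + q x * un n x) - (f x + q x * u x))\<^sup>2 \<partial>lborel) \<longlonglongrightarrow> 0"
proof (rule tendsto_sandwich[of "\<lambda>_. 0"])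
  let ?I = "\<lambda>w. \<integral>x. indicator (cball 0 r) x * (w x)\<^sup>2 \<partial>lborel"
  have "(\<lambda>n. 2 * ?I (\<lambda>x. fn n x - f x) + 2 * A\<^sup>2 * ?I (\<lambda>x. un n x - u x)) \<longlonglongrightarrow> 2 * 0 + 2 * A\<^sup>2 * 0"
    by (intro tendsto_intros ulim flim)
  then show "(\<lambda>n. 2 * ?I (\<lambda>x. fn n x - f x) + 2 * A\<^sup>2 * ?I (\<lambda>x. un n x - u x)) \<longlonglongrightarrow> 0" by simp
  show "eventually (\<lambda>n. 0 \<le> ?I (\<lambda>x. (fn n x + q x * un n x) - (f x + q x * u x))) sequentially"
    by (intro always_eventually allI integral_nonneg_AE AE_I2) auto
  show "eventually (\<lambda>n. ?I (\<lambda>x. (fn n x + q x * un n x) - (f x + q x * u x))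
      \<le> 2 * ?I (\<lambda>x. fn n x - f x) + 2 * A\<^sup>2 * ?I (\<lambda>x. un n x - u x)) sequentially"
  proof (intro always_eventually allI)
    fix n
    have le: "indicator (cball 0 r) x * ((fn n x + q x * un n x) - (f x + q x * u x))\<^sup>2
       \<le> 2 * (indicator (cball 0 r) x * (fn n x - f x)\<^sup>2) + 2 * A\<^sup>2 * (indicator (cball 0 r) x * (un n x - u x)\<^sup>2)" for x
    proof (cases "norm x \<le> r")
      case True
      define a b where "a = fn n x - f x" and "b = q x * (un n x - u x)"
      have "b\<^sup>2 \<le> A\<^sup>2 * (un n x - u x)\<^sup>2"
        unfolding b_def power_mult_distrib using power_mono[OF qb[OF True], of 2] by (intro mult_right_mono) auto
      moreover have "(a + b)\<^sup>2 \<le> 2 * a\<^sup>2 + 2 * b\<^sup>2"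
        using zero_le_power2[of "a - b"] by (simp add: power2_eq_square algebra_simps)
      moreover have "(fn n x + q x * un n x) - (f x + q x * u x) = a + b" by (simp add: a_def b_def algebra_simps)
      ultimately show ?thesis using True by (simp add: a_def[symmetric])
    qed simp
    have int: "integrable lborel (\<lambda>x. 2 * (indicator (cball 0 r) x * (fn n x - f x)\<^sup>2) + 2 * A\<^sup>2 * (indicator (cball 0 r) x * (un n x - u x)\<^sup>2))"
      using L2_loc_borelD(2)[OF L2_loc_borel_diff[OF fn[of n] f], of r] L2_loc_borelD(2)[OF L2_loc_borel_diff[OF un[of n] u], of r]
      by auto
    note [measurable] = L2_loc_borelD(1)[OF u] L2_loc_borelD(1)[OF f] L2_loc_borelD(1)[OF un] L2_loc_borelD(1)[OF fn]
    have m: "(\<lambda>x. indicator (cball 0 r) x * ((fn n x + q x * un n x) - (f x + q x * u x))\<^sup>2) \<in> borel_measurable lborel"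
      by (intro borel_measurable_times borel_measurable_indicator) auto
    have "integrable lborel (\<lambda>x. indicator (cball 0 r) x * ((fn n x + q x * un n x) - (f x + q x * u x))\<^sup>2)"
      by (rule Bochner_Integration.integrable_bound[OF int m])
        (use le in \<open>auto intro!: AE_I2 simp: abs_of_nonneg\<close>)
    then have "?I (\<lambda>x. (fn n x + q x * un n x) - (f x + q x * u x))
      \<le> (\<integral>x. 2 * (indicator (cball 0 r) x * (fn n x - f x)\<^sup>2) + 2 * A\<^sup>2 * (indicator (cball 0 r) x * (un n x - u x)\<^sup>2) \<partial>lborel)"
      by (rule integral_mono[OF _ int le])
    also have "\<dots> = 2 * ?I (\<lambda>x. fn n x - f x) + 2 * A\<^sup>2 * ?I (\<lambda>x. un n x - u x)"
      using L2_loc_borelD(2)[OF L2_loc_borel_diff[OF fn[of n] f], of r] L2_loc_borelD(2)[OF L2_loc_borel_diff[OF un[of n] u], of r]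
      by simp
    finally show "?I (\<lambda>x. (fn n x + q x * un n x) - (f x + q x * u x))
      \<le> 2 * ?I (\<lambda>x. fn n x - f x) + 2 * A\<^sup>2 * ?I (\<lambda>x. un n x - u x)" .
  qed
qed simp

lemma L2_loc_borel_add_mult:
  assumes "L2_loc_borel f" "L2_loc_borel u" "q \<in> borel_measurable borel" "\<And>r. \<exists>A. \<forall>x. norm x \<le> r \<longrightarrow> \<bar>q x\<bar> \<le> A"
  shows "L2_loc_borel (\<lambda>x. f x + q x * u x)"
proof -
  have "L2_loc_borel (\<lambda>x. (- q x) * u x)"
    by (rule L2_loc_borel_mult_bounded) (use assms in auto)
  from L2_loc_borel_diff[OF assms(1) this] show ?thesis by simp
qed

text \<open>Every term of the inequality for functions of class $C^2$ is an integral of a product of two of \<open>u\<close>, \<open>f\<close> and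
\<open>q * u\<close> against a bounded weight with compact support; no gradient is left. So the inequality passes to the limit of the
mollifications.\<close>

lemma weak_cutoff_inequality:
  fixes u f q \<xi> \<eta> :: "real ^ 'n \<Rightarrow> real" and k j :: nat
  assumes u: "L2_loc_borel u" and f: "L2_loc_borel f"
    and weak: "\<And>\<phi>. test_function \<phi> \<Longrightarrow> (\<integral>x. u x * laplacian \<phi> x \<partial>lborel) = (\<integral>x. f x * \<phi> x \<partial>lborel)"
    and xi: "C2_with \<xi> g\<xi> H\<xi>" and eta: "C2_with \<eta> g\<eta> H\<eta>"
    and supp: "\<And>x. norm x > r \<Longrightarrow> \<xi> x = 0" "\<And>x. norm x > r \<Longrightarrow> \<eta> x = 0"
    and grad: "\<And>x. (x \<bullet> x) ^ (k + 2) * (4 * (g\<xi> x \<bullet> g\<xi> x)) \<le> \<eta> x"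
    and j: "j = k + 1 \<or> k = j + 1"
    and c: "c \<ge> 0" "\<And>x. \<xi> x \<noteq> 0 \<or> g\<xi> x \<noteq> 0 \<Longrightarrow> (x \<bullet> x) ^ j \<le> c * (x \<bullet> x) ^ k"
    and q: "q \<in> borel_measurable borel" and qb: "\<And>r. \<exists>A. \<forall>x. norm x \<le> r \<longrightarrow> \<bar>q x\<bar> \<le> A"
    and pot: "\<And>v g H. C2_with v g H \<Longrightarrow> (\<And>x. \<xi> x = 0 \<Longrightarrow> v x = 0) \<Longrightarrow>
        (\<integral>x. q x * ((x \<bullet> x) ^ (k + 1) * (v x * (x \<bullet> g x + (real DIM(real ^ 'n) / 2 + real k) * v x))) \<partial>lborel) \<le> 0"
  shows "(2 * real k + 2)\<^sup>2 * (\<integral>x. ((x \<bullet> x) ^ j * (\<xi> x)\<^sup>2) * (u x * u x) \<partial>lborel)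
    \<le> 3 * c * ((\<integral>x. ((x \<bullet> x) ^ (k + 2) * (\<xi> x)\<^sup>2) * ((f x + q x * u x) * (f x + q x * u x)) \<partial>lborel)
       + (\<integral>x. ((x \<bullet> x) ^ (k + 2) * (lintrace (H\<xi> x))\<^sup>2 + lintrace (H\<eta> x) / 2) * (u x * u x) \<partial>lborel)
       - (\<integral>x. \<eta> x * (u x * f x) \<partial>lborel))"
proof -
  define un fn where "un n = conv u (mollifier n)" and "fn n = conv f (mollifier n)" for n
  obtain A where A: "\<And>x. norm x \<le> r \<Longrightarrow> \<bar>q x\<bar> \<le> A" using qb by blast
  have un: "L2_loc_borel (un n)" and fn: "L2_loc_borel (fn n)" for n
    unfolding un_def fn_def by (intro L2_loc_borel_mollified u f)+
  have ulim: "(\<lambda>n. \<integral>x. indicator (cball 0 r) x * (un n x - u x)\<^sup>2 \<partial>lborel) \<longlonglongrightarrow> 0" for r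
    unfolding un_def by (rule mollified_tendsto_L2_loc[OF u])
  have flim: "(\<lambda>n. \<integral>x. indicator (cball 0 r) x * (fn n x - f x)\<^sup>2 \<partial>lborel) \<longlonglongrightarrow> 0" for r
    unfolding fn_def by (rule mollified_tendsto_L2_loc[OF f])
  have fq: "L2_loc_borel (\<lambda>x. f x + q x * u x)" and fqn: "L2_loc_borel (\<lambda>x. fn n x + q x * un n x)" for n
    by (intro L2_loc_borel_add_mult f u fn un q qb)+
  have fqlim: "(\<lambda>n. \<integral>x. indicator (cball 0 r') x * ((fn n x + q x * un n x) - (f x + q x * u x))\<^sup>2 \<partial>lborel) \<longlonglongrightarrow> 0" for r'
  proof -
    obtain A where "\<And>x. norm x \<le> r' \<Longrightarrow> \<bar>q x\<bar> \<le> A" using qb by blast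
    then show ?thesis by (rule L2_loc_tendsto_linear_combination[OF u f un fn ulim flim q])
  qed
  note dx = C2_withD[OF xi] and de = C2_withD[OF eta]
  have zx: "\<xi> x = 0" "lintrace (H\<xi> x) = 0" if "norm x > r" for x
    using C2_with_vanishing[OF xi supp(1) that] by auto
  have ze: "\<eta> x = 0" "lintrace (H\<eta> x) = 0" if "norm x > r" for x
    using C2_with_vanishing[OF eta supp(2) that] by auto
  show ?thesis
  proof (rule LIMSEQ_le)
    show "(\<lambda>n. (2 * real k + 2)\<^sup>2 * (\<integral>x. ((x \<bullet> x) ^ j * (\<xi> x)\<^sup>2) * (un n x * un n x) \<partial>lborel))
      \<longlonglongrightarrow> (2 * real k + 2)\<^sup>2 * (\<integral>x. ((x \<bullet> x) ^ j * (\<xi> x)\<^sup>2) * (u x * u x) \<partial>lborel)"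
      by (intro tendsto_intros tendsto_weighted_product_continuous[OF u u un un ulim ulim, of _ r] continuous_intros dx)
         (use zx in auto)
    show "(\<lambda>n. 3 * c * ((\<integral>x. ((x \<bullet> x) ^ (k + 2) * (\<xi> x)\<^sup>2) * ((fn n x + q x * un n x) * (fn n x + q x * un n x)) \<partial>lborel)
       + (\<integral>x. ((x \<bullet> x) ^ (k + 2) * (lintrace (H\<xi> x))\<^sup>2 + lintrace (H\<eta> x) / 2) * (un n x * un n x) \<partial>lborel)
       - (\<integral>x. \<eta> x * (un n x * fn n x) \<partial>lborel)))
     \<longlonglongrightarrow> 3 * c * ((\<integral>x. ((x \<bullet> x) ^ (k + 2) * (\<xi> x)\<^sup>2) * ((f x + q x * u x) * (f x + q x * u x)) \<partial>lborel)
       + (\<integral>x. ((x \<bullet> x) ^ (k + 2) * (lintrace (H\<xi> x))\<^sup>2 + lintrace (H\<eta> x) / 2) * (u x * u x) \<partial>lborel)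
       - (\<integral>x. \<eta> x * (u x * f x) \<partial>lborel))"
    proof (intro tendsto_mult tendsto_add tendsto_diff tendsto_const)
      show "(\<lambda>n. \<integral>x. ((x \<bullet> x) ^ (k + 2) * (\<xi> x)\<^sup>2) * ((fn n x + q x * un n x) * (fn n x + q x * un n x)) \<partial>lborel)
        \<longlonglongrightarrow> (\<integral>x. ((x \<bullet> x) ^ (k + 2) * (\<xi> x)\<^sup>2) * ((f x + q x * u x) * (f x + q x * u x)) \<partial>lborel)"
        by (rule tendsto_weighted_product_continuous[OF fq fq fqn fqn fqlim fqlim, of _ r])
           (use zx in \<open>auto intro!: continuous_intros dx\<close>)
      show "(\<lambda>n. \<integral>x. ((x \<bullet> x) ^ (k + 2) * (lintrace (H\<xi> x))\<^sup>2 + lintrace (H\<eta> x) / 2) * (un n x * un n x) \<partial>lborel)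
        \<longlonglongrightarrow> (\<integral>x. ((x \<bullet> x) ^ (k + 2) * (lintrace (H\<xi> x))\<^sup>2 + lintrace (H\<eta> x) / 2) * (u x * u x) \<partial>lborel)"
        by (rule tendsto_weighted_product_continuous[OF u u un un ulim ulim, of _ r])
           (use zx ze in \<open>auto intro!: continuous_intros dx de\<close>)
      show "(\<lambda>n. \<integral>x. \<eta> x * (un n x * fn n x) \<partial>lborel) \<longlonglongrightarrow> (\<integral>x. \<eta> x * (u x * f x) \<partial>lborel)"
        by (rule tendsto_weighted_product_continuous[OF u f un fn ulim flim de(5) supp(2)])
    qed
    show "\<exists>N. \<forall>n\<ge>N. (2 * real k + 2)\<^sup>2 * (\<integral>x. ((x \<bullet> x) ^ j * (\<xi> x)\<^sup>2) * (un n x * un n x) \<partial>lborel)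
      \<le> 3 * c * ((\<integral>x. ((x \<bullet> x) ^ (k + 2) * (\<xi> x)\<^sup>2) * ((fn n x + q x * un n x) * (fn n x + q x * un n x)) \<partial>lborel)
       + (\<integral>x. ((x \<bullet> x) ^ (k + 2) * (lintrace (H\<xi> x))\<^sup>2 + lintrace (H\<eta> x) / 2) * (un n x * un n x) \<partial>lborel)
       - (\<integral>x. \<eta> x * (un n x * fn n x) \<partial>lborel))"
    proof (intro exI[of _ 0] allI impI)
      fix n
      obtain g H where gH: "C2_with (un n) g H" "\<And>x. lintrace (H x) = fn n x"
        unfolding un_def fn_def using C2_with_mollified[OF L2_loc_borel_loc_integrable[OF u] weak] by metis
      show "(2 * real k + 2)\<^sup>2 * (\<integral>x. ((x \<bullet> x) ^ j * (\<xi> x)\<^sup>2) * (un n x * un n x) \<partial>lborel)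
      \<le> 3 * c * ((\<integral>x. ((x \<bullet> x) ^ (k + 2) * (\<xi> x)\<^sup>2) * ((fn n x + q x * un n x) * (fn n x + q x * un n x)) \<partial>lborel)
       + (\<integral>x. ((x \<bullet> x) ^ (k + 2) * (lintrace (H\<xi> x))\<^sup>2 + lintrace (H\<eta> x) / 2) * (un n x * un n x) \<partial>lborel)
       - (\<integral>x. \<eta> x * (un n x * fn n x) \<partial>lborel))"
        using weighted_cutoff_inequality[OF gH(1) xi eta supp grad j c q A pot]
        unfolding gH(2) by simp
    qed
  qed
qed

lemma C2_with_radial:
  fixes p p' p'' :: "real \<Rightarrow> real"
  assumes 1: "\<And>t. (p has_real_derivative p' t) (at t)" and 2: "\<And>t. (p' has_real_derivative p'' t) (at t)"
    and 3: "continuous_on UNIV p''"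
  shows "C2_with (\<lambda>x::'a::euclidean_space. p (x \<bullet> x)) (\<lambda>x. (2 * p' (x \<bullet> x)) *\<^sub>R x)
     (\<lambda>x h. (2 * p' (x \<bullet> x)) *\<^sub>R h + (2 * (p'' (x \<bullet> x) * (2 * (x \<bullet> h)))) *\<^sub>R x)"
  unfolding C2_with_def
proof (intro conjI allI)
  have s: "((\<lambda>x. x \<bullet> x) has_derivative (\<lambda>h. 2 * (x \<bullet> h))) (at x)" for x :: 'a
    by (auto intro!: derivative_eq_intros simp: inner_commute)
  have d1: "((\<lambda>x. p (x \<bullet> x)) has_derivative (\<lambda>h. p' (x \<bullet> x) * (2 * (x \<bullet> h)))) (at x)" for x :: 'a
    using has_derivative_compose[OF s 1[unfolded has_field_derivative_def]] .
  have d2: "((\<lambda>x. p' (x \<bullet> x)) has_derivative (\<lambda>h. p'' (x \<bullet> x) * (2 * (x \<bullet> h)))) (at x)" for x :: 'a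
    using has_derivative_compose[OF s 2[unfolded has_field_derivative_def]] .
  show "((\<lambda>x. p (x \<bullet> x)) has_derivative (\<bullet>) ((2 * p' (x \<bullet> x)) *\<^sub>R x)) (at x)" for x :: 'a
  proof -
    have "(\<bullet>) ((2 * p' (x \<bullet> x)) *\<^sub>R x) = (\<lambda>h. p' (x \<bullet> x) * (2 * (x \<bullet> h)))" by (simp add: fun_eq_iff)
    then show ?thesis using d1[of x] by simp
  qed
  show "((\<lambda>x. (2 * p' (x \<bullet> x)) *\<^sub>R x) has_derivative
      (\<lambda>h. (2 * p' (x \<bullet> x)) *\<^sub>R h + (2 * (p'' (x \<bullet> x) * (2 * (x \<bullet> h)))) *\<^sub>R x)) (at x)" for x :: 'a
    by (intro has_derivative_scaleR has_derivative_mult_right d2 has_derivative_ident)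
  show "((2 * p' (x \<bullet> x)) *\<^sub>R a + (2 * (p'' (x \<bullet> x) * (2 * (x \<bullet> a)))) *\<^sub>R x) \<bullet> b
     = a \<bullet> ((2 * p' (x \<bullet> x)) *\<^sub>R b + (2 * (p'' (x \<bullet> x) * (2 * (x \<bullet> b)))) *\<^sub>R x)" for x a b :: 'a
    by (simp add: inner_add_left inner_add_right inner_commute mult_ac)
  have "continuous_on UNIV p'" using 2 by (meson DERIV_isCont continuous_at_imp_continuous_on)
  moreover have "continuous_on UNIV (\<lambda>x::'a. f (x \<bullet> x))" if "continuous_on UNIV f" for f :: "real \<Rightarrow> real"
    by (rule continuous_on_compose2[OF that _ subset_UNIV]) (intro continuous_intros)
  ultimately have "continuous_on UNIV (\<lambda>x::'a. p' (x \<bullet> x))" "continuous_on UNIV (\<lambda>x::'a. p'' (x \<bullet> x))"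
    using 3 by blast+
  then show "continuous_on UNIV (\<lambda>x. (2 * p' (x \<bullet> x)) *\<^sub>R b + (2 * (p'' (x \<bullet> x) * (2 * (x \<bullet> b)))) *\<^sub>R x)" for b :: 'a
    by (intro continuous_intros)
qed

lemma lintrace_radial:
  fixes x :: "'a::euclidean_space" and a b :: real
  shows "lintrace (\<lambda>h. (2 * a) *\<^sub>R h + (2 * (b * (2 * (x \<bullet> h)))) *\<^sub>R x) = 2 * DIM('a) * a + 4 * b * (x \<bullet> x)"
proof -
  have "linear (\<lambda>h. 2 * (b * (2 * (x \<bullet> h))))"
    by (auto intro!: linearI simp: inner_add_right algebra_simps)
  then show ?thesis by (simp add: lintrace_add lintrace_scaleR lintrace_id lintrace_rank_one)
qed

text \<open>An algebra of functions that is closed under differentiation; the reciprocal makes the usual smooth step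
$e^{-1/t} / (e^{-1/t} + e^{-1/(1-t)})$ a member.\<close>

inductive profile :: "(real \<Rightarrow> real) \<Rightarrow> bool" where
  kappa: "profile (kappa k)"
| reflected: "profile (\<lambda>t. kappa k (1 - t))"
| scale: "profile p \<Longrightarrow> profile (\<lambda>t. c * p t)"
| add: "profile p \<Longrightarrow> profile p' \<Longrightarrow> profile (\<lambda>t. p t + p' t)"
| mult: "profile p \<Longrightarrow> profile p' \<Longrightarrow> profile (\<lambda>t. p t * p' t)"
| recip: "profile (\<lambda>t. inverse (kappa 0 t + kappa 0 (1 - t)))"

lemma kappa_sum_pos: "kappa 0 t + kappa 0 (1 - t) > 0"
  by (auto simp: kappa_def add_pos_pos)

lemma profile_has_derivative:
  assumes "profile p"
  shows "\<exists>p'. profile p' \<and> (\<forall>t. (p has_real_derivative p' t) (at t))"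
  using assms
proof induction
  case (kappa k)
  have "profile (\<lambda>t. kappa (k + 2) t + (- real k) * kappa (k + 1) t)" by (intro profile.intros)
  then show ?case using has_derivative_kappa[of k] by (intro exI[of _ "\<lambda>t. kappa (k + 2) t + (- real k) * kappa (k + 1) t"]) simp
next
  case (reflected k)
  have "profile (\<lambda>t. (- 1) * (kappa (k + 2) (1 - t) + (- real k) * kappa (k + 1) (1 - t)))" by (intro profile.intros)
  moreover have "((\<lambda>t. kappa k (1 - t)) has_real_derivative (- 1) * (kappa (k + 2) (1 - t) + (- real k) * kappa (k + 1) (1 - t))) (at t)" for t
  proof -
    have "((\<lambda>t. kappa k (1 - t)) has_real_derivative (kappa (k + 2) (1 - t) - real k * kappa (k + 1) (1 - t)) * (- 1)) (at t)"
      by (rule DERIV_chain2[OF has_derivative_kappa]) (auto intro!: derivative_eq_intros)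
    then show ?thesis by simp
  qed
  ultimately show ?case by blast
next
  case (scale p c)
  then obtain p' where "profile p'" "\<And>t. (p has_real_derivative p' t) (at t)" by blast
  then show ?case by (intro exI[of _ "\<lambda>t. c * p' t"]) (auto intro: profile.intros DERIV_cmult)
next
  case (add p q)
  then obtain p' q' where "profile p'" "\<And>t. (p has_real_derivative p' t) (at t)"
    "profile q'" "\<And>t. (q has_real_derivative q' t) (at t)" by blast
  then show ?case by (intro exI[of _ "\<lambda>t. p' t + q' t"]) (auto intro: profile.intros DERIV_add)
next
  case (mult p q)
  then obtain p' q' where "profile p'" "\<And>t. (p has_real_derivative p' t) (at t)"
    "profile q'" "\<And>t. (q has_real_derivative q' t) (at t)" by blast
  with mult.hyps show ?case
    by (intro exI[of _ "\<lambda>t. p' t * q t + q' t * p t"]) (auto intro!: profile.intros DERIV_mult)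
next
  case recip
  let ?D = "\<lambda>t. kappa 0 t + kappa 0 (1 - t)"
  let ?D' = "\<lambda>t. kappa 2 t + (- 1) * kappa 2 (1 - t)"
  have "profile (\<lambda>t. (- 1) * (?D' t * (inverse (?D t) * inverse (?D t))))" by (intro profile.intros)
  moreover have "((\<lambda>t. inverse (?D t)) has_real_derivative (- 1) * (?D' t * (inverse (?D t) * inverse (?D t)))) (at t)" for t
  proof -
    have 1: "(kappa 0 has_real_derivative kappa 2 t) (at t)" for t
      using has_derivative_kappa[of 0 t] by (simp add: numeral_2_eq_2)
    have "((\<lambda>t. kappa 0 (1 - t)) has_real_derivative kappa 2 (1 - t) * (- 1)) (at t)"
      by (rule DERIV_chain2[OF 1]) (auto intro!: derivative_eq_intros)
    from DERIV_add[OF 1[of t] this] have "(?D has_real_derivative ?D' t) (at t)"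
      by simp
    from DERIV_inverse_fun[OF this] show ?thesis
      using kappa_sum_pos[of t] by (simp add: power2_eq_square mult_ac)
  qed
  ultimately show ?case by blast
qed

lemma step_profile:
  obtains p p1 p2 p3 :: "real \<Rightarrow> real" and B where
    "\<And>t. (p has_real_derivative p1 t) (at t)" "\<And>t. (p1 has_real_derivative p2 t) (at t)"
    "\<And>t. (p2 has_real_derivative p3 t) (at t)" "continuous_on UNIV p3"
    "\<And>t. t \<le> 0 \<Longrightarrow> p t = 0" "\<And>t. t \<ge> 1 \<Longrightarrow> p t = 1" "\<And>t. 0 \<le> p t" "\<And>t. p t \<le> 1"
    "\<And>t. t \<le> 0 \<or> t \<ge> 1 \<Longrightarrow> p1 t = 0 \<and> p2 t = 0 \<and> p3 t = 0"
    "B \<ge> 0" "\<And>t. \<bar>p1 t\<bar> \<le> B" "\<And>t. \<bar>p2 t\<bar> \<le> B" "\<And>t. \<bar>p3 t\<bar> \<le> B"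
proof -
  define p where "p t = kappa 0 t * inverse (kappa 0 t + kappa 0 (1 - t))" for t
  have "profile p" unfolding p_def[abs_def] by (intro profile.intros)
  then obtain p1 where p1: "profile p1" "\<And>t. (p has_real_derivative p1 t) (at t)" using profile_has_derivative by blast
  obtain p2 where p2: "profile p2" "\<And>t. (p1 has_real_derivative p2 t) (at t)" using profile_has_derivative[OF p1(1)] by blast
  obtain p3 where p3: "profile p3" "\<And>t. (p2 has_real_derivative p3 t) (at t)" using profile_has_derivative[OF p2(1)] by blast
  obtain p4 where p4: "\<And>t. (p3 has_real_derivative p4 t) (at t)" using profile_has_derivative[OF p3(1)] by blast
  have cont: "continuous_on UNIV q" if "\<And>t. (q has_real_derivative q' t) (at t)" for q q' :: "real \<Rightarrow> real"
    using that by (meson DERIV_isCont continuous_at_imp_continuous_on)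
  have z0: "p t = 0" if "t \<le> 0" for t using that by (simp add: p_def kappa_def)
  have z1: "p t = 1" if "t \<ge> 1" for t using that kappa_sum_pos[of t] by (simp add: p_def kappa_def)
  \<comment> \<open>a derivative of a function that is constant on an open half line vanishes on its closure\<close>
  have van: "q' t = 0" if d: "\<And>t. (q has_real_derivative q' t) (at t)" and c: "continuous_on UNIV q'"
    and l: "\<And>t. t < 0 \<Longrightarrow> q t = a" and r: "\<And>t. t > 1 \<Longrightarrow> q t = b" and t: "t \<le> 0 \<or> t \<ge> 1"
    for q q' :: "real \<Rightarrow> real" and t a b
  proof -
    have l': "q' t = 0" if "t < 0" for t
    proof -
      have "(q has_real_derivative 0) (at t)"
        by (rule has_field_derivative_transform_within_open[OF DERIV_const, of "{..<0}"]) (use that l in auto)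
      then show ?thesis using d DERIV_unique by blast
    qed
    have r': "q' t = 0" if "t > 1" for t
    proof -
      have "(q has_real_derivative 0) (at t)"
        by (rule has_field_derivative_transform_within_open[OF DERIV_const, of "{1<..}"]) (use that r in auto)
      then show ?thesis using d DERIV_unique by blast
    qed
    have lim: "(q' \<longlongrightarrow> q' s) (at s)" for s
      using c by (simp add: continuous_on_eq_continuous_at isCont_def)
    have "(q' \<longlongrightarrow> 0) (at_left 0)"
      by (rule tendsto_eventually) (auto simp: eventually_at_filter l')
    then have "q' 0 = 0" using tendsto_unique[OF trivial_limit_at_left_real filterlim_at_split[THEN iffD1, OF lim, THEN conjunct1]] by blast
    moreover have "(q' \<longlongrightarrow> 0) (at_right 1)"
      by (rule tendsto_eventually) (auto simp: eventually_at_filter r')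
    then have "q' 1 = 0" using tendsto_unique[OF trivial_limit_at_right_real filterlim_at_split[THEN iffD1, OF lim, THEN conjunct2]] by blast
    ultimately show ?thesis using t l'[of t] r'[of t] by fastforce
  qed
  have v1: "p1 t = 0" if "t \<le> 0 \<or> t \<ge> 1" for t
    by (rule van[OF p1(2) cont[OF p2(2)], of 0 1, OF _ _ that]) (auto simp: z0 z1)
  have v2: "p2 t = 0" if "t \<le> 0 \<or> t \<ge> 1" for t
    by (rule van[OF p2(2) cont[OF p3(2)], of 0 0, OF _ _ that]) (auto simp: v1)
  have v3: "p3 t = 0" if "t \<le> 0 \<or> t \<ge> 1" for t
    by (rule van[OF p3(2) cont[OF p4], of 0 0, OF _ _ that]) (auto simp: v2)
  have bd: "\<exists>B\<ge>0. \<forall>t. norm (q t) \<le> B" if "continuous_on UNIV q" "\<And>t. t \<le> 0 \<or> t \<ge> 1 \<Longrightarrow> q t = 0" for q :: "real \<Rightarrow> real"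
  proof -
    have "q t = 0" if t: "norm t > 1" for t
    proof -
      have "t \<le> 0 \<or> t \<ge> 1" using t by (auto simp: abs_if split: if_splits)
      then show ?thesis by (rule \<open>\<And>t. t \<le> 0 \<or> t \<ge> 1 \<Longrightarrow> q t = 0\<close>)
    qed
    from bounded_of_compactly_supported[OF that(1) this] show ?thesis by metis
  qed
  obtain B1 where B1: "B1 \<ge> 0" "\<And>t. \<bar>p1 t\<bar> \<le> B1" using bd[OF cont[OF p2(2)] v1] by auto
  obtain B2 where B2: "B2 \<ge> 0" "\<And>t. \<bar>p2 t\<bar> \<le> B2" using bd[OF cont[OF p3(2)] v2] by auto
  obtain B3 where B3: "B3 \<ge> 0" "\<And>t. \<bar>p3 t\<bar> \<le> B3" using bd[OF cont[OF p4] v3] by auto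
  have le1: "p t \<le> 1" for t
    using kappa_sum_pos[of t] by (simp add: p_def field_simps kappa_def)
  have ge0: "0 \<le> p t" for t
    using kappa_sum_pos[of t] by (simp add: p_def kappa_def)
  have b: "\<bar>p1 t\<bar> \<le> B1 + B2 + B3" "\<bar>p2 t\<bar> \<le> B1 + B2 + B3" "\<bar>p3 t\<bar> \<le> B1 + B2 + B3" for t
    using B1(1) B1(2)[of t] B2(1) B2(2)[of t] B3(1) B3(2)[of t] by linarith+
  show ?thesis
    by (rule that[of p p1 p2 p3 "B1 + B2 + B3", OF p1(2) p2(2) p3(2) cont[OF p4] z0 z1 ge0 le1 _ _ b])
      (use v1 v2 v3 B1 B2 B3 in auto)
qed

section \<open>Radial cut-offs on annuli\<close>

text \<open>On each transition zone the error has this form, where \<open>x\<close>, \<open>y\<close>, \<open>z\<close> are the first three derivatives of the step.\<close>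

lemma cutoff_term_bound:
  fixes x y z s w L B \<beta> n :: real
  assumes b: "\<bar>x\<bar> \<le> B" "\<bar>y\<bar> \<le> B" "\<bar>z\<bar> \<le> B" and s: "0 \<le> s" "s \<le> L" "1 \<le> L"
    and w: "0 \<le> w" "w \<le> \<beta>" and n: "0 \<le> n"
  shows "\<bar>w * (2 * n * x + 4 * s * y)\<^sup>2 + n * (16 * \<beta> * x\<^sup>2 + 32 * s * (\<beta> * (x * y)))
      + 2 * s * (64 * (\<beta> * (x * y)) + 32 * s * (\<beta> * (y\<^sup>2 + x * z)))\<bar>
    \<le> \<beta> * L\<^sup>2 * (((2 * n + 4) * B)\<^sup>2 + 48 * n * B\<^sup>2 + 256 * B\<^sup>2)"
proof -
  have B: "B \<ge> 0" using b by linarith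
  have \<beta>: "\<beta> \<ge> 0" using w by linarith
  have LL: "1 \<le> L\<^sup>2" "L \<le> L\<^sup>2" using s power_increasing[of 0 2 L] power_increasing[of 1 2 L] by auto
  have xy: "\<bar>x * y\<bar> \<le> B\<^sup>2" "\<bar>x * z\<bar> \<le> B\<^sup>2"
    unfolding abs_mult power2_eq_square using b B by (auto intro!: mult_mono)
  have xx: "x\<^sup>2 \<le> B\<^sup>2" "y\<^sup>2 \<le> B\<^sup>2"
    using power_mono[of "\<bar>x\<bar>" B 2] power_mono[of "\<bar>y\<bar>" B 2] b by auto
  have "\<bar>2 * n * x + 4 * s * y\<bar> \<le> 2 * n * \<bar>x\<bar> + 4 * s * \<bar>y\<bar>"
    using n s by (intro order_trans[OF abs_triangle_ineq]) (simp add: abs_mult)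
  also have "\<dots> \<le> 2 * n * (L * B) + 4 * L * B"
    using b n s B mult_right_mono[of 1 L B] by (intro add_mono mult_mono) auto
  also have "\<dots> = L * ((2 * n + 4) * B)" by (simp add: algebra_simps)
  finally have "(2 * n * x + 4 * s * y)\<^sup>2 \<le> (L * ((2 * n + 4) * B))\<^sup>2"
    using power_mono[of "\<bar>2 * n * x + 4 * s * y\<bar>" _ 2] by simp
  then have 1: "\<bar>w * (2 * n * x + 4 * s * y)\<^sup>2\<bar> \<le> \<beta> * (L\<^sup>2 * ((2 * n + 4) * B)\<^sup>2)"
    using w by (simp add: abs_mult power_mult_distrib mult_mono)
  have 2: "\<bar>n * (16 * \<beta> * x\<^sup>2 + 32 * s * (\<beta> * (x * y)))\<bar> \<le> \<beta> * (L\<^sup>2 * (48 * n * B\<^sup>2))"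
  proof -
    have "\<bar>16 * x\<^sup>2 + 32 * s * (x * y)\<bar> \<le> 16 * x\<^sup>2 + 32 * (s * \<bar>x * y\<bar>)"
      using s by (intro order_trans[OF abs_triangle_ineq]) (simp add: abs_mult)
    also have "\<dots> \<le> 16 * (L\<^sup>2 * B\<^sup>2) + 32 * (L\<^sup>2 * B\<^sup>2)"
      using xx xy s LL mult_right_mono[OF LL(1), of "B\<^sup>2"] by (intro add_mono mult_left_mono mult_mono) auto
    also have "\<dots> = 48 * (L\<^sup>2 * B\<^sup>2)" by simp
    finally have "n * \<beta> * \<bar>16 * x\<^sup>2 + 32 * s * (x * y)\<bar> \<le> n * \<beta> * (48 * (L\<^sup>2 * B\<^sup>2))"
      using n \<beta> by (intro mult_left_mono) auto
    moreover have eq: "n * (16 * \<beta> * x\<^sup>2 + 32 * s * (\<beta> * (x * y))) = n * \<beta> * (16 * x\<^sup>2 + 32 * s * (x * y))"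
      by (simp add: algebra_simps)
    ultimately show ?thesis unfolding eq using n \<beta> by (simp add: abs_mult mult_ac)
  qed
  have 3: "\<bar>2 * s * (64 * (\<beta> * (x * y)) + 32 * s * (\<beta> * (y\<^sup>2 + x * z)))\<bar> \<le> \<beta> * (L\<^sup>2 * (256 * B\<^sup>2))"
  proof -
    have a: "s * \<bar>x * y\<bar> \<le> L\<^sup>2 * B\<^sup>2" using xy s LL by (intro mult_mono) auto
    have "\<bar>y\<^sup>2 + x * z\<bar> \<le> 2 * B\<^sup>2" using xx xy zero_le_power2[of y] unfolding abs_le_iff by linarith
    moreover have "s * s \<le> L\<^sup>2" unfolding power2_eq_square using s by (intro mult_mono) auto
    ultimately have c: "(s * s) * \<bar>y\<^sup>2 + x * z\<bar> \<le> L\<^sup>2 * (2 * B\<^sup>2)" using s by (intro mult_mono) auto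
    have "\<bar>128 * (s * (x * y)) + 64 * ((s * s) * (y\<^sup>2 + x * z))\<bar> \<le> 128 * (s * \<bar>x * y\<bar>) + 64 * ((s * s) * \<bar>y\<^sup>2 + x * z\<bar>)"
      using s by (intro order_trans[OF abs_triangle_ineq]) (simp add: abs_mult)
    also have "\<dots> \<le> 256 * (L\<^sup>2 * B\<^sup>2)" using a c by simp
    finally have "\<beta> * \<bar>128 * (s * (x * y)) + 64 * ((s * s) * (y\<^sup>2 + x * z))\<bar> \<le> \<beta> * (256 * (L\<^sup>2 * B\<^sup>2))"
      using \<beta> by (intro mult_left_mono)
    moreover have "2 * s * (64 * (\<beta> * (x * y)) + 32 * s * (\<beta> * (y\<^sup>2 + x * z))) = \<beta> * (128 * (s * (x * y)) + 64 * ((s * s) * (y\<^sup>2 + x * z)))"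
      by (simp add: algebra_simps)
    ultimately show ?thesis using \<beta> by (simp add: abs_mult mult_ac)
  qed
  have "\<bar>w * (2 * n * x + 4 * s * y)\<^sup>2 + n * (16 * \<beta> * x\<^sup>2 + 32 * s * (\<beta> * (x * y)))
      + 2 * s * (64 * (\<beta> * (x * y)) + 32 * s * (\<beta> * (y\<^sup>2 + x * z)))\<bar>
    \<le> \<beta> * (L\<^sup>2 * ((2 * n + 4) * B)\<^sup>2) + \<beta> * (L\<^sup>2 * (48 * n * B\<^sup>2)) + \<beta> * (L\<^sup>2 * (256 * B\<^sup>2))"
    using 1 2 3 by linarith
  also have "\<dots> = \<beta> * L\<^sup>2 * (((2 * n + 4) * B)\<^sup>2 + 48 * n * B\<^sup>2 + 256 * B\<^sup>2)"
    by (simp add: distrib_left mult.assoc)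
  finally show ?thesis .
qed

text \<open>A bound for the error that an annular cut-off causes at \<open>s = x \<bullet> x\<close>. It is supported inside the inner edge, where it
grows with \<open>k\<close> only like \<open>(a + 1) ^ k\<close>, and beyond the outer edge \<open>S\<close>.\<close>

definition cutoff_error :: "real \<Rightarrow> real \<Rightarrow> real \<Rightarrow> nat \<Rightarrow> real \<Rightarrow> real" where
  "cutoff_error a Q S k s = Q * ((if s \<le> a + 1 then (a + 1) ^ (k + 2) else 0) + (if s \<ge> S then (2 * S) ^ (k + 4) else 0))"

text \<open>In terms of \<open>s = x \<bullet> x\<close>, the function \<open>p\<close> is the cut-off and \<open>e\<close> dominates the weighted square of its gradient.
The expressions \<open>2 * n * p' s + 4 * p'' s * s\<close> and \<open>2 * n * e' s + 4 * e'' s * s\<close> are the Laplacians of these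
functions in dimension \<open>n\<close>.\<close>

definition annular_profile ::
    "real \<Rightarrow> real \<Rightarrow> real \<Rightarrow> real \<Rightarrow> nat \<Rightarrow> (real \<Rightarrow> real) \<Rightarrow> (real \<Rightarrow> real) \<Rightarrow> (real \<Rightarrow> real) \<Rightarrow>
      (real \<Rightarrow> real) \<Rightarrow> (real \<Rightarrow> real) \<Rightarrow> (real \<Rightarrow> real) \<Rightarrow> bool" where
  "annular_profile a n Q S k p p' p'' e e' e'' \<longleftrightarrow>
     (\<forall>s. (p has_real_derivative p' s) (at s)) \<and> (\<forall>s. (p' has_real_derivative p'' s) (at s)) \<and> continuous_on UNIV p'' \<and>
     (\<forall>s. (e has_real_derivative e' s) (at s)) \<and> (\<forall>s. (e' has_real_derivative e'' s) (at s)) \<and> continuous_on UNIV e'' \<and>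
     (\<forall>s. s \<le> a \<or> s \<ge> 2 * S \<longrightarrow> p s = 0 \<and> e s = 0) \<and> (\<forall>s. a + 1 \<le> s \<and> s \<le> S \<longrightarrow> p s = 1) \<and>
     (\<forall>s\<ge>0. s ^ (k + 2) * (16 * s * (p' s)\<^sup>2) \<le> e s) \<and>
     (\<forall>s\<ge>0. \<bar>s ^ (k + 2) * (2 * n * p' s + 4 * p'' s * s)\<^sup>2 + (2 * n * e' s + 4 * e'' s * s) / 2\<bar> \<le> cutoff_error a Q S k s) \<and>
     (\<forall>s\<ge>0. 0 \<le> e s \<and> e s \<le> cutoff_error a Q S k s)"

text \<open>The cut-off is the product of a step that rises between \<open>a\<close> and \<open>a + 1\<close> and a step that falls between \<open>S\<close> and \<open>2 * S\<close>.
Every \<open>s\<close> lies where at least one of the two is constant. In \<open>e\<close> the weight \<open>s ^ (k + 2)\<close> is replaced by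
its maximum \<open>\<alpha>\<close> or \<open>\<beta>\<close> on each transition zone; so no derivative falls on the weight and the constant \<open>Q\<close> does not
depend on \<open>k\<close>.\<close>

lemma annular_cutoff:
  fixes a n :: real
  assumes a: "a \<ge> 0" and n: "n \<ge> 0"
  obtains Q where "Q \<ge> 0"
    "\<And>S k. S \<ge> a + 1 \<Longrightarrow> \<exists>p p' p'' e e' e''. annular_profile a n Q S k p p' p'' e e' e''"
proof -
  obtain \<sigma> \<sigma>1 \<sigma>2 \<sigma>3 :: "real \<Rightarrow> real" and B where
    d1: "\<And>t. (\<sigma> has_real_derivative \<sigma>1 t) (at t)" and d2: "\<And>t. (\<sigma>1 has_real_derivative \<sigma>2 t) (at t)"
    and d3: "\<And>t. (\<sigma>2 has_real_derivative \<sigma>3 t) (at t)" and c3: "continuous_on UNIV \<sigma>3"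
    and s0: "\<And>t. t \<le> 0 \<Longrightarrow> \<sigma> t = 0" and s1: "\<And>t. t \<ge> 1 \<Longrightarrow> \<sigma> t = 1"
    and sv: "\<And>t. t \<le> 0 \<or> t \<ge> 1 \<Longrightarrow> \<sigma>1 t = 0 \<and> \<sigma>2 t = 0 \<and> \<sigma>3 t = 0"
    and B: "B \<ge> 0" "\<And>t. \<bar>\<sigma>1 t\<bar> \<le> B" "\<And>t. \<bar>\<sigma>2 t\<bar> \<le> B" "\<And>t. \<bar>\<sigma>3 t\<bar> \<le> B"
    by (rule step_profile) blast
  define Q0 where "Q0 = ((2 * n + 4) * B)\<^sup>2 + 48 * n * B\<^sup>2 + 256 * B\<^sup>2"
  define Q where "Q = (a + 1)\<^sup>2 * Q0"
  have Q0: "Q0 \<ge> 0" "16 * B\<^sup>2 \<le> Q0" using n by (auto simp: Q0_def)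
  have a1: "1 \<le> (a + 1)\<^sup>2" using a power_increasing[of 0 2 "a + 1"] by simp
  have Q: "Q \<ge> 0" "Q0 \<le> Q" using Q0 mult_right_mono[OF a1 Q0(1)] by (auto simp: Q_def)
  show ?thesis
  proof (rule that[OF Q(1)])
    fix S :: real and k :: nat assume S: "S \<ge> a + 1"
    then have S1: "S \<ge> 1" using a by linarith
    define A0 A1 A2 A3 where "A0 s = \<sigma> (s - a)" and "A1 s = \<sigma>1 (s - a)" and "A2 s = \<sigma>2 (s - a)" and "A3 s = \<sigma>3 (s - a)" for s
    define T0 T1 T2 T3 where "T0 s = 1 - \<sigma> (s / S - 1)" and "T1 s = - (\<sigma>1 (s / S - 1) * (1 / S))"
      and "T2 s = - (\<sigma>2 (s / S - 1) * (1 / S) * (1 / S))" and "T3 s = - (\<sigma>3 (s / S - 1) * (1 / S) * (1 / S) * (1 / S))" for s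
    have sh: "((\<lambda>s. f (s - a)) has_real_derivative f' (s - a)) (at s)" if "\<And>t. (f has_real_derivative f' t) (at t)" for f f' :: "real \<Rightarrow> real" and s
    proof -
      have "((\<lambda>s. f (s - a)) has_real_derivative f' (s - a) * 1) (at s)"
        by (rule DERIV_chain2[OF that]) (auto intro!: derivative_eq_intros)
      then show ?thesis by simp
    qed
    have sc: "((\<lambda>s. f (s / S - 1)) has_real_derivative f' (s / S - 1) * (1 / S)) (at s)" if "\<And>t. (f has_real_derivative f' t) (at t)" for f f' :: "real \<Rightarrow> real" and s
      by (rule DERIV_chain2[OF that]) (use S1 in \<open>auto intro!: derivative_eq_intros\<close>)
    have dA0: "(A0 has_real_derivative A1 s) (at s)" for s unfolding A0_def A1_def by (rule sh[OF d1])
    have dA1: "(A1 has_real_derivative A2 s) (at s)" for s unfolding A1_def A2_def by (rule sh[OF d2])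
    have dA2: "(A2 has_real_derivative A3 s) (at s)" for s unfolding A2_def A3_def by (rule sh[OF d3])
    have dT0: "(T0 has_real_derivative T1 s) (at s)" for s
      unfolding T0_def T1_def using DERIV_diff[OF DERIV_const sc[OF d1]] by simp
    have dT1: "(T1 has_real_derivative T2 s) (at s)" for s
      unfolding T1_def T2_def by (intro DERIV_minus DERIV_cmult_right sc[OF d2])
    have dT2: "(T2 has_real_derivative T3 s) (at s)" for s
      unfolding T2_def T3_def by (intro DERIV_minus DERIV_cmult_right sc[OF d3])
    have cD: "continuous_on UNIV f" if "\<And>s. (f has_real_derivative f' s) (at s)" for f f' :: "real \<Rightarrow> real"
      using that by (meson DERIV_isCont continuous_at_imp_continuous_on)
    note cA = cD[OF dA0] cD[OF dA1] cD[OF dA2] and cT = cD[OF dT0] cD[OF dT1] cD[OF dT2]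
    have cA3: "continuous_on UNIV A3"
      unfolding A3_def[abs_def] by (rule continuous_on_compose2[OF c3 _ subset_UNIV]) (intro continuous_intros)
    have cT3: "continuous_on UNIV T3"
    proof -
      have "continuous_on UNIV (\<lambda>s. \<sigma>3 (s / S - 1))"
        by (rule continuous_on_compose2[OF c3 _ subset_UNIV]) (use S1 in \<open>auto intro!: continuous_intros\<close>)
      then show ?thesis unfolding T3_def[abs_def] by (intro continuous_intros)
    qed
    define \<alpha> \<beta> where "\<alpha> = (a + 1) ^ (k + 2)" and "\<beta> = (2 * S) ^ (k + 2)"
    have \<alpha>: "\<alpha> \<ge> 0" and \<beta>: "\<beta> \<ge> 0" using a S1 by (auto simp: \<alpha>_def \<beta>_def)
    define p p' p'' where "p s = A0 s * T0 s" and "p' s = A1 s * T0 s + T1 s * A0 s"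
      and "p'' s = (A2 s * T0 s + T1 s * A1 s) + (T2 s * A0 s + A1 s * T1 s)" for s
    define e e' e'' where "e s = 16 * s * (\<alpha> * (A1 s * A1 s) + \<beta> * (T1 s * T1 s))"
      and "e' s = 16 * (\<alpha> * (A1 s * A1 s) + \<beta> * (T1 s * T1 s)) + (\<alpha> * (A2 s * A1 s + A2 s * A1 s) + \<beta> * (T2 s * T1 s + T2 s * T1 s)) * (16 * s)"
      and "e'' s = 16 * (\<alpha> * (A2 s * A1 s + A2 s * A1 s) + \<beta> * (T2 s * T1 s + T2 s * T1 s))
         + ((\<alpha> * ((A3 s * A1 s + A2 s * A2 s) + (A3 s * A1 s + A2 s * A2 s)) + \<beta> * ((T3 s * T1 s + T2 s * T2 s) + (T3 s * T1 s + T2 s * T2 s))) * (16 * s)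
         + 16 * (\<alpha> * (A2 s * A1 s + A2 s * A1 s) + \<beta> * (T2 s * T1 s + T2 s * T1 s)))" for s
    have i16: "((\<lambda>s. 16 * s) has_real_derivative 16) (at s)" for s :: real
      by (auto intro!: derivative_eq_intros)
    have dp: "(p has_real_derivative p' s) (at s)" for s
      unfolding p_def p'_def by (intro DERIV_mult dA0 dT0)
    have dp': "(p' has_real_derivative p'' s) (at s)" for s
      unfolding p'_def p''_def by (intro DERIV_add DERIV_mult dA0 dA1 dT0 dT1)
    have de: "(e has_real_derivative e' s) (at s)" for s
      unfolding e_def e'_def by (intro DERIV_mult DERIV_add DERIV_cmult dA1 dT1 i16)
    have de': "(e' has_real_derivative e'' s) (at s)" for s
      unfolding e'_def e''_def by (intro DERIV_add DERIV_mult DERIV_cmult dA1 dA2 dT1 dT2 i16)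
    have A_lo: "A0 s = 0" "A1 s = 0" if "s \<le> a" for s using that s0 sv by (auto simp: A0_def A1_def)
    have A_hi: "A0 s = 1" "A1 s = 0" "A2 s = 0" "A3 s = 0" if "s \<ge> a + 1" for s
      using that s1[of "s - a"] sv[of "s - a"] by (auto simp: A0_def A1_def A2_def A3_def)
    have T_lo: "T0 s = 1" "T1 s = 0" "T2 s = 0" "T3 s = 0" if "s \<le> S" for s
    proof -
      have "s / S - 1 \<le> 0" using that S1 by (simp add: field_simps)
      then show "T0 s = 1" "T1 s = 0" "T2 s = 0" "T3 s = 0"
        using s0[of "s / S - 1"] sv[of "s / S - 1"] by (auto simp: T0_def T1_def T2_def T3_def)
    qed
    have T_hi: "T0 s = 0" "T1 s = 0" "T2 s = 0" "T3 s = 0" if "s \<ge> 2 * S" for s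
    proof -
      have "s / S - 1 \<ge> 1" using that S1 by (simp add: field_simps)
      then show "T0 s = 0" "T1 s = 0" "T2 s = 0" "T3 s = 0"
        using s1[of "s / S - 1"] sv[of "s / S - 1"] by (auto simp: T0_def T1_def T2_def T3_def)
    qed
    have bA: "\<bar>A1 s\<bar> \<le> B" "\<bar>A2 s\<bar> \<le> B" "\<bar>A3 s\<bar> \<le> B" for s by (auto simp: A1_def A2_def A3_def B)
    have div: "\<bar>x * (1 / S)\<bar> \<le> B" if "\<bar>x\<bar> \<le> B" for x
      unfolding abs_mult using that S1 B(1) mult_mono[of "\<bar>x\<bar>" B "\<bar>1 / S\<bar>" 1] by (simp add: divide_le_eq)
    have bT: "\<bar>T1 s\<bar> \<le> B" "\<bar>T2 s\<bar> \<le> B" "\<bar>T3 s\<bar> \<le> B" for s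
      unfolding T1_def T2_def T3_def abs_minus_cancel by (intro div B)+
    let ?b = "\<lambda>s. Q * ((if s \<le> a + 1 then (a + 1) ^ (k + 2) else 0) + (if s \<ge> S then (2 * S) ^ (k + 4) else 0))"
    have b_in: "\<alpha> * (a + 1)\<^sup>2 * Q0 \<le> ?b s" if "s \<le> a + 1" for s
    proof -
      have "\<alpha> * (a + 1)\<^sup>2 * Q0 = Q * \<alpha>" by (simp add: Q_def)
      also have "\<dots> \<le> ?b s" using that Q(1) S1 by (intro mult_left_mono) (auto simp: \<alpha>_def)
      finally show ?thesis .
    qed
    have b_out: "\<beta> * (2 * S)\<^sup>2 * Q0 \<le> ?b s" if "s \<ge> S" for s
    proof -
      have "\<beta> * (2 * S)\<^sup>2 * Q0 \<le> \<beta> * (2 * S)\<^sup>2 * Q" using Q \<beta> by (intro mult_left_mono) auto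
      also have "\<dots> = Q * (2 * S) ^ (k + 4)"
      proof -
        have "k + 4 = (k + 2) + 2" by simp
        then show ?thesis unfolding \<beta>_def by (simp only: power_add mult_ac)
      qed
      also have "\<dots> \<le> ?b s" using that Q(1) a by (intro mult_left_mono) auto
      finally show ?thesis .
    qed
    have b_nn: "0 \<le> ?b s" for s using Q(1) a S1 by (intro mult_nonneg_nonneg add_nonneg_nonneg) auto
    have grad: "s ^ (k + 2) * (16 * s * (p' s)\<^sup>2) \<le> e s" if s: "s \<ge> 0" for s
    proof -
      consider "s \<le> a + 1" | "a + 1 \<le> s" "s \<le> 2 * S" | "s \<ge> 2 * S" "a + 1 \<le> s" using S a by linarith
      then show ?thesis
      proof cases
        case 1
        then have "s ^ (k + 2) * (16 * s * (A1 s)\<^sup>2) \<le> \<alpha> * (16 * s * (A1 s)\<^sup>2)"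
          unfolding \<alpha>_def using s by (intro mult_right_mono power_mono) auto
        then show ?thesis using 1 S T_lo[of s] by (simp add: p'_def e_def power2_eq_square mult_ac)
      next
        case 2
        then have "s ^ (k + 2) * (16 * s * (T1 s)\<^sup>2) \<le> \<beta> * (16 * s * (T1 s)\<^sup>2)"
          unfolding \<beta>_def using s by (intro mult_right_mono power_mono) auto
        then show ?thesis using 2 A_hi[of s] by (simp add: p'_def e_def power2_eq_square mult_ac)
      next
        case 3
        then show ?thesis using A_hi[of s] T_hi[of s] by (simp add: p'_def e_def)
      qed
    qed
    have bound: "\<bar>s ^ (k + 2) * (2 * n * p' s + 4 * p'' s * s)\<^sup>2 + (2 * n * e' s + 4 * e'' s * s) / 2\<bar> \<le> ?b s" if s: "s \<ge> 0" for s
    proof -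
      consider "s \<le> a + 1" | "a + 1 < s" "s < S" | "S \<le> s" "a + 1 < s" "s \<le> 2 * S" | "s > 2 * S" "a + 1 < s" using S a by linarith
      then show ?thesis
      proof cases
        case 1
        have eq: "s ^ (k + 2) * (2 * n * p' s + 4 * p'' s * s)\<^sup>2 + (2 * n * e' s + 4 * e'' s * s) / 2
          = s ^ (k + 2) * (2 * n * A1 s + 4 * s * A2 s)\<^sup>2 + n * (16 * \<alpha> * (A1 s)\<^sup>2 + 32 * s * (\<alpha> * (A1 s * A2 s)))
            + 2 * s * (64 * (\<alpha> * (A1 s * A2 s)) + 32 * s * (\<alpha> * ((A2 s)\<^sup>2 + A1 s * A3 s)))"
          using T_lo[of s] 1 S by (simp add: p'_def p''_def e'_def e''_def power2_eq_square field_simps)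
        have w: "s ^ (k + 2) \<le> \<alpha>" unfolding \<alpha>_def using s 1 by (intro power_mono) auto
        have "\<bar>s ^ (k + 2) * (2 * n * A1 s + 4 * s * A2 s)\<^sup>2 + n * (16 * \<alpha> * (A1 s)\<^sup>2 + 32 * s * (\<alpha> * (A1 s * A2 s)))
            + 2 * s * (64 * (\<alpha> * (A1 s * A2 s)) + 32 * s * (\<alpha> * ((A2 s)\<^sup>2 + A1 s * A3 s)))\<bar> \<le> \<alpha> * (a + 1)\<^sup>2 * Q0"
          unfolding Q0_def by (rule cutoff_term_bound[OF bA]) (use s 1 a n w in auto)
        also have "\<dots> \<le> ?b s" by (rule b_in[OF 1])
        finally show ?thesis unfolding eq .
      next
        case 2
        then show ?thesis using A_hi[of s] T_lo[of s] by (simp add: p'_def p''_def e'_def e''_def)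
      next
        case 3
        have eq: "s ^ (k + 2) * (2 * n * p' s + 4 * p'' s * s)\<^sup>2 + (2 * n * e' s + 4 * e'' s * s) / 2
          = s ^ (k + 2) * (2 * n * T1 s + 4 * s * T2 s)\<^sup>2 + n * (16 * \<beta> * (T1 s)\<^sup>2 + 32 * s * (\<beta> * (T1 s * T2 s)))
            + 2 * s * (64 * (\<beta> * (T1 s * T2 s)) + 32 * s * (\<beta> * ((T2 s)\<^sup>2 + T1 s * T3 s)))"
          using A_hi[of s] 3 by (simp add: p'_def p''_def e'_def e''_def power2_eq_square field_simps)
        have w: "s ^ (k + 2) \<le> \<beta>" unfolding \<beta>_def using s 3 by (intro power_mono) auto
        have "\<bar>s ^ (k + 2) * (2 * n * T1 s + 4 * s * T2 s)\<^sup>2 + n * (16 * \<beta> * (T1 s)\<^sup>2 + 32 * s * (\<beta> * (T1 s * T2 s)))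
            + 2 * s * (64 * (\<beta> * (T1 s * T2 s)) + 32 * s * (\<beta> * ((T2 s)\<^sup>2 + T1 s * T3 s)))\<bar> \<le> \<beta> * (2 * S)\<^sup>2 * Q0"
          unfolding Q0_def by (rule cutoff_term_bound[OF bT]) (use s 3 S1 n w in auto)
        also have "\<dots> \<le> ?b s" by (rule b_out) (use 3 in auto)
        finally show ?thesis unfolding eq .
      next
        case 4
        then show ?thesis using A_hi[of s] T_hi[of s] b_nn[of s] by (simp add: p'_def p''_def e'_def e''_def)
      qed
    qed
    have ebound: "0 \<le> e s \<and> e s \<le> ?b s" if s: "s \<ge> 0" for s
    proof
      show "0 \<le> e s" unfolding e_def
        by (rule mult_nonneg_nonneg[OF _ add_nonneg_nonneg[OF mult_nonneg_nonneg[OF \<alpha> zero_le_square] mult_nonneg_nonneg[OF \<beta> zero_le_square]]])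
          (use s in simp)
      have sq: "x * x \<le> B\<^sup>2" if "\<bar>x\<bar> \<le> B" for x
        using power_mono[OF that, of 2] by (simp add: power2_eq_square)
      consider "s \<le> a + 1" | "a + 1 < s" "s < S" | "S \<le> s" "a + 1 < s" "s \<le> 2 * S" | "s > 2 * S" "a + 1 < s" using S a by linarith
      then show "e s \<le> ?b s"
      proof cases
        case 1
        have "e s = 16 * s * (\<alpha> * (A1 s * A1 s))" using T_lo[of s] 1 S by (simp add: e_def)
        also have "\<dots> \<le> 16 * (a + 1)\<^sup>2 * (\<alpha> * B\<^sup>2)"
          using s 1 a \<alpha> sq[OF bA(1)] power_increasing[of 1 2 "a + 1"] by (intro mult_mono) auto
        also have "\<dots> = \<alpha> * (a + 1)\<^sup>2 * (16 * B\<^sup>2)" by simp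
        also have "\<dots> \<le> \<alpha> * (a + 1)\<^sup>2 * Q0" using Q0 \<alpha> by (intro mult_left_mono) auto
        also have "\<dots> \<le> ?b s" by (rule b_in[OF 1])
        finally show ?thesis .
      next
        case 2
        then show ?thesis using A_hi[of s] T_lo[of s] by (simp add: e_def)
      next
        case 3
        have "e s = 16 * s * (\<beta> * (T1 s * T1 s))" using A_hi[of s] 3 by (simp add: e_def)
        also have "\<dots> \<le> 16 * (2 * S)\<^sup>2 * (\<beta> * B\<^sup>2)"
          using s 3 S1 \<beta> sq[OF bT(1)] power_increasing[of 1 2 "2 * S"] by (intro mult_mono) auto
        also have "\<dots> = \<beta> * (2 * S)\<^sup>2 * (16 * B\<^sup>2)" by simp
        also have "\<dots> \<le> \<beta> * (2 * S)\<^sup>2 * Q0" using Q0 \<beta> by (intro mult_left_mono) auto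
        also have "\<dots> \<le> ?b s" by (rule b_out) (use 3 in auto)
        finally show ?thesis .
      next
        case 4
        then show ?thesis using A_hi[of s] T_hi[of s] b_nn[of s] by (simp add: e_def)
      qed
    qed
    have "annular_profile a n Q S k p p' p'' e e' e''"
      unfolding annular_profile_def cutoff_error_def
    proof (intro conjI)
      show "continuous_on UNIV p''" unfolding p''_def[abs_def] by (intro continuous_intros cA cT)
      show "continuous_on UNIV e''" unfolding e''_def[abs_def] by (intro continuous_intros cA cT cA3 cT3)
      show "\<forall>s. s \<le> a \<or> s \<ge> 2 * S \<longrightarrow> p s = 0 \<and> e s = 0"
      proof (intro allI impI)
        fix s assume "s \<le> a \<or> s \<ge> 2 * S"
        then show "p s = 0 \<and> e s = 0"
        proof
          assume "s \<le> a"
          then show ?thesis using A_lo[of s] T_lo[of s] S by (simp add: p_def e_def)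
        next
          assume "s \<ge> 2 * S"
          then show ?thesis using A_hi[of s] T_hi[of s] S S1 by (simp add: p_def e_def)
        qed
      qed
      show "\<forall>s. a + 1 \<le> s \<and> s \<le> S \<longrightarrow> p s = 1" using A_hi T_lo by (simp add: p_def)
    qed (use dp dp' de de' grad bound ebound in auto)
    then show "\<exists>p p' p'' e e' e''. annular_profile a n Q S k p p' p'' e e' e''" by blast
  qed
qed

section \<open>Vanishing near infinity\<close>

lemma integral_eq_0_imp_AE_on:
  fixes f :: "'a \<Rightarrow> real"
  assumes "integrable M f" "\<And>x. 0 \<le> f x" "(\<integral>x. f x \<partial>M) \<le> 0"
  shows "AE x in M. f x = 0"
proof -
  have "(\<integral>x. f x \<partial>M) = 0" using assms integral_nonneg_AE[of f M] by (intro antisym) auto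
  then show ?thesis using integral_nonneg_eq_0_iff_AE[OF assms(1)] assms(2) by auto
qed

text \<open>With \<open>q = V\<close> the equation makes the first term on the right of \<open>weak_cutoff_inequality\<close> vanish, and only the errors of
the cut-off remain. First \<open>S\<close> tends to infinity, then \<open>k\<close>.\<close>

lemma vanishes_near_infinity:
  fixes u f V :: "real ^ 'n \<Rightarrow> real"
  assumes u: "L2_loc_borel u" and f: "L2_loc_borel f"
    and weak: "\<And>\<phi>. test_function \<phi> \<Longrightarrow> (\<integral>x. u x * laplacian \<phi> x \<partial>lborel) = (\<integral>x. f x * \<phi> x \<partial>lborel)"
    and Vm: "V \<in> borel_measurable borel" and R: "R > 1"
    and Vb: "C \<ge> 0" "\<And>x. \<bar>V x\<bar> \<le> C * (x \<bullet> x) ^ m"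
    and mono: "\<And>l. l > 1 \<Longrightarrow> AE y in lborel. norm y > R \<longrightarrow> V y \<le> l\<^sup>2 * V (l *\<^sub>R y)"
    and eq: "AE x in lborel. norm x > R \<longrightarrow> f x + V x * u x = 0"
    and u2: "integrable lborel (\<lambda>x. (u x)\<^sup>2)"
    and tail: "\<And>p. (\<lambda>i. real i ^ p * (\<integral>x. indicator {x. real i \<le> x \<bullet> x} x * (u x)\<^sup>2 \<partial>lborel)) \<longlonglongrightarrow> 0"
  shows "AE x in lborel. x \<bullet> x \<ge> (R + 1)\<^sup>2 + 1 \<longrightarrow> u x = 0"
proof -
  \<comment> \<open>the cut-off starts at radius \<open>R + 1\<close>, which leaves room for the dilations used for the potential term\<close>
  define a where "a = (R + 1)\<^sup>2"
  have a: "a \<ge> 1" using R by (simp add: a_def)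
  have aR: "norm x > R + 1 \<longleftrightarrow> x \<bullet> x > a" for x :: "real ^ 'n"
    using R abs_le_square_iff[of "norm x" "R + 1"] by (simp add: a_def power2_norm_eq_inner not_le[symmetric])
  have um[measurable]: "u \<in> borel_measurable borel" by (rule L2_loc_borelD(1)[OF u])
  note [measurable] = Vm L2_loc_borelD(1)[OF f]
  let ?n = "real DIM(real ^ 'n)"
  obtain Q where Q: "Q \<ge> 0" and cut: "\<And>S k. S \<ge> a + 1 \<Longrightarrow> \<exists>p p' p'' e e' e''. annular_profile a ?n Q S k p p' p'' e e' e''"
    by (rule annular_cutoff[of a ?n]) (use a in auto)
  define E where "E = (\<integral>x. (u x)\<^sup>2 \<partial>lborel)"
  have E: "E \<ge> 0" unfolding E_def by (intro integral_nonneg_AE) auto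
  define t where "t i = (\<integral>x. indicator {x. real i \<le> x \<bullet> x} x * (u x)\<^sup>2 \<partial>lborel)" for i :: nat
  define K where "K = Q * (1 + C * (a + 1) ^ m)"
  have ind_int: "integrable lborel (\<lambda>x. indicator A x * (u x)\<^sup>2)" if "A \<in> sets borel" for A
  proof (rule Bochner_Integration.integrable_bound[OF u2])
    show "(\<lambda>x. indicator A x * (u x)\<^sup>2) \<in> borel_measurable lborel"
      using that by (intro borel_measurable_times borel_measurable_indicator) auto
  qed (auto simp: indicator_def)
  \<comment> \<open>the cut-off whose outer transition starts at \<open>S = i\<close>; the last term tends to \<open>0\<close> as \<open>i\<close> grows\<close>
  have est: "(2 * real k + 2)\<^sup>2 * ((a + 1) ^ (k - 1) * (\<integral>x. indicator {x. a + 1 \<le> x \<bullet> x \<and> x \<bullet> x \<le> L} x * (u x)\<^sup>2 \<partial>lborel))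
      \<le> 3 * ((a + 1) ^ (k + 2) * K * E + Q * (1 + C * (2 * real i) ^ m) * (2 * real i) ^ (k + 4) * t i)"
    if k: "k \<ge> 1" and i: "real i \<ge> a + 1" "real i \<ge> L" for k i L
  proof -
    define S where "S = real i"
    have S: "S \<ge> a + 1" "S \<ge> 1" "S \<ge> L" using i a by (auto simp: S_def)
    obtain p p' p'' e e' e'' where prof: "annular_profile a ?n Q S k p p' p'' e e' e''"
      using cut[OF S(1), of k] by blast
    note prof' = prof[unfolded annular_profile_def]
    have dp: "\<And>s. (p has_real_derivative p' s) (at s)" "\<And>s. (p' has_real_derivative p'' s) (at s)" "continuous_on UNIV p''"
      and de: "\<And>s. (e has_real_derivative e' s) (at s)" "\<And>s. (e' has_real_derivative e'' s) (at s)" "continuous_on UNIV e''"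
      and van: "\<And>s. s \<le> a \<or> s \<ge> 2 * S \<Longrightarrow> p s = 0" "\<And>s. s \<le> a \<or> s \<ge> 2 * S \<Longrightarrow> e s = 0"
      and one: "\<And>s. a + 1 \<le> s \<Longrightarrow> s \<le> S \<Longrightarrow> p s = 1"
      and grad: "\<And>s. s \<ge> 0 \<Longrightarrow> s ^ (k + 2) * (16 * s * (p' s)\<^sup>2) \<le> e s"
      and bd: "\<And>s. s \<ge> 0 \<Longrightarrow> \<bar>s ^ (k + 2) * (2 * ?n * p' s + 4 * p'' s * s)\<^sup>2 + (2 * ?n * e' s + 4 * e'' s * s) / 2\<bar> \<le> cutoff_error a Q S k s"
      and ebd: "\<And>s. s \<ge> 0 \<Longrightarrow> 0 \<le> e s \<and> e s \<le> cutoff_error a Q S k s"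
      using prof' by blast+
    define r where "r = sqrt (2 * S)"
    have rS: "x \<bullet> x \<ge> 2 * S" if "norm x > r" for x :: "real ^ 'n"
    proof -
      have "r\<^sup>2 \<le> (norm x)\<^sup>2" using that S by (intro power_mono) (auto simp: r_def)
      then show ?thesis using S by (simp add: r_def power2_norm_eq_inner)
    qed
    define \<xi> \<eta> where "\<xi> x = p (x \<bullet> x)" and "\<eta> x = e (x \<bullet> x)" for x :: "real ^ 'n"
    define g\<xi> where "g\<xi> x = (2 * p' (x \<bullet> x)) *\<^sub>R x" for x :: "real ^ 'n"
    define H\<xi> where "H\<xi> x h = (2 * p' (x \<bullet> x)) *\<^sub>R h + (2 * (p'' (x \<bullet> x) * (2 * (x \<bullet> h)))) *\<^sub>R x" for x h :: "real ^ 'n"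
    define g\<eta> where "g\<eta> x = (2 * e' (x \<bullet> x)) *\<^sub>R x" for x :: "real ^ 'n"
    define H\<eta> where "H\<eta> x h = (2 * e' (x \<bullet> x)) *\<^sub>R h + (2 * (e'' (x \<bullet> x) * (2 * (x \<bullet> h)))) *\<^sub>R x" for x h :: "real ^ 'n"
    have C\<xi>: "C2_with \<xi> g\<xi> H\<xi>" unfolding \<xi>_def[abs_def] g\<xi>_def[abs_def] H\<xi>_def[abs_def] by (rule C2_with_radial[OF dp])
    have C\<eta>: "C2_with \<eta> g\<eta> H\<eta>" unfolding \<eta>_def[abs_def] g\<eta>_def[abs_def] H\<eta>_def[abs_def] by (rule C2_with_radial[OF de])
    have tr\<xi>: "lintrace (H\<xi> x) = 2 * ?n * p' (x \<bullet> x) + 4 * p'' (x \<bullet> x) * (x \<bullet> x)" for x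
      unfolding H\<xi>_def by (rule trans[OF lintrace_radial]) simp
    have tr\<eta>: "lintrace (H\<eta> x) = 2 * ?n * e' (x \<bullet> x) + 4 * e'' (x \<bullet> x) * (x \<bullet> x)" for x
      unfolding H\<eta>_def by (rule trans[OF lintrace_radial]) simp
    have \<xi>r: "\<xi> x = 0" and \<eta>r: "\<eta> x = 0" if "norm x > r" for x using van rS[OF that] by (auto simp: \<xi>_def \<eta>_def)
    have k1: "k = (k - 1) + 1" using k by simp
    let ?G = "\<lambda>x. (x \<bullet> x) ^ (k + 2) * (lintrace (H\<xi> x))\<^sup>2 + lintrace (H\<eta> x) / 2"
    have main: "(2 * real k + 2)\<^sup>2 * (\<integral>x. ((x \<bullet> x) ^ (k - 1) * (\<xi> x)\<^sup>2) * (u x * u x) \<partial>lborel)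
      \<le> 3 * 1 * ((\<integral>x. ((x \<bullet> x) ^ (k + 2) * (\<xi> x)\<^sup>2) * ((f x + V x * u x) * (f x + V x * u x)) \<partial>lborel)
       + (\<integral>x. ?G x * (u x * u x) \<partial>lborel) - (\<integral>x. \<eta> x * (u x * f x) \<partial>lborel))"
    proof (rule weak_cutoff_inequality[OF u f weak C\<xi> C\<eta> \<xi>r \<eta>r _ disjI2[OF k1] _ _ Vm])
      show "(x \<bullet> x) ^ (k + 2) * (4 * (g\<xi> x \<bullet> g\<xi> x)) \<le> \<eta> x" for x
        using grad[of "x \<bullet> x"] by (simp add: g\<xi>_def \<eta>_def power2_eq_square mult_ac)
      show "(x \<bullet> x) ^ (k - 1) \<le> 1 * (x \<bullet> x) ^ k" if "\<xi> x \<noteq> 0 \<or> g\<xi> x \<noteq> 0" for x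
      proof -
        have "x \<bullet> x \<ge> 1"
        proof (rule ccontr)
          assume "\<not> ?thesis"
          then have xa: "x \<bullet> x < a" using a by linarith
          have "(p has_real_derivative 0) (at (x \<bullet> x))"
            by (rule has_field_derivative_transform_within_open[OF DERIV_const, of "{..<a}"]) (use xa van in auto)
          then have "p' (x \<bullet> x) = 0" using dp(1) DERIV_unique by blast
          then have "g\<xi> x = 0" by (simp add: g\<xi>_def)
          moreover have "\<xi> x = 0" using van(1) xa by (simp add: \<xi>_def)
          ultimately show False using that by simp
        qed
        then show ?thesis using power_increasing[of "k - 1" k "x \<bullet> x"] by simp
      qed
      show "\<exists>A. \<forall>x. norm x \<le> r' \<longrightarrow> \<bar>V x\<bar> \<le> A" for r'
      proof (intro exI allI impI)
        fix x :: "real ^ 'n" assume "norm x \<le> r'"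
        then have "x \<bullet> x \<le> r'\<^sup>2" using power_mono[of "norm x" r' 2] by (simp add: power2_norm_eq_inner)
        then have "C * (x \<bullet> x) ^ m \<le> C * (r'\<^sup>2) ^ m" using Vb(1) by (intro mult_left_mono power_mono) auto
        then show "\<bar>V x\<bar> \<le> C * (r'\<^sup>2) ^ m" using Vb(2)[of x] by linarith
      qed
      fix v g H assume v: "C2_with v g H" and v0: "\<And>x. \<xi> x = 0 \<Longrightarrow> v x = 0"
      show "(\<integral>x. V x * ((x \<bullet> x) ^ (k + 1) * (v x * (x \<bullet> g x + (?n / 2 + real k) * v x))) \<partial>lborel) \<le> 0"
      proof (rule potential_term_nonpos[OF v _ _ _ _ Vm _ mono])
        show "0 < R" "R < R + 1" using R by auto
        show "v x = 0" if "norm x \<le> R + 1" for x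
          using that aR[of x] van(1) by (intro v0) (auto simp: \<xi>_def)
        show "v x = 0" if "norm x > r" for x using v0 \<xi>r[OF that] by simp
        show "\<bar>V x\<bar> \<le> C * (r\<^sup>2) ^ m" if "norm x \<le> r" for x
        proof -
          have "x \<bullet> x \<le> r\<^sup>2" using that power_mono[of "norm x" r 2] by (simp add: power2_norm_eq_inner)
          then have "C * (x \<bullet> x) ^ m \<le> C * (r\<^sup>2) ^ m" using Vb(1) by (intro mult_left_mono power_mono) auto
          then show ?thesis using Vb(2)[of x] by linarith
        qed
      qed
    qed auto
    have z: "AE x in lborel. ((x \<bullet> x) ^ (k + 2) * (\<xi> x)\<^sup>2) * ((f x + V x * u x) * (f x + V x * u x)) = 0"
      using eq
    proof eventually_elim
      case (elim x)
      show ?case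
      proof (cases "norm x > R + 1")
        case True
        then show ?thesis using elim by simp
      next
        case False
        then show ?thesis using aR[of x] van(1) by (simp add: \<xi>_def)
      qed
    qed
    have first: "(\<integral>x. ((x \<bullet> x) ^ (k + 2) * (\<xi> x)\<^sup>2) * ((f x + V x * u x) * (f x + V x * u x)) \<partial>lborel) = 0"
      by (rule integral_eq_zero_AE[OF z])
    note d\<xi> = C2_withD[OF C\<xi>] and d\<eta> = C2_withD[OF C\<eta>]
    have z\<xi>: "lintrace (H\<xi> x) = 0" and z\<eta>: "lintrace (H\<eta> x) = 0" if "norm x > r" for x
      using C2_with_vanishing[OF C\<xi> \<xi>r that] C2_with_vanishing[OF C\<eta> \<eta>r that] by auto
    have wint: "integrable lborel (\<lambda>x. h x * (v x * w x))"
      if h: "continuous_on UNIV h" "\<And>x. norm x > r \<Longrightarrow> h x = 0" and vw: "L2_loc_borel v" "L2_loc_borel w" for h v w :: "real ^ 'n \<Rightarrow> real"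
    proof -
      obtain A where "\<And>x. \<bar>h x\<bar> \<le> A" using bounded_of_compactly_supported[OF h] by (metis real_norm_def)
      then show ?thesis by (intro integrable_weighted_product[OF vw borel_measurable_continuous_onI[OF h(1)] _ h(2)])
    qed
    have iG: "integrable lborel (\<lambda>x. ?G x * (u x * u x))"
      using z\<xi> z\<eta> by (intro wint u continuous_intros d\<xi> d\<eta>) auto
    have i\<eta>: "integrable lborel (\<lambda>x. \<eta> x * (u x * f x))" by (rule wint[OF d\<eta>(5) \<eta>r u f])
    have iL: "integrable lborel (\<lambda>x. ((x \<bullet> x) ^ (k - 1) * (\<xi> x)\<^sup>2) * (u x * u x))"
      using \<xi>r by (intro wint u continuous_intros d\<xi>) auto
    let ?A = "{x :: real ^ 'n. a + 1 \<le> x \<bullet> x \<and> x \<bullet> x \<le> L}"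
    let ?S = "{x :: real ^ 'n. real i \<le> x \<bullet> x}"
    have Am: "?A \<in> sets borel" and Sm: "?S \<in> sets borel" by measurable
    have "(a + 1) ^ (k - 1) * (\<integral>x. indicator ?A x * (u x)\<^sup>2 \<partial>lborel) = (\<integral>x. (a + 1) ^ (k - 1) * (indicator ?A x * (u x)\<^sup>2) \<partial>lborel)"
      by simp
    also have "\<dots> \<le> (\<integral>x. ((x \<bullet> x) ^ (k - 1) * (\<xi> x)\<^sup>2) * (u x * u x) \<partial>lborel)"
    proof (rule integral_mono[OF integrable_mult_right[OF ind_int[OF Am]] iL])
      fix x
      show "(a + 1) ^ (k - 1) * (indicator ?A x * (u x)\<^sup>2) \<le> ((x \<bullet> x) ^ (k - 1) * (\<xi> x)\<^sup>2) * (u x * u x)"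
      proof (cases "x \<in> ?A")
        case True
        then have "\<xi> x = 1" using one S(3) by (simp add: \<xi>_def)
        moreover have "(a + 1) ^ (k - 1) \<le> (x \<bullet> x) ^ (k - 1)" using True a by (intro power_mono) auto
        ultimately show ?thesis using True by (simp add: power2_eq_square mult_right_mono)
      next
        case False
        then show ?thesis by simp
      qed
    qed
    finally have "(2 * real k + 2)\<^sup>2 * ((a + 1) ^ (k - 1) * (\<integral>x. indicator ?A x * (u x)\<^sup>2 \<partial>lborel))
       \<le> (2 * real k + 2)\<^sup>2 * (\<integral>x. ((x \<bullet> x) ^ (k - 1) * (\<xi> x)\<^sup>2) * (u x * u x) \<partial>lborel)"
      by (intro mult_left_mono) auto
    also have "\<dots> \<le> 3 * ((\<integral>x. ?G x * (u x * u x) \<partial>lborel) - (\<integral>x. \<eta> x * (u x * f x) \<partial>lborel))"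
      using main first by simp
    also have "\<dots> = 3 * (\<integral>x. ?G x * (u x * u x) - \<eta> x * (u x * f x) \<partial>lborel)"
      using iG i\<eta> by simp
    also have "\<dots> \<le> 3 * (\<integral>x. (a + 1) ^ (k + 2) * K * (u x)\<^sup>2 + Q * (1 + C * (2 * S) ^ m) * (2 * S) ^ (k + 4) * (indicator ?S x * (u x)\<^sup>2) \<partial>lborel)"
    proof (intro mult_left_mono integral_mono_AE)
      show "integrable lborel (\<lambda>x. ?G x * (u x * u x) - \<eta> x * (u x * f x))" using iG i\<eta> by auto
      show "integrable lborel (\<lambda>x. (a + 1) ^ (k + 2) * K * (u x)\<^sup>2 + Q * (1 + C * (2 * S) ^ m) * (2 * S) ^ (k + 4) * (indicator ?S x * (u x)\<^sup>2))"
        using u2 ind_int[OF Sm] by auto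
      show "AE x in lborel. ?G x * (u x * u x) - \<eta> x * (u x * f x)
         \<le> (a + 1) ^ (k + 2) * K * (u x)\<^sup>2 + Q * (1 + C * (2 * S) ^ m) * (2 * S) ^ (k + 4) * (indicator ?S x * (u x)\<^sup>2)"
        using eq
      proof eventually_elim
        case (elim x)
        define s where "s = x \<bullet> x"
        have s0: "s \<ge> 0" by (simp add: s_def)
        define b where "b = cutoff_error a Q S k s"
        note b_def = b_def[unfolded cutoff_error_def]
        have b0: "b \<ge> 0" unfolding b_def using Q a S by (intro mult_nonneg_nonneg add_nonneg_nonneg) auto
        have G: "?G x \<le> b" using bd[OF s0] unfolding tr\<xi> tr\<eta> s_def[symmetric] b_def cutoff_error_def by linarith
        have \<eta>b: "0 \<le> \<eta> x" "\<eta> x \<le> b" using ebd[OF s0] unfolding \<eta>_def s_def[symmetric] b_def cutoff_error_def by auto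
        have "- (\<eta> x * (u x * f x)) = \<eta> x * (V x * (u x)\<^sup>2)"
        proof (cases "norm x > R + 1")
          case True
          then have "f x = - (V x * u x)" using elim by simp
          then show ?thesis by (simp add: power2_eq_square)
        next
          case False
          then have "\<eta> x = 0" using aR[of x] van(2) by (simp add: \<eta>_def)
          then show ?thesis by simp
        qed
        also have "\<dots> \<le> \<eta> x * (C * s ^ m * (u x)\<^sup>2)"
          using Vb(2)[of x] \<eta>b by (intro mult_left_mono mult_right_mono) (auto simp: s_def)
        finally have "?G x * (u x * u x) - \<eta> x * (u x * f x) \<le> ?G x * (u x)\<^sup>2 + \<eta> x * (C * s ^ m * (u x)\<^sup>2)"
          by (simp add: power2_eq_square)
        also have "\<dots> \<le> b * (u x)\<^sup>2 + \<eta> x * (C * s ^ m * (u x)\<^sup>2)"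
          using G by (intro add_right_mono mult_right_mono) auto
        also have "\<dots> \<le> (a + 1) ^ (k + 2) * K * (u x)\<^sup>2 + Q * (1 + C * (2 * S) ^ m) * (2 * S) ^ (k + 4) * (indicator ?S x * (u x)\<^sup>2)"
        proof -
          have nn: "0 \<le> (a + 1) ^ (k + 2) * K * (u x)\<^sup>2" "0 \<le> Q * (1 + C * (2 * S) ^ m) * (2 * S) ^ (k + 4) * (indicator ?S x * (u x)\<^sup>2)"
            unfolding K_def using Q a S Vb(1) by (auto intro!: mult_nonneg_nonneg add_nonneg_nonneg)
          consider "s \<ge> 2 * S" | "s \<le> 2 * S" "s \<ge> S" "s > a + 1" | "s < S" "s > a + 1" | "s \<le> a + 1" "s < S" | "s \<le> a + 1" "s \<ge> S"
            using S by linarith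
          then show ?thesis
          proof cases
            case 1
            then have "\<eta> x = 0" using van(2) by (simp add: \<eta>_def s_def)
            moreover have "b = Q * (2 * S) ^ (k + 4)" using 1 S a by (simp add: b_def)
            moreover have "indicator ?S x = (1::real)" using 1 S by (simp add: S_def s_def)
            moreover have "0 \<le> Q * (C * (2 * S) ^ m) * (2 * S) ^ (k + 4) * (u x)\<^sup>2" using Q Vb(1) S by simp
            ultimately show ?thesis using nn(1) by (simp add: algebra_simps)
          next
            case 2
            have b: "b = Q * (2 * S) ^ (k + 4)" using 2 by (simp add: b_def)
            have "\<eta> x * (C * s ^ m * (u x)\<^sup>2) \<le> b * (C * (2 * S) ^ m * (u x)\<^sup>2)"
              using \<eta>b b0 Vb(1) 2 s0 by (intro mult_mono mult_right_mono mult_left_mono power_mono) auto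
            moreover have "indicator ?S x = (1::real)" using 2 by (simp add: S_def s_def)
            ultimately show ?thesis using nn(1) b by (simp add: algebra_simps)
          next
            case 3
            then have "b = 0" by (simp add: b_def)
            then show ?thesis using \<eta>b nn by simp
          next
            case 4
            have b: "b = Q * (a + 1) ^ (k + 2)" using 4 by (simp add: b_def)
            have "\<eta> x * (C * s ^ m * (u x)\<^sup>2) \<le> b * (C * (a + 1) ^ m * (u x)\<^sup>2)"
              using \<eta>b b0 Vb(1) 4 s0 by (intro mult_mono mult_right_mono mult_left_mono power_mono) auto
            then show ?thesis using nn(2) b by (simp add: K_def algebra_simps)
          next
            case 5
            have b: "b = Q * (a + 1) ^ (k + 2) + Q * (2 * S) ^ (k + 4)" using 5 by (simp add: b_def distrib_left)
            have "\<eta> x * (C * s ^ m * (u x)\<^sup>2) \<le> b * (C * s ^ m * (u x)\<^sup>2)"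
              using \<eta>b Vb(1) s0 by (intro mult_right_mono) auto
            also have "\<dots> = Q * (a + 1) ^ (k + 2) * (C * s ^ m * (u x)\<^sup>2) + Q * (2 * S) ^ (k + 4) * (C * s ^ m * (u x)\<^sup>2)"
              by (simp add: b distrib_right)
            also have "\<dots> \<le> Q * (a + 1) ^ (k + 2) * (C * (a + 1) ^ m * (u x)\<^sup>2) + Q * (2 * S) ^ (k + 4) * (C * (2 * S) ^ m * (u x)\<^sup>2)"
              using Q a S Vb(1) 5 s0 by (intro add_mono mult_left_mono mult_right_mono power_mono) auto
            finally have "\<eta> x * (C * s ^ m * (u x)\<^sup>2) \<le> Q * (a + 1) ^ (k + 2) * (C * (a + 1) ^ m * (u x)\<^sup>2) + Q * (2 * S) ^ (k + 4) * (C * (2 * S) ^ m * (u x)\<^sup>2)" .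
            moreover have "indicator ?S x = (1::real)" using 5 by (simp add: S_def s_def)
            ultimately show ?thesis using b by (simp add: K_def algebra_simps)
          qed
        qed
        finally show ?case .
      qed
    qed simp
    also have "\<dots> = 3 * ((a + 1) ^ (k + 2) * K * E + Q * (1 + C * (2 * S) ^ m) * (2 * S) ^ (k + 4) * t i)"
      using u2 ind_int[OF Sm] by (simp add: E_def t_def)
    finally show ?thesis by (simp add: S_def)
  qed
  have zero: "(\<integral>x. indicator {x. a + 1 \<le> x \<bullet> x \<and> x \<bullet> x \<le> L} x * (u x)\<^sup>2 \<partial>lborel) \<le> 0" for L
  proof -
    define I where "I = (\<integral>x. indicator {x. a + 1 \<le> x \<bullet> x \<and> x \<bullet> x \<le> L} x * (u x)\<^sup>2 \<partial>lborel)"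
    have le: "(2 * real k + 2)\<^sup>2 * I \<le> 3 * ((a + 1) ^ 3 * K * E)" if k: "k \<ge> 1" for k
    proof -
      have T: "(\<lambda>i. real i ^ p * t i) \<longlonglongrightarrow> 0" for p using tail[of p] by (simp add: t_def)
      have "(\<lambda>i. Q * 2 ^ (k + 4) * (real i ^ (k + 4) * t i) + Q * C * 2 ^ (m + (k + 4)) * (real i ^ (m + (k + 4)) * t i))
         \<longlonglongrightarrow> Q * 2 ^ (k + 4) * 0 + Q * C * 2 ^ (m + (k + 4)) * 0"
        by (intro tendsto_intros T)
      moreover have "(\<lambda>i. Q * 2 ^ (k + 4) * (real i ^ (k + 4) * t i) + Q * C * 2 ^ (m + (k + 4)) * (real i ^ (m + (k + 4)) * t i))
        = (\<lambda>i. Q * (1 + C * (2 * real i) ^ m) * (2 * real i) ^ (k + 4) * t i)"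
        by (simp only: power_mult_distrib power_add distrib_left distrib_right mult_ac mult_1_left mult_1_right)
      ultimately have lim0: "(\<lambda>i. Q * (1 + C * (2 * real i) ^ m) * (2 * real i) ^ (k + 4) * t i) \<longlonglongrightarrow> 0" by simp
      have "(\<lambda>i. 3 * ((a + 1) ^ (k + 2) * K * E + Q * (1 + C * (2 * real i) ^ m) * (2 * real i) ^ (k + 4) * t i))
        \<longlonglongrightarrow> 3 * ((a + 1) ^ (k + 2) * K * E + 0)"
        by (intro tendsto_intros lim0)
      moreover have "eventually (\<lambda>i. (2 * real k + 2)\<^sup>2 * ((a + 1) ^ (k - 1) * I)
         \<le> 3 * ((a + 1) ^ (k + 2) * K * E + Q * (1 + C * (2 * real i) ^ m) * (2 * real i) ^ (k + 4) * t i)) sequentially"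
      proof -
        obtain N where N: "max (a + 1) L \<le> real N" using real_arch_simple by blast
        show ?thesis
        proof (rule eventually_sequentiallyI[of N])
          fix i assume "N \<le> i"
          then have "max (a + 1) L \<le> real i" using N by linarith
          then show "(2 * real k + 2)\<^sup>2 * ((a + 1) ^ (k - 1) * I)
            \<le> 3 * ((a + 1) ^ (k + 2) * K * E + Q * (1 + C * (2 * real i) ^ m) * (2 * real i) ^ (k + 4) * t i)"
            unfolding I_def by (intro est k) auto
        qed
      qed
      ultimately have h: "(2 * real k + 2)\<^sup>2 * ((a + 1) ^ (k - 1) * I) \<le> 3 * ((a + 1) ^ (k + 2) * K * E + 0)"
        by (rule tendsto_lowerbound) simp
      have "k + 2 = (k - 1) + 3" using k by simp
      then have pw: "(a + 1) ^ (k + 2) = (a + 1) ^ (k - 1) * (a + 1) ^ 3" by (simp only: power_add)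
      have "(a + 1) ^ (k - 1) * ((2 * real k + 2)\<^sup>2 * I) \<le> (a + 1) ^ (k - 1) * (3 * ((a + 1) ^ 3 * K * E))"
        using h unfolding pw by (simp only: mult_ac add_0_right)
      moreover have "(a + 1) ^ (k - 1) > 0" using a by simp
      ultimately show ?thesis by (rule mult_left_le_imp_le)
    qed
    show "I \<le> 0"
    proof (rule ccontr)
      assume "\<not> I \<le> 0"
      then have I: "I > 0" by simp
      obtain N :: nat where N: "3 * ((a + 1) ^ 3 * K * E) / I < real N" using reals_Archimedean2 by blast
      have "3 * ((a + 1) ^ 3 * K * E) < real N * I" using N I by (simp add: field_simps)
      also have "\<dots> \<le> (2 * real (N + 1) + 2)\<^sup>2 * I"
      proof (rule mult_right_mono)
        have "real N \<le> (2 * real (N + 1) + 2) ^ 1" by simp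
        also have "\<dots> \<le> (2 * real (N + 1) + 2)\<^sup>2" by (rule power_increasing) auto
        finally show "real N \<le> (2 * real (N + 1) + 2)\<^sup>2" .
      qed (use I in simp)
      also have "\<dots> \<le> 3 * ((a + 1) ^ 3 * K * E)" by (rule le) simp
      finally show False by simp
    qed
  qed
  have "AE x in lborel. indicator {x. a + 1 \<le> x \<bullet> x \<and> x \<bullet> x \<le> real L} x * (u x)\<^sup>2 = 0" for L :: nat
    by (rule integral_eq_0_imp_AE_on[OF ind_int _ zero]) auto
  then have "AE x in lborel. \<forall>L::nat. indicator {x. a + 1 \<le> x \<bullet> x \<and> x \<bullet> x \<le> real L} x * (u x)\<^sup>2 = 0"
    unfolding AE_all_countable by blast
  then show ?thesis
  proof eventually_elim
    case (elim x)
    obtain L :: nat where "x \<bullet> x \<le> real L" using real_arch_simple by blast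
    then show ?case using elim[rule_format, of L] by (auto simp: a_def)
  qed
qed

section \<open>Vanishing of compactly supported solutions\<close>

text \<open>Here the cut-off equals \<open>1\<close> where \<open>u\<close> lives, so that the terms with its derivatives vanish, and the potential is moved to
the right side: \<open>q = 0\<close>. Since \<open>x \<bullet> x \<le> b + 1\<close> on the support of the cut-off, the right side is a fixed multiple of the
integral on the left, which carries the factor \<open>(2 * k + 2)\<^sup>2\<close>.\<close>

lemma vanishes_of_compact_support:
  fixes u f :: "real ^ 'n \<Rightarrow> real"
  assumes u: "L2_loc_borel u" and f: "L2_loc_borel f"
    and weak: "\<And>\<phi>. test_function \<phi> \<Longrightarrow> (\<integral>x. u x * laplacian \<phi> x \<partial>lborel) = (\<integral>x. f x * \<phi> x \<partial>lborel)"
    and b: "b \<ge> 0" and supp: "AE x in lborel. x \<bullet> x \<ge> b \<longrightarrow> u x = 0"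
    and A: "A \<ge> 0" and fA: "AE x in lborel. \<bar>f x\<bar> \<le> A * \<bar>u x\<bar>"
  shows "AE x in lborel. u x = 0"
proof -
  obtain \<sigma> \<sigma>1 \<sigma>2 \<sigma>3 :: "real \<Rightarrow> real" and B where
    d1: "\<And>t. (\<sigma> has_real_derivative \<sigma>1 t) (at t)" and d2: "\<And>t. (\<sigma>1 has_real_derivative \<sigma>2 t) (at t)"
    and d3: "\<And>t. (\<sigma>2 has_real_derivative \<sigma>3 t) (at t)" and c3: "continuous_on UNIV \<sigma>3"
    and s0: "\<And>t. t \<le> 0 \<Longrightarrow> \<sigma> t = 0" and s1: "\<And>t. t \<ge> 1 \<Longrightarrow> \<sigma> t = 1"
    and sv: "\<And>t. t \<le> 0 \<or> t \<ge> 1 \<Longrightarrow> \<sigma>1 t = 0 \<and> \<sigma>2 t = 0 \<and> \<sigma>3 t = 0"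
    by (rule step_profile) blast
  \<comment> \<open>one exponent suffices: \<open>3 * (b + 1)\<^sup>2 * A\<^sup>2\<close> is the multiple on the right side\<close>
  obtain k :: nat where k: "3 * (b + 1)\<^sup>2 * A\<^sup>2 < real k" using reals_Archimedean2 by blast
  define \<beta> where "\<beta> = (b + 1) ^ (k + 2)"
  have \<beta>: "\<beta> \<ge> 0" using b by (simp add: \<beta>_def)
  have sh: "((\<lambda>s. h (s - b)) has_real_derivative h' (s - b)) (at s)" if "\<And>t. (h has_real_derivative h' t) (at t)" for h h' :: "real \<Rightarrow> real" and s
  proof -
    have "((\<lambda>s. h (s - b)) has_real_derivative h' (s - b) * 1) (at s)"
      by (rule DERIV_chain2[OF that]) (auto intro!: derivative_eq_intros)
    then show ?thesis by simp
  qed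
  have cD: "continuous_on UNIV h" if "\<And>s. (h has_real_derivative h' s) (at s)" for h h' :: "real \<Rightarrow> real"
    using that by (meson DERIV_isCont continuous_at_imp_continuous_on)
  define A1 A2 A3 where "A1 s = \<sigma>1 (s - b)" and "A2 s = \<sigma>2 (s - b)" and "A3 s = \<sigma>3 (s - b)" for s
  have dA1: "(A1 has_real_derivative A2 s) (at s)" for s unfolding A1_def A2_def by (rule sh[OF d2])
  have dA2: "(A2 has_real_derivative A3 s) (at s)" for s unfolding A2_def A3_def by (rule sh[OF d3])
  have cA3: "continuous_on UNIV A3"
    unfolding A3_def[abs_def] by (rule continuous_on_compose2[OF c3 _ subset_UNIV]) (intro continuous_intros)
  have lo: "A1 s = 0" "A2 s = 0" "A3 s = 0" if "s \<le> b" for s using sv[of "s - b"] that by (auto simp: A1_def A2_def A3_def)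
  have hi: "A1 s = 0" if "s \<ge> b + 1" for s using sv[of "s - b"] that by (auto simp: A1_def)
  define p where "p s = 1 - \<sigma> (s - b)" for s
  define e e' e'' where "e s = 16 * s * (\<beta> * (A1 s * A1 s))"
    and "e' s = 16 * (\<beta> * (A1 s * A1 s)) + (\<beta> * (A2 s * A1 s + A2 s * A1 s)) * (16 * s)"
    and "e'' s = 16 * (\<beta> * (A2 s * A1 s + A2 s * A1 s))
      + ((\<beta> * ((A3 s * A1 s + A2 s * A2 s) + (A3 s * A1 s + A2 s * A2 s))) * (16 * s) + 16 * (\<beta> * (A2 s * A1 s + A2 s * A1 s)))" for s
  have i16: "((\<lambda>s. 16 * s) has_real_derivative 16) (at s)" for s :: real
    by (auto intro!: derivative_eq_intros)
  have dp: "(p has_real_derivative - A1 s) (at s)" for s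
    unfolding p_def A1_def using DERIV_diff[OF DERIV_const sh[OF d1]] by simp
  have dp': "((\<lambda>s. - A1 s) has_real_derivative - A2 s) (at s)" for s by (intro DERIV_minus dA1)
  have cp: "continuous_on UNIV (\<lambda>s. - A2 s)" by (intro continuous_intros cD[OF dA2])
  have de: "(e has_real_derivative e' s) (at s)" for s
    unfolding e_def e'_def by (intro DERIV_mult DERIV_cmult dA1 i16)
  have de': "(e' has_real_derivative e'' s) (at s)" for s
    unfolding e'_def e''_def by (intro DERIV_add DERIV_mult DERIV_cmult dA1 dA2 i16)
  have ce: "continuous_on UNIV e''"
    unfolding e''_def[abs_def] by (intro continuous_intros cD[OF dA1] cD[OF dA2] cA3)
  define \<xi> \<eta> where "\<xi> x = p (x \<bullet> x)" and "\<eta> x = e (x \<bullet> x)" for x :: "real ^ 'n"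
  define g\<xi> where "g\<xi> x = (2 * (- A1 (x \<bullet> x))) *\<^sub>R x" for x :: "real ^ 'n"
  define H\<xi> where "H\<xi> x h = (2 * (- A1 (x \<bullet> x))) *\<^sub>R h + (2 * ((- A2 (x \<bullet> x)) * (2 * (x \<bullet> h)))) *\<^sub>R x" for x h :: "real ^ 'n"
  define g\<eta> where "g\<eta> x = (2 * e' (x \<bullet> x)) *\<^sub>R x" for x :: "real ^ 'n"
  define H\<eta> where "H\<eta> x h = (2 * e' (x \<bullet> x)) *\<^sub>R h + (2 * (e'' (x \<bullet> x) * (2 * (x \<bullet> h)))) *\<^sub>R x" for x h :: "real ^ 'n"
  have C\<xi>: "C2_with \<xi> g\<xi> H\<xi>"
    unfolding \<xi>_def[abs_def] g\<xi>_def[abs_def] H\<xi>_def[abs_def] by (rule C2_with_radial[OF dp dp' cp])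
  have C\<eta>: "C2_with \<eta> g\<eta> H\<eta>" unfolding \<eta>_def[abs_def] g\<eta>_def[abs_def] H\<eta>_def[abs_def] by (rule C2_with_radial[OF de de' ce])
  have tr\<xi>: "lintrace (H\<xi> x) = 0" and tr\<eta>: "lintrace (H\<eta> x) = 0" and \<eta>0: "\<eta> x = 0" if "x \<bullet> x \<le> b" for x
    using lo[OF that] by (simp_all add: H\<xi>_def H\<eta>_def e'_def e''_def \<eta>_def e_def lintrace_def)
  define r where "r = sqrt (b + 1)"
  have rS: "x \<bullet> x \<ge> b + 1" if "norm x > r" for x :: "real ^ 'n"
  proof -
    have "r\<^sup>2 \<le> (norm x)\<^sup>2" using that b by (intro power_mono) (auto simp: r_def)
    then show ?thesis using b by (simp add: r_def power2_norm_eq_inner)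
  qed
  have p_hi: "p s = 0" if "s \<ge> b + 1" for s using s1[of "s - b"] that by (simp add: p_def)
  have \<xi>r: "\<xi> x = 0" and \<eta>r: "\<eta> x = 0" if "norm x > r" for x
    using p_hi rS[OF that] hi[OF rS[OF that]] by (auto simp: \<xi>_def \<eta>_def e_def)
  let ?G = "\<lambda>x. (x \<bullet> x) ^ (k + 2) * (lintrace (H\<xi> x))\<^sup>2 + lintrace (H\<eta> x) / 2"
  have main: "(2 * real k + 2)\<^sup>2 * (\<integral>x. ((x \<bullet> x) ^ (k + 1) * (\<xi> x)\<^sup>2) * (u x * u x) \<partial>lborel)
    \<le> 3 * (b + 1) * ((\<integral>x. ((x \<bullet> x) ^ (k + 2) * (\<xi> x)\<^sup>2) * ((f x + 0 * u x) * (f x + 0 * u x)) \<partial>lborel)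
       + (\<integral>x. ?G x * (u x * u x) \<partial>lborel) - (\<integral>x. \<eta> x * (u x * f x) \<partial>lborel))"
  proof (rule weak_cutoff_inequality[OF u f weak C\<xi> C\<eta> \<xi>r \<eta>r _ disjI1[OF refl]])
    show "(x \<bullet> x) ^ (k + 2) * (4 * (g\<xi> x \<bullet> g\<xi> x)) \<le> \<eta> x" for x
    proof (cases "x \<bullet> x \<le> b + 1")
      case True
      then have "(x \<bullet> x) ^ (k + 2) * (16 * (x \<bullet> x) * (A1 (x \<bullet> x) * A1 (x \<bullet> x))) \<le> \<beta> * (16 * (x \<bullet> x) * (A1 (x \<bullet> x) * A1 (x \<bullet> x)))"
        unfolding \<beta>_def by (intro mult_right_mono power_mono) auto
      then show ?thesis by (simp add: g\<xi>_def \<eta>_def e_def mult_ac)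
    next
      case False
      then show ?thesis using hi[of "x \<bullet> x"] by (simp add: g\<xi>_def \<eta>_def e_def)
    qed
    show "(x \<bullet> x) ^ (k + 1) \<le> (b + 1) * (x \<bullet> x) ^ k" if "\<xi> x \<noteq> 0 \<or> g\<xi> x \<noteq> 0" for x
    proof -
      have "x \<bullet> x \<le> b + 1"
      proof (rule ccontr)
        assume "\<not> ?thesis"
        then show False using that hi[of "x \<bullet> x"] p_hi[of "x \<bullet> x"] by (simp add: \<xi>_def g\<xi>_def)
      qed
      then show ?thesis by (simp add: mult_right_mono)
    qed
  qed (use b in auto)
  have "AE x in lborel. ?G x * (u x * u x) = 0"
    using supp
  proof eventually_elim
    case (elim x)
    then show ?case using tr\<xi>[of x] tr\<eta>[of x] by (cases "x \<bullet> x \<le> b") auto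
  qed
  then have z1: "(\<integral>x. ?G x * (u x * u x) \<partial>lborel) = 0" by (rule integral_eq_zero_AE)
  have "AE x in lborel. \<eta> x * (u x * f x) = 0"
    using supp
  proof eventually_elim
    case (elim x)
    then show ?case using \<eta>0[of x] by (cases "x \<bullet> x \<le> b") auto
  qed
  then have z2: "(\<integral>x. \<eta> x * (u x * f x) \<partial>lborel) = 0" by (rule integral_eq_zero_AE)
  note d\<xi> = C2_withD[OF C\<xi>]
  have wint: "integrable lborel (\<lambda>x. h x * (v x * v x))"
    if h: "continuous_on UNIV h" "\<And>x. norm x > r \<Longrightarrow> h x = 0" and v: "L2_loc_borel v" for h v :: "real ^ 'n \<Rightarrow> real"
  proof -
    obtain A where "\<And>x. \<bar>h x\<bar> \<le> A" using bounded_of_compactly_supported[OF h] by (metis real_norm_def)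
    then show ?thesis by (intro integrable_weighted_product[OF v v borel_measurable_continuous_onI[OF h(1)] _ h(2)])
  qed
  define I where "I = (\<integral>x. ((x \<bullet> x) ^ (k + 1) * (\<xi> x)\<^sup>2) * (u x * u x) \<partial>lborel)"
  have iu: "integrable lborel (\<lambda>x. ((x \<bullet> x) ^ (k + 1) * (\<xi> x)\<^sup>2) * (u x * u x))"
    using \<xi>r by (intro wint u continuous_intros d\<xi>) auto
  have if': "integrable lborel (\<lambda>x. ((x \<bullet> x) ^ (k + 2) * (\<xi> x)\<^sup>2) * (f x * f x))"
    using \<xi>r by (intro wint f continuous_intros d\<xi>) auto
  have "(\<integral>x. ((x \<bullet> x) ^ (k + 2) * (\<xi> x)\<^sup>2) * (f x * f x) \<partial>lborel)
     \<le> (\<integral>x. (b + 1) * A\<^sup>2 * (((x \<bullet> x) ^ (k + 1) * (\<xi> x)\<^sup>2) * (u x * u x)) \<partial>lborel)"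
  proof (rule integral_mono_AE[OF if'])
    show "integrable lborel (\<lambda>x. (b + 1) * A\<^sup>2 * (((x \<bullet> x) ^ (k + 1) * (\<xi> x)\<^sup>2) * (u x * u x)))" using iu by auto
    show "AE x in lborel. ((x \<bullet> x) ^ (k + 2) * (\<xi> x)\<^sup>2) * (f x * f x) \<le> (b + 1) * A\<^sup>2 * (((x \<bullet> x) ^ (k + 1) * (\<xi> x)\<^sup>2) * (u x * u x))"
      using fA
    proof eventually_elim
      case (elim x)
      show ?case
      proof (cases "x \<bullet> x \<le> b + 1")
        case True
        have ff: "f x * f x \<le> A\<^sup>2 * (u x * u x)"
        proof -
          have "(f x)\<^sup>2 \<le> A\<^sup>2 * (u x)\<^sup>2" using power_mono[OF elim, of 2] by (simp add: power_mult_distrib)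
          then show ?thesis by (simp only: power2_eq_square[of "f x"] power2_eq_square[of "u x"])
        qed
        have "((x \<bullet> x) * ((x \<bullet> x) ^ (k + 1) * (\<xi> x)\<^sup>2)) * (f x * f x) \<le> ((b + 1) * ((x \<bullet> x) ^ (k + 1) * (\<xi> x)\<^sup>2)) * (A\<^sup>2 * (u x * u x))"
          by (rule mult_mono[OF mult_right_mono[OF True] ff]) (use b in auto)
        then show ?thesis by (simp add: mult_ac)
      next
        case False
        then show ?thesis using p_hi[of "x \<bullet> x"] by (simp add: \<xi>_def)
      qed
    qed
  qed
  also have "\<dots> = (b + 1) * A\<^sup>2 * I" by (simp add: I_def)
  finally have fI: "(\<integral>x. ((x \<bullet> x) ^ (k + 2) * (\<xi> x)\<^sup>2) * (f x * f x) \<partial>lborel) \<le> (b + 1) * A\<^sup>2 * I" .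
  have "(2 * real k + 2)\<^sup>2 * I \<le> 3 * (b + 1) * (\<integral>x. ((x \<bullet> x) ^ (k + 2) * (\<xi> x)\<^sup>2) * (f x * f x) \<partial>lborel)"
    using main unfolding z1 z2 I_def by simp
  also have "\<dots> \<le> 3 * (b + 1) * ((b + 1) * A\<^sup>2 * I)" using fI b by (intro mult_left_mono) auto
  finally have "(2 * real k + 2)\<^sup>2 * I \<le> (3 * (b + 1)\<^sup>2 * A\<^sup>2) * I" by (simp add: power2_eq_square mult_ac)
  moreover have "3 * (b + 1)\<^sup>2 * A\<^sup>2 < (2 * real k + 2)\<^sup>2"
  proof -
    have "real k \<le> (2 * real k + 2) ^ 1" by simp
    also have "\<dots> \<le> (2 * real k + 2)\<^sup>2" by (rule power_increasing) auto
    finally show ?thesis using k by linarith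
  qed
  ultimately have I0: "I \<le> 0" by (meson linorder_not_le mult_strict_right_mono)
  have "AE x in lborel. ((x \<bullet> x) ^ (k + 1) * (\<xi> x)\<^sup>2) * (u x * u x) = 0"
  proof -
    have "I = 0" using I0 integral_nonneg_AE[of "\<lambda>x. ((x \<bullet> x) ^ (k + 1) * (\<xi> x)\<^sup>2) * (u x * u x)" lborel] unfolding I_def by (intro antisym) auto
    then show ?thesis using integral_nonneg_eq_0_iff_AE[OF iu] unfolding I_def by auto
  qed
  then show ?thesis
    using supp AE_lborel_singleton[of 0]
  proof eventually_elim
    case (elim x)
    show ?case
    proof (cases "x \<bullet> x \<ge> b")
      case False
      then have "\<xi> x = 1" using s0[of "x \<bullet> x - b"] by (simp add: \<xi>_def p_def)
      then show ?thesis using elim by simp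
    qed (use elim in simp)
  qed
qed

lemma smooth_continuous:
  assumes "smooth \<phi>"
  shows "continuous_on UNIV \<phi>" "continuous_on UNIV (laplacian \<phi>)"
proof -
  have d: "foldr partial_deriv is \<phi> differentiable (at x)" for "is" x
    using assms by (simp add: smooth_def)
  have c: "continuous_on UNIV (foldr partial_deriv is \<phi>)" for "is"
    using d by (meson continuous_at_imp_continuous_on differentiable_imp_continuous_within)
  show "continuous_on UNIV \<phi>" using c[of "[]"] by simp
  have "continuous_on UNIV (partial_deriv i (partial_deriv i \<phi>))" for i using c[of "[i, i]"] by simp
  then show "continuous_on UNIV (laplacian \<phi>)"
    unfolding laplacian_def[abs_def] by (intro continuous_intros)
qed

text \<open>The essential bounds on the balls of integer radius are turned into bounds everywhere by setting the function to \<open>0\<close> where it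
violates them.\<close>

lemma Linf_loc_borel_representative:
  fixes V :: "real ^ 'n \<Rightarrow> real"
  assumes "Linf_loc V"
  obtains W where "W \<in> borel_measurable borel" "AE x in lborel. V x = W x"
    "\<And>r. \<exists>A. \<forall>x. norm x \<le> r \<longrightarrow> \<bar>W x\<bar> \<le> A"
proof -
  obtain V0 where V0[measurable]: "V0 \<in> borel_measurable borel" and V0e: "AE x in lborel. V x = V0 x"
    using completion_ex_borel_measurable_real[of V lborel] assms by (auto simp: Linf_loc_def)
  have "\<exists>B. AE x in lborel. x \<in> cball 0 (real n) \<longrightarrow> \<bar>V x\<bar> \<le> B" for n
    using assms compact_cball unfolding Linf_loc_def AE_completion_iff by blast
  then obtain B where B: "\<And>n. AE x in lborel. x \<in> cball 0 (real n) \<longrightarrow> \<bar>V x\<bar> \<le> B n" by metis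
  define N where "N x = nat \<lceil>norm x\<rceil>" for x :: "real ^ 'n"
  define W where "W x = (if \<bar>V0 x\<bar> \<le> B (N x) then V0 x else 0)" for x
  have Nm[measurable]: "N \<in> borel \<rightarrow>\<^sub>M count_space UNIV" unfolding N_def[abs_def] by measurable
  have BNm[measurable]: "(\<lambda>x. B (N x)) \<in> borel_measurable borel"
    by (rule measurable_compose[OF Nm]) simp
  have normN: "norm x \<le> real (N x)" for x unfolding N_def by linarith
  show ?thesis
  proof (rule that[of W])
    show "W \<in> borel_measurable borel" unfolding W_def[abs_def] by measurable
    have "AE x in lborel. \<forall>n. x \<in> cball 0 (real n) \<longrightarrow> \<bar>V x\<bar> \<le> B n" using B by (simp add: AE_all_countable)
    then show "AE x in lborel. V x = W x"
      using V0e
    proof eventually_elim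
      case (elim x)
      then have "\<bar>V x\<bar> \<le> B (N x)" using normN[of x] by auto
      then show ?case using elim by (simp add: W_def)
    qed
    fix r
    show "\<exists>A. \<forall>x. norm x \<le> r \<longrightarrow> \<bar>W x\<bar> \<le> A"
    proof (intro exI allI impI)
      fix x :: "real ^ 'n" assume "norm x \<le> r"
      then have "N x \<le> nat \<lceil>r\<rceil>" unfolding N_def by (intro nat_mono ceiling_mono)
      then have "\<bar>B (N x)\<bar> \<le> (\<Sum>i\<in>{..nat \<lceil>r\<rceil>}. \<bar>B i\<bar>)" by (intro member_le_sum) auto
      then show "\<bar>W x\<bar> \<le> (\<Sum>i\<in>{..nat \<lceil>r\<rceil>}. \<bar>B i\<bar>)" by (auto simp: W_def)
    qed
  qed
qed

lemma L2_loc_borel_representative: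
  fixes u :: "real ^ 'n \<Rightarrow> real"
  assumes "L2_loc u"
  obtains w where "L2_loc_borel w" "AE x in lborel. u x = w x"
proof -
  have um: "u \<in> borel_measurable lebesgue" using assms by (simp add: L2_loc_def)
  obtain w where w[measurable]: "w \<in> borel_measurable borel" and we: "AE x in lborel. u x = w x"
    using completion_ex_borel_measurable_real[OF um] by auto
  have "integrable lborel (\<lambda>y. indicator (cball 0 r) y * (w y)\<^sup>2)" for r
  proof -
    have "integrable lebesgue (\<lambda>y. indicator (cball 0 r) y * (u y)\<^sup>2)"
      using assms unfolding L2_loc_def set_integrable_def by simp
    moreover have "AE y in lebesgue. indicator (cball 0 r) y * (u y)\<^sup>2 = indicator (cball 0 r) y * (w y)\<^sup>2"
      using AE_completion[OF we] by eventually_elim simp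
    moreover have m: "(\<lambda>y. indicator (cball 0 r) y * (w y)\<^sup>2) \<in> borel_measurable lborel"
      by (intro borel_measurable_times borel_measurable_indicator) auto
    ultimately have "integrable lebesgue (\<lambda>y. indicator (cball 0 r) y * (w y)\<^sup>2)"
      by (subst integrable_cong_AE[symmetric]) (auto intro: measurable_completion)
    then show ?thesis using integrable_completion[OF m] by simp
  qed
  then have "L2_loc_borel w" by (simp add: L2_loc_borel_def)
  then show ?thesis using we by (rule that)
qed

section \<open>The uniqueness theorem\<close>

lemma square_integrable_of_tail:
  fixes w :: "'a::euclidean_space \<Rightarrow> real"
  assumes w: "L2_loc_borel w"
    and tail: "((\<lambda>r. ennreal (r powr 0) * (\<integral>\<^sup>+x\<in>{x. norm x > r}. ennreal ((w x)\<^sup>2) \<partial>lborel)) \<longlongrightarrow> 0) at_top"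
  shows "integrable lborel (\<lambda>x. (w x)\<^sup>2)"
proof (rule integrableI_nonneg)
  have [measurable]: "w \<in> borel_measurable borel" by (rule L2_loc_borelD(1)[OF w])
  show "(\<lambda>x. (w x)\<^sup>2) \<in> borel_measurable lborel" by simp
  have "eventually (\<lambda>r. ennreal (r powr 0) * (\<integral>\<^sup>+x\<in>{x. norm x > r}. ennreal ((w x)\<^sup>2) \<partial>lborel) < 1) at_top"
    using tail by (rule order_tendstoD) simp
  then obtain r where r: "r > 0" "ennreal (r powr 0) * (\<integral>\<^sup>+x\<in>{x. norm x > r}. ennreal ((w x)\<^sup>2) \<partial>lborel) < 1"
    using eventually_gt_at_top[of 0] eventually_happens[OF eventually_conj] by (metis (no_types, lifting) trivial_limit_at_top_linorder)
  have "(\<integral>\<^sup>+x. ennreal ((w x)\<^sup>2) \<partial>lborel)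
     = (\<integral>\<^sup>+x. ennreal (indicator (cball 0 r) x * (w x)\<^sup>2) + ennreal ((w x)\<^sup>2) * indicator {x. norm x > r} x \<partial>lborel)"
    by (intro nn_integral_cong) (auto simp: indicator_def)
  also have "\<dots> = (\<integral>\<^sup>+x. ennreal (indicator (cball 0 r) x * (w x)\<^sup>2) \<partial>lborel) + (\<integral>\<^sup>+x. ennreal ((w x)\<^sup>2) * indicator {x. norm x > r} x \<partial>lborel)"
  proof (rule nn_integral_add)
    show "(\<lambda>x. ennreal (indicator (cball 0 r) x * (w x)\<^sup>2)) \<in> borel_measurable lborel"
      using borel_measurable_integrable[OF L2_loc_borelD(2)[OF w, of r]] by simp
  qed measurable
  also have "\<dots> < \<infinity>"
  proof -
    have "(\<integral>\<^sup>+x. ennreal (indicator (cball 0 r) x * (w x)\<^sup>2) \<partial>lborel) = ennreal (\<integral>x. indicator (cball 0 r) x * (w x)\<^sup>2 \<partial>lborel)"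
      by (rule nn_integral_eq_integral[OF L2_loc_borelD(2)[OF w]]) simp
    moreover have "(\<integral>\<^sup>+x. ennreal ((w x)\<^sup>2) * indicator {x. norm x > r} x \<partial>lborel) < 1" using r by simp
    ultimately show ?thesis by (auto simp: less_top[symmetric] top_unique)
  qed
  finally show "(\<integral>\<^sup>+x. ennreal ((w x)\<^sup>2) \<partial>lborel) < \<infinity>" .
qed simp

text \<open>The radius \<open>sqrt (real i) / 2\<close> is used because the decay is given on the open set \<open>norm x > r\<close>, and the region here is closed.\<close>

lemma tail_power_decay:
  fixes w :: "'a::euclidean_space \<Rightarrow> real"
  assumes [measurable]: "w \<in> borel_measurable borel" and w2: "integrable lborel (\<lambda>x. (w x)\<^sup>2)"
    and tail: "\<And>m::real. m \<ge> 0 \<Longrightarrow>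
      ((\<lambda>r. ennreal (r powr m) * (\<integral>\<^sup>+x\<in>{x. norm x > r}. ennreal ((w x)\<^sup>2) \<partial>lborel)) \<longlongrightarrow> 0) at_top"
  shows "(\<lambda>i. real i ^ p * (\<integral>x. indicator {x. real i \<le> x \<bullet> x} x * (w x)\<^sup>2 \<partial>lborel)) \<longlonglongrightarrow> 0"
proof -
  define T where "T r = (\<integral>\<^sup>+x\<in>{x. norm x > r}. ennreal ((w x)\<^sup>2) \<partial>lborel)" for r
  define t where "t i = (\<integral>x. indicator {x. real i \<le> x \<bullet> x} x * (w x)\<^sup>2 \<partial>lborel)" for i
  define \<rho> where "\<rho> i = sqrt (real i) / 2" for i
  have sm: "{x :: 'a. real i \<le> x \<bullet> x} \<in> sets borel" for i by measurable
  have int: "integrable lborel (\<lambda>x. indicator {x. real i \<le> x \<bullet> x} x * (w x)\<^sup>2)" for i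
  proof (rule Bochner_Integration.integrable_bound[OF w2])
    show "(\<lambda>x. indicator {x. real i \<le> x \<bullet> x} x * (w x)\<^sup>2) \<in> borel_measurable lborel"
      using sm by (intro borel_measurable_times borel_measurable_indicator) auto
  qed (auto simp: indicator_def)
  have t0: "t i \<ge> 0" for i unfolding t_def by (intro integral_nonneg_AE) auto
  have le: "ennreal (real i ^ p * t i) \<le> ennreal (4 ^ p) * (ennreal (\<rho> i powr (2 * real p)) * T (\<rho> i))" if i: "i \<ge> 1" for i
  proof -
    have "ennreal (t i) = (\<integral>\<^sup>+x. ennreal (indicator {x. real i \<le> x \<bullet> x} x * (w x)\<^sup>2) \<partial>lborel)"
      unfolding t_def by (rule nn_integral_eq_integral[symmetric, OF int]) simp
    also have "\<dots> \<le> T (\<rho> i)"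
      unfolding T_def
    proof (rule nn_integral_mono)
      fix x :: 'a
      have "norm x > \<rho> i" if "real i \<le> x \<bullet> x"
      proof -
        have "sqrt (real i) \<le> norm x" using real_sqrt_le_mono[OF that] by (simp add: norm_eq_sqrt_inner)
        moreover have "sqrt (real i) > 0" using i by simp
        ultimately show ?thesis unfolding \<rho>_def by linarith
      qed
      then show "ennreal (indicator {x. real i \<le> x \<bullet> x} x * (w x)\<^sup>2) \<le> ennreal ((w x)\<^sup>2) * indicator {x. norm x > \<rho> i} x"
        by (auto simp: indicator_def)
    qed
    finally have tT: "ennreal (t i) \<le> T (\<rho> i)" .
    have "real i ^ p = 4 ^ p * \<rho> i powr (2 * real p)"
    proof -
      have r: "\<rho> i > 0" using i by (simp add: \<rho>_def)
      have "\<rho> i powr (2 * real p) = \<rho> i ^ (2 * p)" using powr_realpow[OF r, of "2 * p"] by simp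
      also have "\<dots> = (real i / 4) ^ p" by (simp add: power_mult \<rho>_def power_divide)
      finally show ?thesis by (simp add: power_divide)
    qed
    then have "ennreal (real i ^ p * t i) = ennreal (4 ^ p) * (ennreal (\<rho> i powr (2 * real p)) * ennreal (t i))"
      using t0[of i] by (simp add: ennreal_mult[symmetric] mult.assoc)
    also have "\<dots> \<le> ennreal (4 ^ p) * (ennreal (\<rho> i powr (2 * real p)) * T (\<rho> i))"
      using tT by (intro mult_left_mono) auto
    finally show ?thesis .
  qed
  have \<rho>: "filterlim \<rho> at_top sequentially"
  proof -
    have "filterlim (\<lambda>i. (1 / 2) * sqrt (real i)) at_top sequentially"
      by (rule filterlim_tendsto_pos_mult_at_top[OF tendsto_const])
         (auto intro: filterlim_compose[OF sqrt_at_top filterlim_real_sequentially])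
    then show ?thesis by (simp add: \<rho>_def[abs_def])
  qed
  have "((\<lambda>i. ennreal (\<rho> i powr (2 * real p)) * T (\<rho> i)) \<longlongrightarrow> 0) sequentially"
    using filterlim_compose[OF tail[of "2 * real p"] \<rho>] by (simp add: T_def)
  then have "((\<lambda>i. ennreal (4 ^ p) * (ennreal (\<rho> i powr (2 * real p)) * T (\<rho> i))) \<longlongrightarrow> ennreal (4 ^ p) * 0) sequentially"
    by (intro ennreal_tendsto_cmult) auto
  then have up: "((\<lambda>i. ennreal (4 ^ p) * (ennreal (\<rho> i powr (2 * real p)) * T (\<rho> i))) \<longlongrightarrow> 0) sequentially"
    by simp
  have "((\<lambda>i. ennreal (real i ^ p * t i)) \<longlongrightarrow> 0) sequentially"
  proof (rule tendsto_sandwich[OF _ _ tendsto_const up])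
    show "eventually (\<lambda>i. ennreal (real i ^ p * t i) \<le> ennreal (4 ^ p) * (ennreal (\<rho> i powr (2 * real p)) * T (\<rho> i))) sequentially"
      by (rule eventually_sequentiallyI[of 1]) (rule le)
  qed simp
  then have "((\<lambda>i. real i ^ p * t i) \<longlongrightarrow> 0) sequentially"
    using tendsto_ennrealD[of "\<lambda>i. real i ^ p * t i" 0 sequentially] t0 by simp
  then show ?thesis by (simp add: t_def)
qed

theorem theorem1p1:
  fixes V u :: "real ^ 'n \<Rightarrow> real" and R C M :: real
  assumes "CARD('n) \<ge> 2"
    and "Linf_loc V"
    and "R > 1" and "C > 0"
    and "locally_lipschitz_on {x. norm x > R} V"
    and "\<And>x. norm x > R \<Longrightarrow> \<bar>V x\<bar> \<le> C * norm x powr M"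
    and "AE x in lebesgue. norm x > R \<longrightarrow>
           (\<forall>D. has_radial_deriv_r2V V (norm x) (x /\<^sub>R norm x) D \<longrightarrow> D \<ge> 0)"
    and "L2_loc u"
    and "weak_solution V u"
    and "\<And>m::real. m \<ge> 0 \<Longrightarrow>
           ((\<lambda>r. ennreal (r powr m) * (\<integral>\<^sup>+x\<in>{x. norm x > r}. ennreal (\<bar>u x\<bar>\<^sup>2) \<partial>lebesgue))
              \<longlongrightarrow> 0) at_top"
  shows "AE x in lebesgue. u x = 0"
proof -
  obtain W where Wm: "W \<in> borel_measurable borel" and We: "AE x in lborel. V x = W x"
    and Wb: "\<And>r. \<exists>A. \<forall>x. norm x \<le> r \<longrightarrow> \<bar>W x\<bar> \<le> A"
    using Linf_loc_borel_representative[OF assms(2)] by blast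
  obtain w where w: "L2_loc_borel w" and we: "AE x in lborel. u x = w x"
    using L2_loc_borel_representative[OF assms(8)] by blast
  note wm = L2_loc_borelD(1)[OF w]
  note [measurable] = Wm wm
  define f where "f x = - W x * w x" for x
  have fm[measurable]: "f \<in> borel_measurable borel" unfolding f_def[abs_def] by measurable
  have f: "L2_loc_borel f"
    unfolding f_def[abs_def] by (rule L2_loc_borel_mult_bounded[OF w]) (use Wb in auto)
  have weak: "(\<integral>x. w x * laplacian \<phi> x \<partial>lborel) = (\<integral>x. f x * \<phi> x \<partial>lborel)" if \<phi>: "test_function \<phi>" for \<phi>
  proof -
    have sm: "smooth \<phi>" using \<phi> by (simp add: test_function_def)
    note [measurable] = borel_measurable_continuous_onI[OF smooth_continuous(1)[OF sm]]
      borel_measurable_continuous_onI[OF smooth_continuous(2)[OF sm]]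
    have um: "u \<in> borel_measurable lebesgue" and Vm: "V \<in> borel_measurable lebesgue"
      using assms(2,8) by (auto simp: L2_loc_def Linf_loc_def)
    have pm: "\<phi> \<in> borel_measurable lebesgue" and lm: "laplacian \<phi> \<in> borel_measurable lebesgue"
      by (rule measurable_completion, simp)+
    have "(\<integral>x. u x * (- laplacian \<phi> x) \<partial>lebesgue) = (\<integral>x. w x * (- laplacian \<phi> x) \<partial>lebesgue)"
    proof (rule integral_cong_AE)
      show "(\<lambda>x. u x * (- laplacian \<phi> x)) \<in> borel_measurable lebesgue" using um lm by simp
      show "(\<lambda>x. w x * (- laplacian \<phi> x)) \<in> borel_measurable lebesgue" by (rule measurable_completion) simp
      show "AE x in lebesgue. u x * (- laplacian \<phi> x) = w x * (- laplacian \<phi> x)"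
        using AE_completion[OF we] by eventually_elim simp
    qed
    also have "\<dots> = (\<integral>x. w x * (- laplacian \<phi> x) \<partial>lborel)" by (rule integral_completion) simp
    finally have 1: "(\<integral>x. u x * (- laplacian \<phi> x) \<partial>lebesgue) = - (\<integral>x. w x * laplacian \<phi> x \<partial>lborel)" by simp
    have "(\<integral>x. (V x * u x) * \<phi> x \<partial>lebesgue) = (\<integral>x. (W x * w x) * \<phi> x \<partial>lebesgue)"
    proof (rule integral_cong_AE)
      show "(\<lambda>x. (V x * u x) * \<phi> x) \<in> borel_measurable lebesgue" using um Vm pm by simp
      show "(\<lambda>x. (W x * w x) * \<phi> x) \<in> borel_measurable lebesgue" by (rule measurable_completion) simp
      show "AE x in lebesgue. (V x * u x) * \<phi> x = (W x * w x) * \<phi> x"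
        using AE_completion[OF we] AE_completion[OF We] by eventually_elim simp
    qed
    also have "\<dots> = (\<integral>x. (W x * w x) * \<phi> x \<partial>lborel)" by (rule integral_completion) simp
    also have "\<dots> = - (\<integral>x. f x * \<phi> x \<partial>lborel)" by (simp add: f_def)
    finally have 2: "(\<integral>x. (V x * u x) * \<phi> x \<partial>lebesgue) = - (\<integral>x. f x * \<phi> x \<partial>lborel)" .
    have "(\<integral>x. u x * (- laplacian \<phi> x) \<partial>lebesgue) = (\<integral>x. (V x * u x) * \<phi> x \<partial>lebesgue)"
      using assms(9) \<phi> unfolding weak_solution_def by blast
    then show ?thesis using 1 2 by linarith
  qed
  have tail: "((\<lambda>r. ennreal (r powr m) * (\<integral>\<^sup>+x\<in>{x. norm x > r}. ennreal ((w x)\<^sup>2) \<partial>lborel)) \<longlongrightarrow> 0) at_top"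
    if "m \<ge> 0" for m :: real
  proof -
    have "(\<integral>\<^sup>+x\<in>{x. norm x > r}. ennreal (\<bar>u x\<bar>\<^sup>2) \<partial>lebesgue) = (\<integral>\<^sup>+x\<in>{x. norm x > r}. ennreal ((w x)\<^sup>2) \<partial>lborel)" for r
      unfolding nn_integral_completion
      by (rule nn_integral_cong_AE) (use we in eventually_elim, simp)
    then show ?thesis using assms(10)[OF that] by simp
  qed
  have w2: "integrable lborel (\<lambda>x. (w x)\<^sup>2)"
    by (rule square_integrable_of_tail[OF w tail]) simp
  define \<Omega> where "\<Omega> = {x :: real ^ 'n. norm x > R}"
  define q where "q x = indicator \<Omega> x *\<^sub>R V x" for x
  have \<Omega>_open: "open \<Omega>" unfolding \<Omega>_def by (intro open_Collect_less continuous_intros)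
  have "continuous_on \<Omega> V"
    using local_lipschitz_continuous_on[OF assms(5)[unfolded locally_lipschitz_on_iff_local_lipschitz], of 0]
    by (simp add: \<Omega>_def)
  then have qm: "q \<in> borel_measurable borel"
    unfolding q_def[abs_def] using \<Omega>_open by (intro borel_measurable_continuous_on_indicator) auto
  define m where "m = nat \<lceil>\<bar>M\<bar>\<rceil>"
  have qb: "\<bar>q x\<bar> \<le> C * (x \<bullet> x) ^ m" for x
  proof (cases "norm x > R")
    case True
    then have n1: "norm x > 1" using assms(3) by linarith
    have "M \<le> 2 * real m" unfolding m_def by linarith
    then have "norm x powr M \<le> norm x powr (2 * real m)" using n1 by (intro powr_mono) auto
    also have "\<dots> = norm x ^ (2 * m)" using powr_realpow[of "norm x" "2 * m"] n1 by force
    also have "\<dots> = (x \<bullet> x) ^ m" by (simp add: power_mult power2_norm_eq_inner)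
    finally have "C * norm x powr M \<le> C * (x \<bullet> x) ^ m" using assms(4) by (intro mult_left_mono) auto
    then show ?thesis using assms(6)[OF True] True by (simp add: q_def \<Omega>_def)
  next
    case False
    then show ?thesis using assms(4) by (simp add: q_def \<Omega>_def)
  qed
  have "AE x in lborel. x \<bullet> x \<ge> (R + 1)\<^sup>2 + 1 \<longrightarrow> w x = 0"
  proof (rule vanishes_near_infinity[OF w f weak qm assms(3) _ qb _ _ w2])
    show "0 \<le> C" using assms(4) by simp
    show "AE y in lborel. norm y > R \<longrightarrow> q y \<le> l\<^sup>2 * q (l *\<^sub>R y)" if l: "l > 1" for l
    proof -
      have "AE y in lborel. norm y > R \<longrightarrow> V y \<le> l\<^sup>2 * V (l *\<^sub>R y)"
        by (rule radially_nondecreasing[OF _ assms(5) _ l])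
           (use assms(3) assms(7)[unfolded AE_completion_iff] in auto)
      then show ?thesis
      proof eventually_elim
        case (elim y)
        show ?case
        proof
          assume y: "norm y > R"
          have "1 * norm y \<le> l * norm y" using l by (intro mult_right_mono) auto
          then have "norm (l *\<^sub>R y) > R" using y l by simp
          then show "q y \<le> l\<^sup>2 * q (l *\<^sub>R y)" using elim y by (simp add: q_def \<Omega>_def)
        qed
      qed
    qed
    show "AE x in lborel. norm x > R \<longrightarrow> f x + q x * w x = 0"
      using We by eventually_elim (simp add: f_def q_def \<Omega>_def)
    show "(\<lambda>i. real i ^ p * (\<integral>x. indicator {x. real i \<le> x \<bullet> x} x * (w x)\<^sup>2 \<partial>lborel)) \<longlonglongrightarrow> 0" for p
      by (rule tail_power_decay[OF wm w2 tail])
  qed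
  moreover obtain A where A: "\<And>x. norm x \<le> sqrt ((R + 1)\<^sup>2 + 1) \<Longrightarrow> \<bar>W x\<bar> \<le> A" using Wb by blast
  ultimately have "AE x in lborel. \<bar>f x\<bar> \<le> max A 0 * \<bar>w x\<bar>"
  proof -
    assume "AE x in lborel. x \<bullet> x \<ge> (R + 1)\<^sup>2 + 1 \<longrightarrow> w x = 0"
    then show ?thesis
    proof eventually_elim
      case (elim x)
      show ?case
      proof (cases "x \<bullet> x \<ge> (R + 1)\<^sup>2 + 1")
        case False
        then have "norm x \<le> sqrt ((R + 1)\<^sup>2 + 1)" unfolding norm_eq_sqrt_inner by (intro real_sqrt_le_mono) simp
        from A[OF this] show ?thesis unfolding f_def by (auto simp: abs_mult intro!: mult_right_mono)
      qed (use elim in \<open>simp add: f_def\<close>)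
    qed
  qed
  then have "AE x in lborel. w x = 0"
    using \<open>AE x in lborel. x \<bullet> x \<ge> (R + 1)\<^sup>2 + 1 \<longrightarrow> w x = 0\<close>
    by (intro vanishes_of_compact_support[OF w f weak, of "(R + 1)\<^sup>2 + 1" "max A 0"]) auto
  then have "AE x in lborel. u x = 0" using we by eventually_elim simp
  then show ?thesis by (rule AE_completion)
qed

end
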